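(* Let $n\ge 4$ and let $X$ be an ENR homology $n$-manifold. Then $X$ has the Disjoint Path Concordances Property (DCP) if and only if $X\times\mathbb{R}$ has the Disjoint Disks Property (DDP).
   Context: All maps are continuous. $D$ and $I$ both denote the unit interval $[0,1]$. A homology $n$-manifold is a locally compact metric space $X$ such that $H_*(X,X-\{x\};\mathbb{Z})\cong H_*(\mathbb{R}^n,\mathbb{R}^n-\{\text{origin}\};\mathbb{Z})$ for all $x\in X$. An ENR homology $n$-manifold is a homology $n$-manifold which is homeomorphic to a retract of an open subset of some Euclidean space (ENR = Euclidean neighborhood retract). DDP: a metric space $Y$ has the Disjoint Disks Property if every pair of maps $f_1,f_2\colon I^2\to Y$ can be approximated, arbitrarily closely, by maps $g_1,g_2\colon I^2\to Y$ with $g_1(I^2)\cap g_2(I^2)=\emptyset$. DCP: let $\rho$ be the metric on $X$, and let $\operatorname{proj}_X\colon X\times I\to X$ be the projection. A path homotopy in $X$ is any map $D\times I\to X$. A path concordance in $X$ is a map $F\colon D\times I\to X\times I$ such that $F(D\times\{e\})\subset X\times\{e\}$ for $e\in\{0,1\}$. $(X,\rho)$ has the Disjoint Path Concordances Property if for any two path homotopies $f_1,f_2\colon D\times I\to X$ and any $\epsilon>0$ there exist path concordances $F_1,F_2\colon D\times I\to X\times I$ such that $F_1(D\times I)\cap F_2(D\times I)=\emptyset$ and $\rho(f_i,\operatorname{proj}_X F_i)<\epsilon$ (uniform distance) for $i=1,2$. *)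

theory Defs
  imports "HOL-Analysis.Analysis" "HOL-Homology.Homology"
begin

text \<open>Metric spaces are rendered as sets \<open>X :: 'a::metric_space set\<close> with the metric
  \<^const>\<open>dist\<close> restricted to \<open>X\<close>. The Euclidean space of dimension \<open>n\<close> is the library's
  \<^term>\<open>Euclidean_space n\<close>, in which \<open>n\<close> is a term: a point is a function \<open>nat \<Rightarrow> real\<close> vanishing
  at all indices \<open>i \<ge> n\<close>.\<close>

definition homology_manifold :: "nat \<Rightarrow> 'a::metric_space set \<Rightarrow> bool" where
  "homology_manifold n X \<longleftrightarrow>
     locally_compact_space (top_of_set X) \<and>
     (\<forall>x\<in>X. \<forall>p::int.
        relative_homology_group p (top_of_set X) (X - {x}) \<cong>
        relative_homology_group p (Euclidean_space n) (topspace (Euclidean_space n) - {\<lambda>i. 0}))"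

text \<open>The library's \<^const>\<open>ENR\<close> only speaks about subsets of the ambient type; here the dimension \<open>N\<close>
  of the Euclidean space has to be existentially quantified.\<close>

definition homeomorphic_to_ENR :: "'a::metric_space set \<Rightarrow> bool" where
  "homeomorphic_to_ENR X \<longleftrightarrow>
     (\<exists>N U S. openin (Euclidean_space N) U \<and>
        S retract_of_space (subtopology (Euclidean_space N) U) \<and>
        top_of_set X homeomorphic_space subtopology (Euclidean_space N) S)"

definition ENR_homology_manifold :: "nat \<Rightarrow> 'a::metric_space set \<Rightarrow> bool" where
  "ENR_homology_manifold n X \<longleftrightarrow> homology_manifold n X \<and> homeomorphic_to_ENR X"

abbreviation unit_square :: "(real \<times> real) set" where
  "unit_square \<equiv> {0..1} \<times> {0..1}"

text \<open>The uniform distances below are between continuous maps on the compact square, so they are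
  attained maxima and being \<open>< \<epsilon>\<close> is the pointwise condition.\<close>

definition disjoint_disks_property :: "'a::metric_space set \<Rightarrow> bool" where
  "disjoint_disks_property Y \<longleftrightarrow>
     (\<forall>f1 f2 :: real \<times> real \<Rightarrow> 'a.
        continuous_on unit_square f1 \<and> f1 ` unit_square \<subseteq> Y \<and>
        continuous_on unit_square f2 \<and> f2 ` unit_square \<subseteq> Y \<longrightarrow>
        (\<forall>\<epsilon>>0. \<exists>g1 g2 :: real \<times> real \<Rightarrow> 'a.
           continuous_on unit_square g1 \<and> g1 ` unit_square \<subseteq> Y \<and>
           continuous_on unit_square g2 \<and> g2 ` unit_square \<subseteq> Y \<and>
           (\<forall>z\<in>unit_square. dist (f1 z) (g1 z) < \<epsilon>) \<and>
           (\<forall>z\<in>unit_square. dist (f2 z) (g2 z) < \<epsilon>) \<and>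
           g1 ` unit_square \<inter> g2 ` unit_square = {}))"

definition path_homotopy :: "'a::metric_space set \<Rightarrow> (real \<times> real \<Rightarrow> 'a) \<Rightarrow> bool" where
  "path_homotopy X f \<longleftrightarrow> continuous_on unit_square f \<and> f ` unit_square \<subseteq> X"

definition path_concordance ::
    "'a::metric_space set \<Rightarrow> (real \<times> real \<Rightarrow> 'a \<times> real) \<Rightarrow> bool" where
  "path_concordance X F \<longleftrightarrow>
     continuous_on unit_square F \<and> F ` unit_square \<subseteq> X \<times> {0..1} \<and>
     (\<forall>e\<in>{0,1}. F ` ({0..1} \<times> {e}) \<subseteq> X \<times> {e})"

definition disjoint_path_concordances_property :: "'a::metric_space set \<Rightarrow> bool" where
  "disjoint_path_concordances_property X \<longleftrightarrow>
     (\<forall>f1 f2. path_homotopy X f1 \<and> path_homotopy X f2 \<longrightarrow>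
        (\<forall>\<epsilon>>0. \<exists>F1 F2. path_concordance X F1 \<and> path_concordance X F2 \<and>
           F1 ` unit_square \<inter> F2 ` unit_square = {} \<and>
           (\<forall>z\<in>unit_square. dist (f1 z) (fst (F1 z)) < \<epsilon>) \<and>
           (\<forall>z\<in>unit_square. dist (f2 z) (fst (F2 z)) < \<epsilon>)))"

end

theory Submission
  imports Defs
begin

text \<open>
  Throughout, \<open>X\<close> embeds in a Euclidean space as a retract of an open set \<open>U\<close>. The retraction
  turns small perturbations of a map on a closed part of its domain into small perturbations of
  the whole map: extend the coordinates of the displacement by Tietze and retract
  (\<open>ENR_controlled_extension\<close>). The other tools are Brouwer's fixed point theorem in the plane,
  compactness, and a property implied by both sides of the equivalence: two paths in \<open>X\<close> can be
  pushed apart (\<open>disjoint_paths_property\<close>). With controlled extension, this makes the images of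
  finitely many pairs of arcs in the domains of two disks disjoint
  (\<open>separate_finitely_many_arcs\<close>).

  The property follows from disjoint concordances by looking at one end of concordances between
  constant homotopies. To get it from disjoint disks in \<open>X \<times> \<real>\<close>, make the vertical walls over the
  two paths disjoint. Their parts at heights near \<open>1/2\<close> have disjoint projections to \<open>X\<close>, and
  these projections contain paths following each subinterval of the original paths, because by
  Brouwer a horizontal level in a wall crosses it from left to right (\<open>level_crossing_path\<close>).
  Short paths in small balls around the points of a mesh join the pieces
  (\<open>DDP_imp_disjoint_paths\<close>).

  \<^emph>\<open>From disks to concordances.\<close> Separate the ends of the two homotopies, regard a homotopy \<open>a\<close> as
  the disk \<open>z \<mapsto> (a z, snd z)\<close> in \<open>X \<times> \<real>\<close>, make the two disks disjoint, and damp the change of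
  height near the ends, where the disks were already apart (\<open>DDP_imp_DCP\<close>).

  \<^emph>\<open>From concordances to disks.\<close> Stretching the line reduces the claim to a coarse version in
  which the heights of the two disks may change by a bounded amount, only their \<open>X\<close>-components
  being controlled (\<open>DCP_disjoint_disks_coarse\<close>). There is then freedom to redesign the heights. A
  height \<open>H i\<close> is chosen whose integer level sets are finite unions of short arcs, and the domain
  is cut into cells by a grid. The level sets and grid lines of the two disks get disjoint images
  in \<open>X\<close>, so a possible intersection always involves a point of one disk inside a cell, between
  two integer levels. The new height of the first disk is constant there, all these constants are
  far apart from each other, and they are placed so that the second disk can attain such a height
  only in a narrow strip along one of its own integer levels. The relevant part of that strip is
  embedded in the unit square by a coordinate and the height, so the strip is a path homotopy,
  with time as its height. Disjoint concordances for the first disk and this homotopy resolve the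
  intersections at this height, without changing the heights at the two ends of the strip; since
  the strips for different constants are disjoint, all these modifications fit together
  (\<open>cell_against_strip\<close>, \<open>concordance_assembly\<close>).
\<close>

section \<open>Perturbing maps into a Euclidean neighborhood retract\<close>

text \<open>Uniform continuity of \<open>f\<close> at the points of a compact set, with one of the two points allowed
  to leave the set: a Lebesgue number of a cover of \<open>K\<close> by balls serves for all of \<open>K\<close>.\<close>

lemma uniformly_near_compact:
  fixes f :: "'a::metric_space \<Rightarrow> 'b::metric_space"
  assumes f: "continuous_on U f" and U: "openin (top_of_set L) U"
    and K: "compact K" "K \<subseteq> U" and e: "0 < e"
  obtains d where "0 < d"
    "\<And>p y. p \<in> K \<Longrightarrow> y \<in> L \<Longrightarrow> dist y p < d \<Longrightarrow> y \<in> U \<and> dist (f y) (f p) < e"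
proof -
  have "\<exists>d>0. \<forall>y\<in>L. dist y p < 2 * d \<longrightarrow> y \<in> U \<and> dist (f y) (f p) < e / 2" if "p \<in> K" for p
  proof -
    have pU: "p \<in> U" using that K(2) by blast
    obtain d1 where d1: "d1 > 0" "ball p d1 \<inter> L \<subseteq> U"
      using bspec[OF conjunct2[OF U[unfolded openin_contains_ball]] pU] by blast
    obtain d2 where d2: "d2 > 0" "\<And>y. y \<in> U \<Longrightarrow> dist y p < d2 \<Longrightarrow> dist (f y) (f p) < e / 2"
      using f[unfolded continuous_on_iff, rule_format, OF pU, of "e / 2"] e by auto
    show ?thesis
    proof (intro exI conjI ballI impI)
      show "min d1 d2 / 2 > 0" using d1 d2 by simp
      fix y assume y: "y \<in> L" "dist y p < 2 * (min d1 d2 / 2)"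
      then show "y \<in> U" using d1 by (auto simp: dist_commute subset_iff)
      then show "dist (f y) (f p) < e / 2" using y d2 by auto
    qed
  qed
  then obtain d where d: "\<And>p. p \<in> K \<Longrightarrow> d p > 0"
    "\<And>p y. p \<in> K \<Longrightarrow> y \<in> L \<Longrightarrow> dist y p < 2 * d p \<Longrightarrow> y \<in> U \<and> dist (f y) (f p) < e / 2"
    by metis
  obtain P where P: "P \<subseteq> K" "finite P" "K \<subseteq> (\<Union>p\<in>P. ball p (d p))"
  proof (rule compactE_image[OF K(1), of K "\<lambda>p. ball p (d p)"])
    show "K \<subseteq> (\<Union>p\<in>K. ball p (d p))" using d(1) by force
  qed auto
  define m where "m = Min (insert 1 (d ` P))"
  have m: "m > 0" "\<And>p. p \<in> P \<Longrightarrow> m \<le> d p"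
    using P d(1) unfolding m_def by auto
  show ?thesis
  proof (rule that[OF m(1)])
    fix p y assume A: "p \<in> K" "y \<in> L" "dist y p < m"
    then obtain q where q: "q \<in> P" "dist q p < d q" using P by auto
    have qK: "q \<in> K" using q P by auto
    have "dist y q < 2 * d q"
      using dist_triangle[of y q p] A q m(2)[OF q(1)] by (simp add: dist_commute)
    then have 1: "y \<in> U \<and> dist (f y) (f q) < e / 2" using d(2) qK A by blast
    have "p \<in> L" using A K U openin_imp_subset by blast
    moreover have "dist p q < 2 * d q"
      using q(2) d(1)[OF qK] by (simp add: dist_commute)
    ultimately have "dist (f p) (f q) < e / 2" using d(2) qK by blast
    then show "y \<in> U \<and> dist (f y) (f p) < e"
      using 1 dist_triangle_half_r[of "f q" "f y" e "f p"] by (simp add: dist_commute)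
  qed
qed

lemma compact_pos_lower_bound:
  fixes f :: "'a::topological_space \<Rightarrow> real"
  assumes "compact K" "continuous_on K f" "\<And>x. x \<in> K \<Longrightarrow> 0 < f x"
  obtains m where "0 < m" "\<And>x. x \<in> K \<Longrightarrow> m \<le> f x"
proof (cases "K = {}")
  case True
  then show ?thesis using that[of 1] by auto
next
  case False
  then obtain x where "x \<in> K" "\<forall>y\<in>K. f x \<le> f y"
    using continuous_attains_inf[OF assms(1) _ assms(2)] by blast
  then show ?thesis using that[of "f x"] assms(3) by auto
qed

lemma finite_closed_pasting:
  fixes f :: "'i \<Rightarrow> 'a::topological_space \<Rightarrow> 'b::topological_space"
  assumes "finite I" "\<And>i. i \<in> I \<Longrightarrow> closed (B i)" "\<And>i. i \<in> I \<Longrightarrow> continuous_on (B i) (f i)"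
    and "\<And>i j x. i \<in> I \<Longrightarrow> j \<in> I \<Longrightarrow> x \<in> B i \<Longrightarrow> x \<in> B j \<Longrightarrow> f i x = f j x"
  obtains g where "continuous_on (\<Union>i\<in>I. B i) g" "\<And>i x. i \<in> I \<Longrightarrow> x \<in> B i \<Longrightarrow> g x = f i x"
proof -
  define g where "g x = f (SOME i. i \<in> I \<and> x \<in> B i) x" for x
  have g: "g x = f i x" if "i \<in> I" "x \<in> B i" for i x
  proof -
    have "(SOME i. i \<in> I \<and> x \<in> B i) \<in> I \<and> x \<in> B (SOME i. i \<in> I \<and> x \<in> B i)"
      using that by (intro someI[of "\<lambda>i. i \<in> I \<and> x \<in> B i"]) auto
    then show ?thesis unfolding g_def using assms(4) that by blast
  qed
  have "continuous_on (\<Union>(B ` I)) g"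
  proof (rule continuous_on_closed_Union)
    fix i assume i: "i \<in> I"
    show "continuous_on (B i) g"
      using assms(3)[OF i] g[OF i] by (simp cong: continuous_on_cong)
  qed (use assms(1,2) in blast)+
  then show ?thesis using that g by blast
qed

text \<open>The metric on \<^typ>\<open>nat \<Rightarrow> real\<close> is a weighted sum over the coordinates whose weights add up to
  2.\<close>

lemma fun_dist_le:
  fixes x y :: "nat \<Rightarrow> real"
  assumes "\<And>i. \<bar>x i - y i\<bar> \<le> c"
  shows "dist x y \<le> 2 * c"
proof -
  have s: "summable (\<lambda>n. (1/2)^n * c :: real)" by (intro summable_mult2 summable_geometric) auto
  have "dist x y \<le> suminf (\<lambda>n. (1/2)^n * c)"
    unfolding dist_fun_def
  proof (rule suminf_le)
    show "(1/2)^n * min (dist (x (from_nat n)) (y (from_nat n))) 1 \<le> (1/2)^n * c" for n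
      using assms[of "from_nat n"] by (intro mult_left_mono) (auto simp: dist_real_def)
    show "summable (\<lambda>n. (1/2)^n * min (dist (x (from_nat n)) (y (from_nat n))) 1)"
      by (rule summable_comparison_test'[of "\<lambda>n. (1/2)^n"]) (auto simp: summable_geometric_iff)
  qed (rule s)
  also have "\<dots> = 2 * c" using suminf_mult2[of "\<lambda>n. (1/2)^n" c] suminf_geometric[of "1/2::real"]
    by (simp add: summable_geometric_iff)
  finally show ?thesis .
qed

text \<open>For finitely many coordinates the smallest of their weights gives a uniform estimate in the
  direction opposite to the preceding lemma.\<close>

lemma fun_coordinates_uniform:
  fixes c :: real
  assumes "0 < c"
  obtains d where "0 < d"
    "\<And>(x :: nat \<Rightarrow> real) y i. dist x y < d \<Longrightarrow> i < N \<Longrightarrow> \<bar>x i - y i\<bar> \<le> c"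
proof -
  define d where "d = Min (insert 1 ((\<lambda>i::nat. (1/2)^(to_nat i) * min c (1/2)) ` {..<N}))"
  have "0 < d" using assms unfolding d_def by auto
  moreover have "\<bar>x i - y i\<bar> \<le> c" if "dist x y < d" "i < N" for x y :: "nat \<Rightarrow> real" and i
  proof -
    have "(\<Sum>n\<in>{to_nat i}. (1/2)^n * min (dist (x (from_nat n)) (y (from_nat n))) 1) \<le> dist x y"
      unfolding dist_fun_def
      by (rule sum_le_suminf, rule summable_comparison_test'[of "\<lambda>n. (1/2)^n"])
         (auto simp: summable_geometric_iff)
    then have "(1/2)^(to_nat i) * min \<bar>x i - y i\<bar> 1 \<le> dist x y" by (simp add: dist_real_def)
    also have "\<dots> < d" by fact
    also have "d \<le> (1/2)^(to_nat i) * min c (1/2)" unfolding d_def using that(2) by (intro Min_le) auto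
    finally show ?thesis by (auto simp: min_def split: if_splits)
  qed
  ultimately show ?thesis by (rule that)
qed

lemma ENR_retraction:
  fixes X :: "'a::metric_space set"
  assumes "homeomorphic_to_ENR X"
  obtains N U and \<phi> :: "'a \<Rightarrow> nat \<Rightarrow> real" and \<rho> where
    "openin (top_of_set {x. \<forall>i\<ge>N. x i = 0}) U" "continuous_on X \<phi>" "\<phi> ` X \<subseteq> U"
    "continuous_on U \<rho>" "\<rho> ` U \<subseteq> X" "\<And>x. x \<in> X \<Longrightarrow> \<rho> (\<phi> x) = x"
proof -
  obtain N U S where U: "openin (Euclidean_space N) U"
    and S: "S retract_of_space (subtopology (Euclidean_space N) U)"
    and h: "top_of_set X homeomorphic_space subtopology (Euclidean_space N) S"
    using assms unfolding homeomorphic_to_ENR_def by blast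
  let ?L = "{x :: nat \<Rightarrow> real. \<forall>i\<ge>N. x i = 0}"
  have E: "Euclidean_space N = top_of_set ?L"
    by (simp add: Euclidean_space_def euclidean_product_topology)
  have UL: "U \<subseteq> ?L" using U openin_imp_subset unfolding E by blast
  have SU: "S \<subseteq> U" using retract_of_space_imp_subset[OF S] by auto
  obtain r where r: "continuous_map (subtopology (Euclidean_space N) U)
      (subtopology (subtopology (Euclidean_space N) U) S) r" "\<And>x. x \<in> S \<Longrightarrow> r x = x"
    using S unfolding retract_of_space_def by blast
  have LU: "?L \<inter> U = U" "?L \<inter> S = S" "U \<inter> S = S" using UL SU by auto
  have r': "continuous_on U r" "r ` U \<subseteq> S"
    using r(1) unfolding E subtopology_subtopology LU
    by (auto simp: continuous_map_in_subtopology)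
  obtain \<phi> \<psi> where "homeomorphic_maps (top_of_set X) (top_of_set S) \<phi> \<psi>"
    using h unfolding E subtopology_subtopology LU homeomorphic_space_def by blast
  then have m: "continuous_on X \<phi>" "\<phi> ` X \<subseteq> S" "continuous_on S \<psi>" "\<psi> ` S \<subseteq> X"
      "\<And>x. x \<in> X \<Longrightarrow> \<psi> (\<phi> x) = x"
    unfolding homeomorphic_maps_def by (auto simp: continuous_map_in_subtopology)
  show ?thesis
  proof (rule that[of N U \<phi> "\<psi> \<circ> r"])
    show "continuous_on U (\<psi> \<circ> r)"
      using r' m(3) by (intro continuous_on_compose) (auto intro: continuous_on_subset)
    show "(\<psi> \<circ> r) ` U \<subseteq> X" using r' m(4) by force
    show "(\<psi> \<circ> r) (\<phi> x) = x" if "x \<in> X" for x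
      using that m r(2) by (simp add: image_subset_iff)
  qed (use U E m SU in auto)
qed

text \<open>In Euclidean space, the displacement from \<open>a\<close> to \<open>w\<close> extends from \<open>A\<close> to \<open>Z\<close> without
  growing, by Tietze's theorem for each coordinate; the retraction brings the displaced map back
  into \<open>X\<close>. The number \<open>d\<close> depends on the compact set \<open>K\<close> and on \<open>e\<close> but not on the maps, because
  the estimates for embedding and retraction are uniform near \<open>K\<close>.\<close>

lemma ENR_controlled_extension:
  fixes X :: "'a::metric_space set"
  assumes X: "homeomorphic_to_ENR X" and K: "compact K" "K \<subseteq> X" and e: "0 < e"
  shows "\<exists>d>0. \<forall>(Z :: 'b::{metric_space,second_countable_topology} set) A a w.
       continuous_on Z a \<and> a ` Z \<subseteq> K \<and> closedin (top_of_set Z) A \<and> continuous_on A w \<and> w ` A \<subseteq> X \<and>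
       (\<forall>z\<in>A. dist (a z) (w z) < d) \<longrightarrow>
       (\<exists>b. continuous_on Z b \<and> b ` Z \<subseteq> X \<and> (\<forall>z\<in>A. b z = w z) \<and> (\<forall>z\<in>Z. dist (a z) (b z) < e))"
proof -
  obtain N U and \<phi> :: "'a \<Rightarrow> nat \<Rightarrow> real" and \<rho> where
    U: "openin (top_of_set {x. \<forall>i\<ge>N. x i = 0}) U" and \<phi>: "continuous_on X \<phi>" "\<phi> ` X \<subseteq> U"
    and \<rho>: "continuous_on U \<rho>" "\<rho> ` U \<subseteq> X" "\<And>x. x \<in> X \<Longrightarrow> \<rho> (\<phi> x) = x"
    by (rule ENR_retraction[OF X]) (rule that; assumption)
  let ?L = "{x :: nat \<Rightarrow> real. \<forall>i\<ge>N. x i = 0}"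
  have UL: "U \<subseteq> ?L" using U openin_imp_subset by blast
  have "compact (\<phi> ` K)" "\<phi> ` K \<subseteq> U"
    using K \<phi> by (auto intro!: compact_continuous_image elim: continuous_on_subset)
  then obtain d1 where d1: "0 < d1"
    "\<And>p y. p \<in> \<phi> ` K \<Longrightarrow> y \<in> ?L \<Longrightarrow> dist y p < d1 \<Longrightarrow> y \<in> U \<and> dist (\<rho> y) (\<rho> p) < e"
    by (rule uniformly_near_compact[OF \<rho>(1) U _ _ e]) blast
  \<comment> \<open>an error of \<open>c\<close> in every coordinate is an error of at most \<open>2 * c < d1\<close> in the metric\<close>
  define c where "c = min (d1 / 3) (1/2)"
  have c: "0 < c" "c < 1" "2 * c < d1" using d1(1) unfolding c_def by auto
  obtain c' where c': "0 < c'"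
    "\<And>(x :: nat \<Rightarrow> real) y i. dist x y < c' \<Longrightarrow> i < N \<Longrightarrow> \<bar>x i - y i\<bar> \<le> c"
    using fun_coordinates_uniform[OF c(1)] by blast
  obtain d where d: "0 < d"
    "\<And>p y. p \<in> K \<Longrightarrow> y \<in> X \<Longrightarrow> dist y p < d \<Longrightarrow> y \<in> X \<and> dist (\<phi> y) (\<phi> p) < c'"
    by (rule uniformly_near_compact[OF \<phi>(1) openin_subtopology_self K c'(1)]) (rule that; assumption)
  have coord: "\<bar>\<phi> y i - \<phi> p i\<bar> \<le> c" if "p \<in> K" "y \<in> X" "dist p y < d" "i < N" for p y i
    using c'(2) d(2) that by (simp add: dist_commute)
  show ?thesis
  proof (intro exI[of _ d] conjI allI impI d(1); elim conjE)
    fix Z A :: "'b set" and a w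
    assume a: "continuous_on Z a" "a ` Z \<subseteq> K" and A: "closedin (top_of_set Z) A"
      and w: "continuous_on A w" "w ` A \<subseteq> X" and "\<forall>z\<in>A. dist (a z) (w z) < d"
    then have w3: "\<And>z. z \<in> A \<Longrightarrow> dist (a z) (w z) < d" by blast
    have AZ: "A \<subseteq> Z" using A closedin_imp_subset by blast
    have aX: "a ` Z \<subseteq> X" using a K by blast
    have c\<phi>a: "continuous_on Z (\<lambda>z. \<phi> (a z))"
      using continuous_on_compose2[OF \<phi>(1) a(1) aX] .
    have c\<phi>w: "continuous_on A (\<lambda>z. \<phi> (w z))"
      using continuous_on_compose2[OF \<phi>(1) w(1,2)] .
    have "\<exists>g. continuous_on Z g \<and> (\<forall>z\<in>A. g z = \<phi> (w z) i - \<phi> (a z) i) \<and> (\<forall>z\<in>Z. norm (g z) \<le> c)"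
      if i: "i < N" for i
    proof -
      have c: "continuous_on A (\<lambda>z. \<phi> (w z) i - \<phi> (a z) i)"
        using c\<phi>w continuous_on_subset[OF c\<phi>a AZ]
        by (intro continuous_on_diff) (auto intro: continuous_on_product_then_coordinatewise)
      have n: "norm (\<phi> (w z) i - \<phi> (a z) i) \<le> c" if "z \<in> A" for z
        using coord[OF _ _ w3[OF that] i] that w(2) a(2) AZ by auto
      obtain g where "continuous_on Z g" "\<And>z. z \<in> A \<Longrightarrow> g z = \<phi> (w z) i - \<phi> (a z) i"
        "\<And>z. z \<in> Z \<Longrightarrow> norm (g z) \<le> c"
        by (rule Tietze[OF c A less_imp_le[OF \<open>0 < c\<close>] n]) (assumption, rule that)
      then show ?thesis by blast
    qed
    then obtain g where g: "\<And>i. i < N \<Longrightarrow> continuous_on Z (g i)"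
      "\<And>i z. i < N \<Longrightarrow> z \<in> A \<Longrightarrow> g i z = \<phi> (w z) i - \<phi> (a z) i"
      "\<And>i z. i < N \<Longrightarrow> z \<in> Z \<Longrightarrow> \<bar>g i z\<bar> \<le> c"
      unfolding real_norm_def by (metis (no_types))
    \<comment> \<open>coordinates from \<open>N\<close> on are left alone, so \<open>y z\<close> stays in the Euclidean space of dimension
      \<open>N\<close>\<close>
    define y where "y z i = \<phi> (a z) i + (if i < N then g i z else 0)" for z i
    have cy: "continuous_on Z y"
    proof (rule continuous_on_coordinatewise_then_product)
      fix i
      have "continuous_on Z (\<lambda>z. \<phi> (a z) i)"
        using continuous_on_product_then_coordinatewise[OF c\<phi>a] .
      then show "continuous_on Z (\<lambda>z. y z i)"
        unfolding y_def using g(1)[of i] by (cases "i < N") (auto intro: continuous_on_add)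
    qed
    have near: "y z \<in> U \<and> dist (\<rho> (y z)) (a z) < e" if z: "z \<in> Z" for z
    proof -
      have "\<phi> (a z) \<in> ?L" using z aX \<phi>(2) UL by blast
      then have "y z \<in> ?L" unfolding y_def by auto
      moreover have "dist (y z) (\<phi> (a z)) \<le> 2 * c"
        by (rule fun_dist_le) (use g(3) z c in \<open>auto simp: y_def\<close>)
      moreover have "\<phi> (a z) \<in> \<phi> ` K" "\<rho> (\<phi> (a z)) = a z" using z a(2) aX \<rho>(3) by auto
      ultimately show ?thesis
        using d1(2)[of "\<phi> (a z)" "y z"] c by auto
    qed
    have yw: "y z = \<phi> (w z)" if "z \<in> A" for z
    proof
      fix i
      have "\<phi> (a z) \<in> ?L" "\<phi> (w z) \<in> ?L" using that aX AZ \<phi>(2) UL w(2) by blast+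
      then show "y z i = \<phi> (w z) i" using g(2) that by (auto simp: y_def)
    qed
    show "\<exists>b. continuous_on Z b \<and> b ` Z \<subseteq> X \<and> (\<forall>z\<in>A. b z = w z) \<and> (\<forall>z\<in>Z. dist (a z) (b z) < e)"
    proof (intro exI conjI ballI)
      show "continuous_on Z (\<lambda>z. \<rho> (y z))"
        using continuous_on_compose2[OF \<rho>(1) cy] near by blast
      show "(\<lambda>z. \<rho> (y z)) ` Z \<subseteq> X" using near \<rho>(2) by blast
      show "\<rho> (y z) = w z" if "z \<in> A" for z using that yw \<rho>(3) w(2) by auto
      show "dist (a z) (\<rho> (y z)) < e" if "z \<in> Z" for z using near that by (simp add: dist_commute)
    qed
  qed
qed

section \<open>Pushing arcs of two disks apart\<close>

definition disjoint_paths_property :: "'a::metric_space set \<Rightarrow> bool" where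
  "disjoint_paths_property X \<longleftrightarrow>
     (\<forall>(\<alpha>1 :: real \<Rightarrow> 'a) (\<alpha>2 :: real \<Rightarrow> 'a).
        continuous_on {0..1} \<alpha>1 \<and> \<alpha>1 ` {0..1} \<subseteq> X \<and>
        continuous_on {0..1} \<alpha>2 \<and> \<alpha>2 ` {0..1} \<subseteq> X \<longrightarrow>
        (\<forall>\<epsilon>>0. \<exists>(\<beta>1 :: real \<Rightarrow> 'a) (\<beta>2 :: real \<Rightarrow> 'a).
           continuous_on {0..1} \<beta>1 \<and> \<beta>1 ` {0..1} \<subseteq> X \<and>
           continuous_on {0..1} \<beta>2 \<and> \<beta>2 ` {0..1} \<subseteq> X \<and>
           (\<forall>t\<in>{0..1}. dist (\<alpha>1 t) (\<beta>1 t) < \<epsilon>) \<and>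
           (\<forall>t\<in>{0..1}. dist (\<alpha>2 t) (\<beta>2 t) < \<epsilon>) \<and>
           \<beta>1 ` {0..1} \<inter> \<beta>2 ` {0..1} = {}))"

text \<open>The two disks of every statement are indexed by \<^typ>\<open>bool\<close>, so that a construction for one disk
  and the other one, \<open>i\<close> and \<open>\<not> i\<close>, is written once.\<close>

definition disk_pair :: "'a::metric_space set \<Rightarrow> (bool \<Rightarrow> real \<times> real \<Rightarrow> 'a) \<Rightarrow> bool" where
  "disk_pair X a \<longleftrightarrow> (\<forall>i. continuous_on unit_square (a i) \<and> a i ` unit_square \<subseteq> X)"

definition close_pairs ::
    "real \<Rightarrow> (bool \<Rightarrow> real \<times> real \<Rightarrow> 'a::metric_space) \<Rightarrow> (bool \<Rightarrow> real \<times> real \<Rightarrow> 'a) \<Rightarrow> bool" where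
  "close_pairs e a b \<longleftrightarrow> (\<forall>i. \<forall>z\<in>unit_square. dist (a i z) (b i z) < e)"

text \<open>A compact set that embeds in the interval. It need not be connected; what matters is that a
  map defined on it factors through a path, by extending the inverse of the embedding.\<close>

definition arc_like :: "(real \<times> real) set \<Rightarrow> bool" where
  "arc_like A \<longleftrightarrow> compact A \<and> A \<subseteq> unit_square \<and>
     (\<exists>q :: real \<times> real \<Rightarrow> real. continuous_on A q \<and> q ` A \<subseteq> {0..1} \<and> inj_on q A)"

lemma disjoint_paths_propertyE:
  fixes \<alpha>1 \<alpha>2 :: "real \<Rightarrow> 'a::metric_space"
  assumes "disjoint_paths_property X"
    and "continuous_on {0..1} \<alpha>1" "\<alpha>1 ` {0..1} \<subseteq> X" "continuous_on {0..1} \<alpha>2" "\<alpha>2 ` {0..1} \<subseteq> X"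
    and "0 < e"
  obtains \<beta>1 \<beta>2 where "continuous_on {0..1} \<beta>1" "\<beta>1 ` {0..1} \<subseteq> X"
      "continuous_on {0..1} \<beta>2" "\<beta>2 ` {0..1} \<subseteq> X"
      "\<And>t. t \<in> {0..1} \<Longrightarrow> dist (\<alpha>1 t) (\<beta>1 t) < e"
      "\<And>t. t \<in> {0..1} \<Longrightarrow> dist (\<alpha>2 t) (\<beta>2 t) < e"
      "\<beta>1 ` {0..1} \<inter> \<beta>2 ` {0..1} = {}"
proof -
  have "\<exists>(\<beta>1 :: real \<Rightarrow> 'a) (\<beta>2 :: real \<Rightarrow> 'a).
           continuous_on {0..1} \<beta>1 \<and> \<beta>1 ` {0..1} \<subseteq> X \<and>
           continuous_on {0..1} \<beta>2 \<and> \<beta>2 ` {0..1} \<subseteq> X \<and>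
           (\<forall>t\<in>{0..1}. dist (\<alpha>1 t) (\<beta>1 t) < e) \<and>
           (\<forall>t\<in>{0..1}. dist (\<alpha>2 t) (\<beta>2 t) < e) \<and>
           \<beta>1 ` {0..1} \<inter> \<beta>2 ` {0..1} = {}"
    using assms unfolding disjoint_paths_property_def by simp
  then show ?thesis
    by (elim exE conjE) (rule that; simp)
qed

lemma compact_unit_square: "compact unit_square"
  by (intro compact_Times compact_Icc)

lemma convex_unit_square: "convex unit_square"
  by (intro convex_Times convex_real_interval)

lemma close_pairs_trans:
  assumes "close_pairs d a b" "close_pairs e b c"
  shows "close_pairs (d + e) a c"
  unfolding close_pairs_def
proof (intro allI ballI)
  fix i z assume "z \<in> unit_square"
  then have "dist (a i z) (b i z) < d" "dist (b i z) (c i z) < e"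
    using assms unfolding close_pairs_def by blast+
  then show "dist (a i z) (c i z) < d + e"
    using dist_triangle[of "a i z" "c i z" "b i z"] by linarith
qed

lemma close_pairs_mono: "close_pairs d a b \<Longrightarrow> d \<le> e \<Longrightarrow> close_pairs e a b"
  unfolding close_pairs_def using order_less_le_trans by blast

lemma disk_pair_compact_image:
  assumes "disk_pair X a"
  shows "compact (\<Union>i. a i ` unit_square)" "(\<Union>i. a i ` unit_square) \<subseteq> X"
proof -
  have "compact (a i ` unit_square)" for i
    using assms unfolding disk_pair_def by (intro compact_continuous_image compact_unit_square) auto
  then show "compact (\<Union>i. a i ` unit_square)" by (intro compact_UN) auto
  show "(\<Union>i. a i ` unit_square) \<subseteq> X" using assms unfolding disk_pair_def by blast
qed

lemma disk_pair_extension: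
  assumes X: "homeomorphic_to_ENR X" and a: "disk_pair X a" and e: "0 < e"
  shows "\<exists>d>0. \<forall>(A :: bool \<Rightarrow> _) w.
       (\<forall>i. compact (A i) \<and> A i \<subseteq> unit_square \<and> continuous_on (A i) (w i) \<and> w i ` A i \<subseteq> X \<and>
         (\<forall>z\<in>A i. dist (a i z) (w i z) < d)) \<longrightarrow>
       (\<exists>b. disk_pair X b \<and> close_pairs e a b \<and> (\<forall>i. \<forall>z\<in>A i. b i z = w i z))"
proof -
  obtain d where d: "0 < d"
    "\<forall>(Z :: (real \<times> real) set) A a' w. continuous_on Z a' \<and> a' ` Z \<subseteq> (\<Union>i. a i ` unit_square) \<and>
        closedin (top_of_set Z) A \<and> continuous_on A w \<and> w ` A \<subseteq> X \<and>
        (\<forall>z\<in>A. dist (a' z) (w z) < d) \<longrightarrow>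
       (\<exists>b. continuous_on Z b \<and> b ` Z \<subseteq> X \<and> (\<forall>z\<in>A. b z = w z) \<and> (\<forall>z\<in>Z. dist (a' z) (b z) < e))"
    using ENR_controlled_extension[where 'b = "real \<times> real", OF X disk_pair_compact_image[OF a] e]
    by (elim exE conjE) (rule that)
  show ?thesis
  proof (intro exI[of _ d] conjI allI impI d(1))
    fix A :: "bool \<Rightarrow> (real \<times> real) set" and w
    assume A: "\<forall>i. compact (A i) \<and> A i \<subseteq> unit_square \<and> continuous_on (A i) (w i) \<and> w i ` A i \<subseteq> X \<and>
         (\<forall>z\<in>A i. dist (a i z) (w i z) < d)"
    have "\<exists>b. continuous_on unit_square b \<and> b ` unit_square \<subseteq> X \<and> (\<forall>z\<in>A i. b z = w i z) \<and>
        (\<forall>z\<in>unit_square. dist (a i z) (b z) < e)" for i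
    proof (rule d(2)[rule_format], intro conjI)
      show "closedin (top_of_set unit_square) (A i)"
        using A by (intro closed_subset compact_imp_closed) auto
    qed (use a A in \<open>auto simp: disk_pair_def\<close>)
    then obtain b where b: "\<And>i. continuous_on unit_square (b i) \<and> b i ` unit_square \<subseteq> X \<and>
        (\<forall>z\<in>A i. b i z = w i z) \<and> (\<forall>z\<in>unit_square. dist (a i z) (b i z) < e)"
      by metis
    show "\<exists>b. disk_pair X b \<and> close_pairs e a b \<and> (\<forall>i. \<forall>z\<in>A i. b i z = w i z)"
      using b unfolding disk_pair_def close_pairs_def by blast
  qed
qed

text \<open>The inverse of an embedding of a compact subset of the square extends to the whole target
  because the square is an absolute extensor (Dugundji). The extension turns a map of the subset
  into a map of an interval or of a square.\<close>

lemma inverse_extension: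
  fixes \<Psi> :: "real \<times> real \<Rightarrow> 'b::{metric_space,second_countable_topology}"
  assumes K: "compact K" "K \<subseteq> unit_square" and \<Psi>: "continuous_on K \<Psi>" "inj_on \<Psi> K"
  obtains \<Phi> where "continuous_on UNIV \<Phi>" "range \<Phi> \<subseteq> unit_square" "\<And>z. z \<in> K \<Longrightarrow> \<Phi> (\<Psi> z) = z"
proof -
  have c: "continuous_on (\<Psi> ` K) (inv_into K \<Psi>)"
    using continuous_on_inv[OF \<Psi>(1) K(1), of "inv_into K \<Psi>"] \<Psi>(2) by simp
  have cl: "closedin (top_of_set UNIV) (\<Psi> ` K)"
    using compact_imp_closed[OF compact_continuous_image[OF \<Psi>(1) K(1)]] by simp
  have im: "inv_into K \<Psi> ` \<Psi> ` K \<subseteq> unit_square"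
    using K(2) \<Psi>(2) by (auto simp: inv_into_f_f)
  have ne: "unit_square \<noteq> {}" by auto
  obtain g where "continuous_on UNIV g" "g ` UNIV \<subseteq> unit_square"
     "\<And>x. x \<in> \<Psi> ` K \<Longrightarrow> g x = inv_into K \<Psi> x"
    by (rule Dugundji[OF convex_unit_square ne cl c im]) (rule that; assumption)
  then show ?thesis using that \<Psi>(2) by auto
qed

text \<open>Along the extended inverses of their embeddings the arcs carry paths in \<open>X\<close>. These can be
  made disjoint, and the perturbation, first defined on the arcs only, extends to the disks.\<close>

lemma separate_arcs:
  assumes X: "homeomorphic_to_ENR X" and dap: "disjoint_paths_property X"
    and a: "disk_pair X a" and A: "arc_like A" and A': "arc_like A'"
    and disj: "i = i' \<Longrightarrow> A \<inter> A' = {}" and e: "0 < e"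
  shows "\<exists>b. disk_pair X b \<and> close_pairs e a b \<and> b i ` A \<inter> b i' ` A' = {}"
proof -
  obtain q :: "real \<times> real \<Rightarrow> real" where q: "continuous_on A q" "q ` A \<subseteq> {0..1}" "inj_on q A"
    using A unfolding arc_like_def by (elim conjE exE) (rule that; assumption)
  obtain q' :: "real \<times> real \<Rightarrow> real" where q': "continuous_on A' q'" "q' ` A' \<subseteq> {0..1}" "inj_on q' A'"
    using A' unfolding arc_like_def by (elim conjE exE) (rule that; assumption)
  have cA: "compact A" "A \<subseteq> unit_square" "compact A'" "A' \<subseteq> unit_square"
    using A A' unfolding arc_like_def by auto
  obtain p where p: "continuous_on UNIV p" "range p \<subseteq> unit_square" "\<And>z. z \<in> A \<Longrightarrow> p (q z) = z"
    by (rule inverse_extension[OF cA(1,2) q(1,3)]) (rule that; assumption)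
  obtain p' where p': "continuous_on UNIV p'" "range p' \<subseteq> unit_square" "\<And>z. z \<in> A' \<Longrightarrow> p' (q' z) = z"
    by (rule inverse_extension[OF cA(3,4) q'(1,3)]) (rule that; assumption)
  obtain d where d: "0 < d"
    "\<forall>(A :: bool \<Rightarrow> _) w.
       (\<forall>i. compact (A i) \<and> A i \<subseteq> unit_square \<and> continuous_on (A i) (w i) \<and> w i ` A i \<subseteq> X \<and>
         (\<forall>z\<in>A i. dist (a i z) (w i z) < d)) \<longrightarrow>
       (\<exists>b. disk_pair X b \<and> close_pairs e a b \<and> (\<forall>i. \<forall>z\<in>A i. b i z = w i z))"
    using disk_pair_extension[OF X a e] by (elim exE conjE) (rule that)
  have ca: "continuous_on unit_square (a k)" "a k ` unit_square \<subseteq> X" for k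
    using a unfolding disk_pair_def by auto
  have 1: "continuous_on {0..1} (\<lambda>t. a i (p t))"
    by (rule continuous_on_compose2[OF ca(1) continuous_on_subset[OF p(1)]]) (use p(2) in auto)
  have 2: "continuous_on {0..1} (\<lambda>t. a i' (p' t))"
    by (rule continuous_on_compose2[OF ca(1) continuous_on_subset[OF p'(1)]]) (use p'(2) in auto)
  have 3: "(\<lambda>t. a i (p t)) ` {0..1} \<subseteq> X" "(\<lambda>t. a i' (p' t)) ` {0..1} \<subseteq> X"
    using subsetD[OF ca(2) imageI[OF subsetD[OF p(2) rangeI]]] subsetD[OF ca(2) imageI[OF subsetD[OF p'(2) rangeI]]]
    by blast+
  obtain \<beta> \<beta>' where \<beta>: "continuous_on {0..1} \<beta>" "\<beta> ` {0..1} \<subseteq> X"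
      "continuous_on {0..1} \<beta>'" "\<beta>' ` {0..1} \<subseteq> X"
      "\<And>t. t \<in> {0..1} \<Longrightarrow> dist (a i (p t)) (\<beta> t) < d"
      "\<And>t. t \<in> {0..1} \<Longrightarrow> dist (a i' (p' t)) (\<beta>' t) < d"
      "\<beta> ` {0..1} \<inter> \<beta>' ` {0..1} = {}"
    by (rule disjoint_paths_propertyE[OF dap 1 3(1) 2 3(2) d(1)]) (rule that; assumption)
  \<comment> \<open>for \<open>i = i'\<close> both prescriptions concern one disk; they are compatible as \<open>A\<close> and \<open>A'\<close> are
    disjoint then\<close>
  define S where "S k = (if k = i then A else {}) \<union> (if k = i' then A' else {})" for k
  define w where "w k z = (if k = i \<and> z \<in> A then \<beta> (q z) else \<beta>' (q' z))" for k z
  have wA: "w i z = \<beta> (q z)" if "z \<in> A" for z using that unfolding w_def by auto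
  have wA': "w i' z = \<beta>' (q' z)" if "z \<in> A'" for z using that disj unfolding w_def by auto
  have "\<exists>b. disk_pair X b \<and> close_pairs e a b \<and> (\<forall>k. \<forall>z\<in>S k. b k z = w k z)"
  proof (rule d(2)[rule_format], intro allI conjI ballI)
    fix k
    show "compact (S k)" using cA unfolding S_def by auto
    show "S k \<subseteq> unit_square" using cA unfolding S_def by auto
    show "continuous_on (S k) (w k)"
      unfolding S_def w_def
    proof (rule continuous_on_cases)
      show "closed (if k = i then A else {})" "closed (if k = i' then A' else {})"
        using cA compact_imp_closed by auto
    qed (use disj continuous_on_compose2[OF \<beta>(1) q(1,2)] continuous_on_compose2[OF \<beta>(3) q'(1,2)] in auto)
    show "w k ` S k \<subseteq> X"
    proof -
      have "w k z \<in> X" if "z \<in> S k" for z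
        using that wA[of z] wA'[of z] q(2) q'(2) \<beta>(2,4) unfolding S_def
        by (auto simp: image_subset_iff split: if_splits)
      then show ?thesis by blast
    qed
    show "dist (a k z) (w k z) < d" if "z \<in> S k" for z
    proof -
      have "dist (a i z) (\<beta> (q z)) < d" if "z \<in> A"
        using \<beta>(5)[of "q z"] q(2) p(3)[OF that] that by (auto simp: image_subset_iff)
      moreover have "dist (a i' z) (\<beta>' (q' z)) < d" if "z \<in> A'"
        using \<beta>(6)[of "q' z"] q'(2) p'(3)[OF that] that by (auto simp: image_subset_iff)
      ultimately show ?thesis using that wA[of z] wA'[of z] unfolding S_def by (auto split: if_splits)
    qed
  qed
  then obtain b where b: "disk_pair X b" "close_pairs e a b" "\<forall>k. \<forall>z\<in>S k. b k z = w k z"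
    by (elim exE conjE) (rule that; assumption)
  have "b i z = \<beta> (q z)" if "z \<in> A" for z using b(3)[rule_format, of z i] wA[OF that] that unfolding S_def by auto
  moreover have "b i' z = \<beta>' (q' z)" if "z \<in> A'" for z
    using b(3)[rule_format, of z i'] wA'[OF that] that unfolding S_def by auto
  ultimately have "b i ` A \<subseteq> \<beta> ` {0..1}" "b i' ` A' \<subseteq> \<beta>' ` {0..1}" using q(2) q'(2) by auto
  then show ?thesis using b \<beta>(7) by blast
qed

lemma separation_open:
  assumes a: "disk_pair X a" and A: "compact A" "A \<subseteq> unit_square" "compact A'" "A' \<subseteq> unit_square"
    and s: "a i ` A \<inter> a i' ` A' = {}"
  obtains d where "0 < d" "\<And>b. close_pairs d a b \<Longrightarrow> b i ` A \<inter> b i' ` A' = {}"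
proof -
  have c: "continuous_on A (a i)" "continuous_on A' (a i')"
    using a A unfolding disk_pair_def by (auto elim: continuous_on_subset)
  have cd: "continuous_on (A \<times> A') (\<lambda>x. dist (a i (fst x)) (a i' (snd x)))"
    by (intro continuous_intros continuous_on_compose2[OF c(1)] continuous_on_compose2[OF c(2)]) auto
  have pd: "0 < dist (a i (fst x)) (a i' (snd x))" if "x \<in> A \<times> A'" for x
    using s that by auto
  obtain d where d0: "d > 0" "\<And>x. x \<in> A \<times> A' \<Longrightarrow> d \<le> dist (a i (fst x)) (a i' (snd x))"
    by (rule compact_pos_lower_bound[OF compact_Times[OF A(1,3)] cd pd]) (assumption, rule that)
  have d: "d \<le> dist (a i z) (a i' z')" if "z \<in> A" "z' \<in> A'" for z z'
    using d0(2)[of "(z, z')"] that by simp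
  show ?thesis
  proof (rule that[of "d / 2"])
    fix b assume b: "close_pairs (d / 2) a b"
    have "b i z \<noteq> b i' z'" if "z \<in> A" "z' \<in> A'" for z z'
    proof
      assume eq: "b i z = b i' z'"
      have "dist (a i z) (b i z) < d / 2" "dist (a i' z') (b i z) < d / 2"
        using b subsetD[OF A(2) that(1)] subsetD[OF A(4) that(2)] unfolding close_pairs_def
        by (blast, metis eq)
      then show False
        using d[OF that] dist_triangle2[of "a i z" "a i' z'" "b i z"] by auto
    qed
    then show "b i ` A \<inter> b i' ` A' = {}" by blast
  qed (use d0 in simp)
qed

text \<open>Separation of one pair of compact sets is an open condition, so achieving it for one more
  pair by a sufficiently small move does not destroy what was achieved before.\<close>

lemma separate_finitely_many:
  fixes P :: "(bool \<times> (real \<times> real) set \<times> bool \<times> (real \<times> real) set) set"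
  assumes a: "disk_pair X a" and e: "0 < e" and P: "finite P"
    and cpt: "\<And>i A i' A'. (i, A, i', A') \<in> P \<Longrightarrow>
      compact A \<and> A \<subseteq> unit_square \<and> compact A' \<and> A' \<subseteq> unit_square"
    and dense: "\<And>i A i' A' a e. (i, A, i', A') \<in> P \<Longrightarrow> disk_pair X a \<Longrightarrow> 0 < e \<Longrightarrow>
      \<exists>b. disk_pair X b \<and> close_pairs e a b \<and> b i ` A \<inter> b i' ` A' = {}"
  obtains b where "disk_pair X b" "close_pairs e a b"
    "\<And>i A i' A'. (i, A, i', A') \<in> P \<Longrightarrow> b i ` A \<inter> b i' ` A' = {}"
proof -
  define good where "good P b \<longleftrightarrow> (\<forall>(i, A, i', A')\<in>P. b i ` A \<inter> b i' ` A' = {})"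
    for P :: "(bool \<times> (real \<times> real) set \<times> bool \<times> (real \<times> real) set) set"
      and b :: "bool \<Rightarrow> real \<times> real \<Rightarrow> 'a"
  have "\<exists>b d. disk_pair X b \<and> close_pairs e a b \<and> 0 < d \<and> (\<forall>c. close_pairs d b c \<longrightarrow> good P c)"
    using P cpt dense e
  proof (induction P arbitrary: e)
    case empty
    then show ?case using a by (intro exI[of _ a] exI[of _ 1]) (auto simp: close_pairs_def good_def)
  next
    case (insert x P)
    obtain i A i' A' where x: "x = (i, A, i', A')" by (cases x) auto
    have cA: "compact A" "A \<subseteq> unit_square" "compact A'" "A' \<subseteq> unit_square"
      using insert.prems(1)[of i A i' A'] x by simp_all
    have "0 < e / 2" using insert.prems(3) by simp
    have "\<exists>b d. disk_pair X b \<and> close_pairs (e / 2) a b \<and> 0 < d \<and> (\<forall>c. close_pairs d b c \<longrightarrow> good P c)"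
    proof (rule insert.IH[OF _ _ \<open>0 < e / 2\<close>])
      fix j B j' B' assume y: "(j, B, j', B') \<in> P"
      show "compact B \<and> B \<subseteq> unit_square \<and> compact B' \<and> B' \<subseteq> unit_square"
        by (rule insert.prems(1)[OF insertI2[OF y]])
      show "\<exists>b. disk_pair X b \<and> close_pairs e a b \<and> b j ` B \<inter> b j' ` B' = {}"
        if "disk_pair X a" "0 < e" for a and e :: real
        by (rule insert.prems(2)[OF insertI2[OF y] that])
    qed
    then obtain b d where b: "disk_pair X b" "close_pairs (e/2) a b"
      "0 < d" "\<forall>c. close_pairs d b c \<longrightarrow> good P c" by (elim exE conjE) (rule that)
    have "0 < min (e / 2) (d / 2)" using insert.prems(3) b(3) by simp
    then have "\<exists>c. disk_pair X c \<and> close_pairs (min (e / 2) (d / 2)) b c \<and> c i ` A \<inter> c i' ` A' = {}"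
      by (intro insert.prems(2)[OF _ b(1)]) (simp add: x)
    then obtain c where c: "disk_pair X c" "close_pairs (min (e / 2) (d / 2)) b c" "c i ` A \<inter> c i' ` A' = {}"
      by (elim exE conjE) (rule that)
    obtain d' where d': "0 < d'" "\<And>b. close_pairs d' c b \<Longrightarrow> b i ` A \<inter> b i' ` A' = {}"
      by (rule separation_open[OF c(1) cA c(3)]) (rule that; assumption)
    have "close_pairs (e / 2 + e / 2) a c"
      by (rule close_pairs_trans[OF b(2) close_pairs_mono[OF c(2)]]) simp
    moreover have "good (insert x P) b'" if "close_pairs (min (d / 2) d') c b'" for b'
    proof -
      have "close_pairs (d / 2 + d / 2) b b'"
        by (rule close_pairs_trans[OF close_pairs_mono[OF c(2)] close_pairs_mono[OF that]]) simp_all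
      then have "good P b'" using b(4) by simp
      moreover have "b' i ` A \<inter> b' i' ` A' = {}" using d'(2) close_pairs_mono[OF that] by simp
      ultimately show ?thesis unfolding good_def x by simp
    qed
    ultimately show ?case
      using c(1) d'(1) b(3) by (intro exI[of _ c] exI[of _ "min (d / 2) d'"]) simp
  qed
  then obtain b d where b: "disk_pair X b" "close_pairs e a b" "0 < d" "\<forall>c. close_pairs d b c \<longrightarrow> good P c"
    by (elim exE conjE) (rule that)
  have "close_pairs d b b" using b(3) unfolding close_pairs_def by simp
  then have g: "good P b" using b(4) by blast
  show ?thesis
  proof (rule that[OF b(1,2)])
    show "b i ` A \<inter> b i' ` A' = {}" if "(i, A, i', A') \<in> P" for i A i' A'
      using bspec[OF g[unfolded good_def] that] by simp
  qed
qed

lemma separate_finitely_many_arcs: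
  fixes P :: "(bool \<times> (real \<times> real) set \<times> bool \<times> (real \<times> real) set) set"
  assumes X: "homeomorphic_to_ENR X" and dap: "disjoint_paths_property X"
    and a: "disk_pair X a" and e: "0 < e" and P: "finite P"
    and arcs: "\<And>i A i' A'. (i, A, i', A') \<in> P \<Longrightarrow> arc_like A \<and> arc_like A' \<and> (i = i' \<longrightarrow> A \<inter> A' = {})"
  obtains b where "disk_pair X b" "close_pairs e a b"
    "\<And>i A i' A'. (i, A, i', A') \<in> P \<Longrightarrow> b i ` A \<inter> b i' ` A' = {}"
proof (rule separate_finitely_many[OF a e P])
  fix i A i' A' and a :: "bool \<Rightarrow> real \<times> real \<Rightarrow> 'a" and e :: real
  assume x: "(i, A, i', A') \<in> P"
  show "compact A \<and> A \<subseteq> unit_square \<and> compact A' \<and> A' \<subseteq> unit_square"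
    using arcs[OF x] unfolding arc_like_def by simp
  show "\<exists>b. disk_pair X b \<and> close_pairs e a b \<and> b i ` A \<inter> b i' ` A' = {}"
    if "disk_pair X a" "0 < e"
    using separate_arcs[OF X dap that(1) _ _ _ that(2)] arcs[OF x] by simp
qed (rule that; assumption)

lemma arc_like_segments:
  assumes "0 \<le> c" "c \<le> 1"
  shows "arc_like ({0..1} \<times> {c})" "arc_like ({c} \<times> {0..1})"
proof -
  show "arc_like ({0..1} \<times> {c})"
    unfolding arc_like_def using assms
    by (intro conjI exI[of _ fst] compact_Times compact_Icc continuous_intros) (auto simp: inj_on_def)
  show "arc_like ({c} \<times> {0..1})"
    unfolding arc_like_def using assms
    by (intro conjI exI[of _ snd] compact_Times compact_Icc continuous_intros) (auto simp: inj_on_def)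
qed

section \<open>Disjoint paths from disjoint concordances\<close>

lemma DCP_approximation:
  assumes "disjoint_path_concordances_property X" "path_homotopy X f1" "path_homotopy X f2" "0 < e"
  obtains F1 F2 where "path_concordance X F1" "path_concordance X F2"
      "F1 ` unit_square \<inter> F2 ` unit_square = {}"
      "\<And>z. z \<in> unit_square \<Longrightarrow> dist (f1 z) (fst (F1 z)) < e"
      "\<And>z. z \<in> unit_square \<Longrightarrow> dist (f2 z) (fst (F2 z)) < e"
  using assms(1)[unfolded disjoint_path_concordances_property_def, THEN spec, THEN spec, THEN mp,
      OF conjI[OF assms(2,3)], THEN spec, THEN mp, OF assms(4)]
  by (elim exE conjE) (rule that; (assumption | erule (1) bspec))

text \<open>A path is the constant homotopy from itself to itself. At time 0 both concordances have
  height 0, so there their disjointness is disjointness of the components in \<open>X\<close>.\<close>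

lemma DCP_imp_disjoint_paths:
  assumes "disjoint_path_concordances_property X"
  shows "disjoint_paths_property X"
  unfolding disjoint_paths_property_def
proof (intro allI impI, elim conjE)
  fix \<alpha>1 \<alpha>2 :: "real \<Rightarrow> 'a" and e :: real
  assume c: "continuous_on {0..1} \<alpha>1" "\<alpha>1 ` {0..1} \<subseteq> X" "continuous_on {0..1} \<alpha>2" "\<alpha>2 ` {0..1} \<subseteq> X"
    and e: "0 < e"
  have ph: "path_homotopy X (\<lambda>z. \<alpha> (fst z))" if "continuous_on {0..1} \<alpha>" "\<alpha> ` {0..1} \<subseteq> X" for \<alpha>
    unfolding path_homotopy_def
    by (intro conjI continuous_on_compose2[OF that(1)] continuous_intros) (use that(2) in auto)
  obtain F1 F2 where F: "path_concordance X F1" "path_concordance X F2"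
      "F1 ` unit_square \<inter> F2 ` unit_square = {}"
      "\<And>z. z \<in> unit_square \<Longrightarrow> dist (\<alpha>1 (fst z)) (fst (F1 z)) < e"
      "\<And>z. z \<in> unit_square \<Longrightarrow> dist (\<alpha>2 (fst z)) (fst (F2 z)) < e"
    by (rule DCP_approximation[OF assms ph[OF c(1,2)] ph[OF c(3,4)] e]) (rule that; assumption)
  have \<beta>: "continuous_on {0..1} (\<lambda>t. fst (F (t, 0)))" "(\<lambda>t. fst (F (t, 0))) ` {0..1} \<subseteq> X"
      "\<And>t. t \<in> {0..1} \<Longrightarrow> F (t, 0) = (fst (F (t, 0)), 0)"
    if "path_concordance X F" for F
  proof -
    have F: "continuous_on unit_square F" "\<And>t. t \<in> {0..1} \<Longrightarrow> F (t, 0) \<in> X \<times> {0}"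
      using that unfolding path_concordance_def by (auto simp: image_subset_iff)
    show "continuous_on {0..1} (\<lambda>t. fst (F (t, 0)))"
      by (intro continuous_on_fst continuous_on_compose2[OF F(1)] continuous_intros) auto
    show "(\<lambda>t. fst (F (t, 0))) ` {0..1} \<subseteq> X" using F(2) by (auto simp: mem_Times_iff)
    show "F (t, 0) = (fst (F (t, 0)), 0)" if "t \<in> {0..1}" for t
      using F(2)[OF that] by (auto simp: mem_Times_iff prod_eq_iff)
  qed
  have "fst (F1 (s, 0)) \<noteq> fst (F2 (t, 0))" if "s \<in> {0..1}" "t \<in> {0..1}" for s t
  proof
    assume "fst (F1 (s, 0)) = fst (F2 (t, 0))"
    then have "F1 (s, 0) = F2 (t, 0)" using \<beta>(3)[OF F(1) that(1)] \<beta>(3)[OF F(2) that(2)] by simp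
    moreover have "F1 (s, 0) \<in> F1 ` unit_square" "F2 (t, 0) \<in> F2 ` unit_square" using that by auto
    ultimately show False using F(3) by auto
  qed
  then have disj: "(\<lambda>t. fst (F1 (t, 0))) ` {0..1} \<inter> (\<lambda>t. fst (F2 (t, 0))) ` {0..1} = {}" by blast
  show "\<exists>\<beta>1 \<beta>2. continuous_on {0..1} \<beta>1 \<and> \<beta>1 ` {0..1} \<subseteq> X \<and> continuous_on {0..1} \<beta>2 \<and> \<beta>2 ` {0..1} \<subseteq> X \<and>
      (\<forall>t\<in>{0..1}. dist (\<alpha>1 t) (\<beta>1 t) < e) \<and> (\<forall>t\<in>{0..1}. dist (\<alpha>2 t) (\<beta>2 t) < e) \<and>
      \<beta>1 ` {0..1} \<inter> \<beta>2 ` {0..1} = {}"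
    using \<beta>(1,2)[OF F(1)] \<beta>(1,2)[OF F(2)] disj F(4,5)
    by (intro exI[of _ "\<lambda>t. fst (F1 (t, 0))"] exI[of _ "\<lambda>t. fst (F2 (t, 0))"]) auto
qed


section \<open>Disjoint paths from disjoint disks\<close>

lemma DDP_approximation:
  fixes f1 f2 :: "real \<times> real \<Rightarrow> 'a::metric_space"
  assumes "disjoint_disks_property Y"
    and "continuous_on unit_square f1" "f1 ` unit_square \<subseteq> Y"
    and "continuous_on unit_square f2" "f2 ` unit_square \<subseteq> Y" and "0 < e"
  obtains g1 g2 where "continuous_on unit_square g1" "g1 ` unit_square \<subseteq> Y"
    "continuous_on unit_square g2" "g2 ` unit_square \<subseteq> Y"
    "\<And>z. z \<in> unit_square \<Longrightarrow> dist (f1 z) (g1 z) < e"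
    "\<And>z. z \<in> unit_square \<Longrightarrow> dist (f2 z) (g2 z) < e"
    "g1 ` unit_square \<inter> g2 ` unit_square = {}"
proof -
  show ?thesis
    using assms(1)[unfolded disjoint_disks_property_def, THEN spec, THEN spec, THEN mp,
        OF conjI[OF assms(2) conjI[OF assms(3) conjI[OF assms(4,5)]]], THEN spec, THEN mp, OF assms(6)]
    by (elim exE conjE) (rule that; (assumption | erule (1) bspec))
qed

text \<open>At an isolated point \<open>x\<close>, maps near the vertical segment over \<open>x\<close> stay in the line over \<open>x\<close>,
  and two of them meet at height \<open>1/2\<close> by the intermediate value theorem.\<close>

lemma DDP_no_isolated_point:
  fixes X :: "'a::metric_space set"
  assumes ddp: "disjoint_disks_property (X \<times> (UNIV :: real set))" and x: "x \<in> X" and e: "0 < e"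
  shows "\<exists>y\<in>X. y \<noteq> x \<and> dist x y < e"
proof (rule ccontr)
  assume "\<not> ?thesis"
  then have iso: "y = x" if "y \<in> X" "dist x y < e" for y using that by blast
  let ?f = "\<lambda>z :: real \<times> real. (x, fst z)"
  have c: "continuous_on unit_square ?f" by (intro continuous_intros)
  have im: "?f ` unit_square \<subseteq> X \<times> UNIV" using x by auto
  have "0 < min e (1/4)" using e by simp
  then obtain g1 g2 where g: "continuous_on unit_square g1" "g1 ` unit_square \<subseteq> X \<times> UNIV"
    "continuous_on unit_square g2" "g2 ` unit_square \<subseteq> X \<times> UNIV"
    "\<And>z. z \<in> unit_square \<Longrightarrow> dist (?f z) (g1 z) < min e (1/4)"
    "\<And>z. z \<in> unit_square \<Longrightarrow> dist (?f z) (g2 z) < min e (1/4)"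
    "g1 ` unit_square \<inter> g2 ` unit_square = {}"
    by (rule DDP_approximation[OF ddp c im c im]) (rule that; assumption)
  have "(x, 1/2) \<in> g ` unit_square"
    if g: "continuous_on unit_square g" "g ` unit_square \<subseteq> X \<times> UNIV"
      "\<And>z. z \<in> unit_square \<Longrightarrow> dist (?f z) (g z) < min e (1/4)" for g
  proof -
    have "continuous_on {0..1} (\<lambda>s. snd (g (s, 0)))"
      by (intro continuous_on_snd continuous_on_compose2[OF g(1)] continuous_intros) auto
    moreover have d: "\<bar>s - snd (g (s, 0))\<bar> < 1/4" "dist x (fst (g (s, 0))) < e" if "s \<in> {0..1}" for s
      using g(3)[of "(s, 0)"] that dist_snd_le[of "?f (s, 0)" "g (s, 0)"] dist_fst_le[of "?f (s, 0)" "g (s, 0)"]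
      by (auto simp: dist_real_def)
    moreover have "snd (g (0, 0)) \<le> 1/2" "1/2 \<le> snd (g (1, 0))" using d(1)[of 0] d(1)[of 1]
      by (simp_all add: abs_if split: if_splits)
    ultimately obtain s where s: "s \<in> {0..1}" "snd (g (s, 0)) = 1/2"
      using IVT'[of "\<lambda>s. snd (g (s, 0))" 0 "1/2" 1] by auto
    have "g (s, 0) \<in> X \<times> UNIV" using g(2) s(1) by (auto simp: image_subset_iff)
    then have "fst (g (s, 0)) = x" using iso d(2)[OF s(1)] by (auto simp: mem_Times_iff)
    then have "g (s, 0) = (x, 1/2)" using s(2) by (simp add: prod_eq_iff)
    then show ?thesis using s(1) by (intro rev_image_eqI[of "(s, 0)"]) auto
  qed
  from this[OF g(1,2,5)] this[OF g(3,4,6)] show False using g(7) by blast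
qed

text \<open>A fixed point of \<open>(x, y) \<mapsto> (x - f (x, y), y - g (x, y))\<close>, clipped to the rectangle, exists
  by Brouwer, and the signs on the four sides make clipping impossible at it.\<close>

lemma crossing_common_zero:
  fixes f g :: "real \<times> real \<Rightarrow> real"
  assumes lr: "l < r" and bt: "b < t"
    and f: "continuous_on ({l..r} \<times> {b..t}) f" and g: "continuous_on ({l..r} \<times> {b..t}) g"
    and fl: "\<And>y. y \<in> {b..t} \<Longrightarrow> f (l, y) < 0" and fr: "\<And>y. y \<in> {b..t} \<Longrightarrow> f (r, y) > 0"
    and gb: "\<And>x. x \<in> {l..r} \<Longrightarrow> g (x, b) < 0" and gt: "\<And>x. x \<in> {l..r} \<Longrightarrow> g (x, t) > 0"
  obtains z where "z \<in> {l..r} \<times> {b..t}" "f z = 0" "g z = 0"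
proof -
  define T where "T z = (max l (min r (fst z - f z)), max b (min t (snd z - g z)))" for z
  have "continuous_on ({l..r} \<times> {b..t}) T"
    unfolding T_def by (intro continuous_intros f g)
  moreover have "T \<in> {l..r} \<times> {b..t} \<rightarrow> {l..r} \<times> {b..t}" unfolding T_def using lr bt by auto
  ultimately obtain z where z: "z \<in> {l..r} \<times> {b..t}" "T z = z"
    by (rule brouwer[of "{l..r} \<times> {b..t}" T, rotated 3])
       (use lr bt in \<open>auto intro!: compact_Times convex_Times\<close>)
  obtain x y where zz: "z = (x, y)" by (cases z)
  have xy: "x \<in> {l..r}" "y \<in> {b..t}" using z(1) zz by auto
  have fx: "max l (min r (x - f z)) = x" and gy: "max b (min t (y - g z)) = y"
    using z(2) unfolding T_def zz by auto
  have "f z = 0"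
  proof (rule ccontr)
    assume "f z \<noteq> 0"
    then consider "f z > 0" | "f z < 0" by linarith
    then show False
    proof cases
      case 1
      then have "x = l" using fx xy by (auto simp: max_def min_def split: if_splits)
      then show False using fl[OF xy(2)] 1 zz by auto
    next
      case 2
      then have "x = r" using fx xy by (auto simp: max_def min_def split: if_splits)
      then show False using fr[OF xy(2)] 2 zz by auto
    qed
  qed
  moreover have "g z = 0"
  proof (rule ccontr)
    assume "g z \<noteq> 0"
    then consider "g z > 0" | "g z < 0" by linarith
    then show False
    proof cases
      case 1
      then have "y = b" using gy xy by (auto simp: max_def min_def split: if_splits)
      then show False using gb[OF xy(1)] 1 zz by auto
    next
      case 2
      then have "y = t" using gy xy by (auto simp: max_def min_def split: if_splits)
      then show False using gt[OF xy(1)] 2 zz by auto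
    qed
  qed
  ultimately show ?thesis using that z(1) by blast
qed

text \<open>Otherwise, the part \<open>U\<close> of the open band around the level that is joined to the left side
  does not reach the right side. The level set splits into closed pieces inside and outside \<open>U\<close>,
  and a Urysohn function that is \<open>-1\<close> on the left side and on the first piece and \<open>1\<close> on the right
  side and on the second one has no zero on the level, contrary to \<open>crossing_common_zero\<close>.\<close>

lemma level_crossing_path:
  fixes v :: "real \<times> real \<Rightarrow> real"
  assumes lr: "l < r" and v: "continuous_on ({l..r} \<times> {0..1}) v"
    and lo: "\<And>s. s \<in> {l..r} \<Longrightarrow> v (s, 0) < c" and hi: "\<And>s. s \<in> {l..r} \<Longrightarrow> v (s, 1) > c"
    and \<eta>: "0 < \<eta>"
  shows "\<exists>y\<in>{0..1}. \<exists>y'\<in>{0..1}.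
    path_component {z \<in> {l..r} \<times> {0..1}. \<bar>v z - c\<bar> < \<eta>} (l, y) (r, y')"
proof (rule ccontr)
  assume no': "\<not> ?thesis"
  let ?B = "{l..r} \<times> {0..1::real}"
  define O' where "O' = {z \<in> ?B. \<bar>v z - c\<bar> < \<eta>}"
  have no: "\<not> path_component O' (l, y) (r, y')" if "y \<in> {0..1}" "y' \<in> {0..1}" for y y'
    using no' that unfolding O'_def by blast
  have clB: "closed ?B" by (intro closed_Times closed_real_atLeastAtMost)
  have lpB: "locally path_connected ?B"
    by (intro convex_imp_locally_path_connected convex_Times convex_real_interval)
  have opO: "openin (top_of_set ?B) O'"
  proof -
    have "O' = ?B \<inter> v -` ball c \<eta>" unfolding O'_def by (auto simp: dist_real_def abs_minus_commute)
    then show ?thesis using continuous_openin_preimage_gen[OF v open_ball] by simp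
  qed
  have lpO: "locally path_connected O'" using locally_open_subset[OF lpB opO] .
  have opc: "openin (top_of_set O') (path_component_set O' z)" for z
    by (rule openin_path_component_locally_path_connected[OF lpO])
  define U where "U = (\<Union>y\<in>{0..1}. path_component_set O' (l, y))"
  have UO: "U \<subseteq> O'" unfolding U_def using path_component_subset by blast
  have oU: "openin (top_of_set O') U" unfolding U_def by (intro openin_Union) (auto intro: opc)
  have cU: "O' - U = (\<Union>z\<in>O' - U. path_component_set O' z)"
  proof
    show "O' - U \<subseteq> (\<Union>z\<in>O' - U. path_component_set O' z)"
      by (auto simp: path_component_refl_eq)
    have False if z: "z \<in> O'" "z \<notin> U" "path_component O' z w" "w \<in> U" for z w
    proof -
      obtain y where "y \<in> {0..1}" "path_component O' (l, y) w" using z(4) unfolding U_def by auto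
      then have "z \<in> U" unfolding U_def
        using path_component_trans path_component_sym z(3) by (metis UN_I mem_Collect_eq)
      then show False using z(2) by blast
    qed
    then show "(\<Union>z\<in>O' - U. path_component_set O' z) \<subseteq> O' - U"
      using path_component_subset by fastforce
  qed
  have oU': "openin (top_of_set O') (O' - U)" by (subst cU, intro openin_Union) (auto intro: opc)
  define S where "S = {z \<in> ?B. v z = c}"
  have SO: "S \<subseteq> O'" unfolding S_def O'_def using \<eta> by auto
  have clS: "closed S"
  proof -
    have "S = ?B \<inter> v -` {c}" unfolding S_def by auto
    then show ?thesis using continuous_closed_preimage[OF v clB closed_singleton] by simp
  qed
  have clopen: "closed (S \<inter> W)" if W: "openin (top_of_set O') W" "openin (top_of_set O') (O' - W)" for W
  proof -
    have "closedin (top_of_set O') W"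
      using W openin_imp_subset[OF W(1)] unfolding closedin_def by (auto simp: )
    then obtain C where "closed C" "W = O' \<inter> C" unfolding closedin_closed by auto
    then have "S \<inter> W = S \<inter> C" using SO by auto
    then show ?thesis using clS \<open>closed C\<close> by auto
  qed
  have clSU: "closed (S \<inter> U)" by (rule clopen[OF oU oU'])
  have "O' - (O' - U) = U" using UO by auto
  then have "closed (S \<inter> (O' - U))" by (intro clopen) (use oU oU' in auto)
  then have clSU': "closed (S - U)" using SO by (metis Diff_Int_distrib Diff_Int Int_Diff inf.absorb1)
  define L where "L = {l} \<times> {0..1::real}"
  define R where "R = {r} \<times> {0..1::real}"
  have clLR: "closed L" "closed R" unfolding L_def R_def by (auto intro: closed_Times)
  have LU: "z \<in> U" if z: "z \<in> L" "z \<in> S" for z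
  proof -
    obtain y where "z = (l, y)" "y \<in> {0..1}" using z(1) unfolding L_def by auto
    moreover have "path_component O' z z" using path_component_refl SO z(2) by blast
    ultimately show ?thesis unfolding U_def by auto
  qed
  have RU: "z \<notin> U" if z: "z \<in> R" for z
  proof -
    obtain y where "z = (r, y)" "y \<in> {0..1}" using z unfolding R_def by auto
    then show ?thesis unfolding U_def using no by auto
  qed
  have "L \<inter> R = {}" unfolding L_def R_def using lr by auto
  then have dj: "(L \<union> S \<inter> U) \<inter> (R \<union> (S - U)) = {}" using LU RU by blast
  obtain f :: "real \<times> real \<Rightarrow> real" where f: "continuous_on UNIV f"
      "\<And>z. z \<in> L \<union> S \<inter> U \<Longrightarrow> f z = -1" "\<And>z. z \<in> R \<union> (S - U) \<Longrightarrow> f z = 1"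
    by (rule Urysohn[OF closed_Un[OF clLR(1) clSU] closed_Un[OF clLR(2) clSU'] dj, of "-1" 1]) (rule that; assumption)
  obtain z where z: "z \<in> ?B" "f z = 0" "v z - c = 0"
  proof (rule crossing_common_zero[OF lr, of 0 1 f "\<lambda>z. v z - c"])
    show "continuous_on ?B f" using f(1) continuous_on_subset by blast
    show "f (l, y) < 0" if "y \<in> {0..1}" for y using f(2)[of "(l, y)"] that unfolding L_def by auto
    show "f (r, y) > 0" if "y \<in> {0..1}" for y using f(3)[of "(r, y)"] that unfolding R_def by auto
  qed (use v lo hi in \<open>auto intro: continuous_intros\<close>)
  then have "z \<in> S" unfolding S_def by auto
  then show False using f(2)[of z] f(3)[of z] z(2) by (cases "z \<in> U") auto
qed

text \<open>Controlled extension applied to the constant path at \<open>p\<close>, with its final point moved to \<open>y\<close>.\<close>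

lemma ENR_local_paths:
  fixes X :: "'a::metric_space set"
  assumes X: "homeomorphic_to_ENR X" and K: "compact K" "K \<subseteq> X" and k: "0 < \<kappa>"
  shows "\<exists>d>0. \<forall>p\<in>K. \<forall>y\<in>X. dist p y < d \<longrightarrow> path_component (X \<inter> ball p \<kappa>) p y"
proof -
  obtain d where d: "0 < d"
    "\<forall>(Z :: real set) A a w. continuous_on Z a \<and> a ` Z \<subseteq> K \<and>
        closedin (top_of_set Z) A \<and> continuous_on A w \<and> w ` A \<subseteq> X \<and>
        (\<forall>z\<in>A. dist (a z) (w z) < d) \<longrightarrow>
       (\<exists>b. continuous_on Z b \<and> b ` Z \<subseteq> X \<and> (\<forall>z\<in>A. b z = w z) \<and> (\<forall>z\<in>Z. dist (a z) (b z) < \<kappa>))"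
    using ENR_controlled_extension[where 'b = real, OF X K k] by (elim exE conjE) (rule that)
  show ?thesis
  proof (intro exI[of _ d] conjI ballI impI d(1))
    fix p y assume A: "p \<in> K" "y \<in> X" "dist p y < d"
    define w where "w t = (if t = 0 then p else y)" for t :: real
    have "\<exists>b. continuous_on {0..1} b \<and> b ` {0..1} \<subseteq> X \<and> (\<forall>z\<in>{0,1}. b z = w z) \<and>
        (\<forall>z\<in>{0..1::real}. dist p (b z) < \<kappa>)"
    proof (rule d(2)[rule_format], intro conjI)
      show "closedin (top_of_set {0..1}) {0, 1 :: real}" by (intro closed_subset) auto
      show "continuous_on {0, 1} w" by (rule continuous_on_finite) simp
    qed (use A K d(1) in \<open>auto simp: w_def\<close>)
    then obtain b where b: "continuous_on {0..1} b" "b ` {0..1} \<subseteq> X" "\<forall>z\<in>{0,1}. b z = w z"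
        "\<forall>z\<in>{0..1::real}. dist p (b z) < \<kappa>"
      by (elim exE conjE) (rule that)
    have "path b" using b(1) by (simp add: path_def)
    moreover have "path_image b \<subseteq> X \<inter> ball p \<kappa>"
      using b(2,4) unfolding path_image_def by auto
    moreover have "pathstart b = p" "pathfinish b = y"
      using b(3) unfolding pathstart_def pathfinish_def w_def by auto
    ultimately show "path_component (X \<inter> ball p \<kappa>) p y" unfolding path_component_def by blast
  qed
qed

lemma mesh_interval:
  assumes "m < n"
  shows "0 \<le> real m / real n" "real m / real n < real (Suc m) / real n" "real (Suc m) / real n \<le> 1"
    "{real m / real n..real (Suc m) / real n} \<subseteq> {0..1}"
proof -
  show "0 \<le> real m / real n" by simp
  then show "{real m / real n..real (Suc m) / real n} \<subseteq> {0..1}"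
    using assms by (intro iffD2[OF atLeastatMost_subset_iff]) (simp add: field_simps)
  show "real m / real n < real (Suc m) / real n" "real (Suc m) / real n \<le> 1"
    using assms by (auto simp: field_simps)
qed

lemma mesh_cover:
  fixes t :: real
  assumes n: "0 < n" and "t \<in> {0..1}"
  shows "\<exists>m<n. t \<in> {real m / real n..real (Suc m) / real n}"
proof (cases "t = 1")
  case True
  then show ?thesis using n by (intro exI[of _ "n - 1"]) (auto simp: field_simps)
next
  case False
  define m where "m = nat \<lfloor>real n * t\<rfloor>"
  have "real m \<le> real n * t" "real n * t < real m + 1" using assms(2) unfolding m_def by auto
  moreover have "real n * t < n" using n assms(2) False by auto
  ultimately have "m < n" by simp
  then show ?thesis using \<open>real m \<le> real n * t\<close> \<open>real n * t < real m + 1\<close> n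
    by (intro exI[of _ m]) (auto simp: field_simps)
qed

text \<open>Used to follow a path roughly: the sets \<open>S m\<close> say where the pieces may run, and the values
  at the mesh points are kept.\<close>

lemma assemble_path:
  fixes \<alpha> :: "real \<Rightarrow> 'a::topological_space" and n :: nat
  assumes n: "0 < n"
    and pc: "\<And>m. m < n \<Longrightarrow> path_component (S m) (\<alpha> (m / n)) (\<alpha> (Suc m / n))"
  shows "\<exists>\<beta>. continuous_on {0..1} \<beta> \<and> (\<forall>m<n. \<beta> ` {m / n..Suc m / n} \<subseteq> S m)"
proof -
  have "\<exists>\<beta>. continuous_on {0..k / n} \<beta> \<and> \<beta> (k / n) = \<alpha> (k / n) \<and> (\<forall>m<k. \<beta> ` {m / n..Suc m / n} \<subseteq> S m)"
    if "k \<le> n" for k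
    using that
  proof (induction k)
    case 0
    show ?case by (intro exI[of _ "\<lambda>t. \<alpha> 0"]) simp
  next
    case (Suc k)
    then obtain \<beta> where \<beta>: "continuous_on {0..k / n} \<beta>" "\<beta> (k / n) = \<alpha> (k / n)"
        "\<And>m. m < k \<Longrightarrow> \<beta> ` {m / n..Suc m / n} \<subseteq> S m" by auto
    obtain g where g: "path g" "path_image g \<subseteq> S k" "pathstart g = \<alpha> (k / n)" "pathfinish g = \<alpha> (Suc k / n)"
      using pc[of k] Suc.prems unfolding path_component_def by auto
    define \<beta>' where "\<beta>' t = (if t \<le> k / n then \<beta> t else g (real n * t - real k))" for t :: real
    have g0: "g (real n * (k / n) - real k) = \<beta> (k / n)" using n g(3) \<beta>(2) by (simp add: pathstart_def)
    have g1: "\<beta>' t = g (real n * t - real k)" if "k / n \<le> t" for t :: real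
      using g0 that unfolding \<beta>'_def by (cases "t = k / n") auto
    have un: "{0..Suc k / n} = {0..k / n} \<union> {k / n..Suc k / n}"
    proof -
      have "0 \<le> real k / n" "real k / n \<le> Suc k / n" by (auto intro: divide_right_mono)
      then show ?thesis by (simp add: ivl_disj_un_two_touch)
    qed
    have rng: "real n * t - real k \<in> {0..1}" if "t \<in> {k / n..Suc k / n}" for t :: real
      using that n by (auto simp: field_simps)
    show ?case
    proof (intro exI[of _ \<beta>'] conjI allI impI)
      show "continuous_on {0..Suc k / n} \<beta>'"
        unfolding un \<beta>'_def
      proof (rule continuous_on_cases)
        show "continuous_on {k / n..Suc k / n} (\<lambda>t. g (real n * t - real k))"
          by (rule continuous_on_compose2[OF g(1)[unfolded path_def]])
             (use rng in \<open>auto intro!: continuous_intros\<close>)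
      qed (use \<beta>(1) g0 in auto)
      show "\<beta>' (Suc k / n) = \<alpha> (Suc k / n)"
        using g1[of "Suc k / n"] g(4) n by (simp add: field_simps pathfinish_def)
      fix m assume "m < Suc k"
      show "\<beta>' ` {m / n..Suc m / n} \<subseteq> S m"
      proof (cases "m = k")
        case True
        show ?thesis
        proof (rule image_subsetI)
          fix t :: real assume "t \<in> {m / n..Suc m / n}"
          then have "\<beta>' t = g (real n * t - real k)" "real n * t - real k \<in> {0..1}" using g1 rng True by auto
          then show "\<beta>' t \<in> S m" using g(2) True unfolding path_image_def by auto
        qed
      next
        case False
        then have m: "m < k" using \<open>m < Suc k\<close> by simp
        have "\<beta>' t = \<beta> t" if "t \<in> {m / n..Suc m / n}" for t :: real
        proof -
          have "Suc m / n \<le> k / n" using m n by (intro divide_right_mono) auto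
          then show ?thesis using that unfolding \<beta>'_def by auto
        qed
        then show ?thesis using \<beta>(3)[OF m] by (simp add: image_subset_iff)
      qed
    qed
  qed
  from this[of n] n show ?thesis by auto
qed

text \<open>What remains of a path \<open>\<alpha>\<close> after the wall over it has been perturbed and cut at a horizontal
  level: a set near \<open>\<alpha>\<close> in which one can travel, near the corresponding part of \<open>\<alpha>\<close>, from close to
  any \<open>\<alpha> l\<close> to close to any \<open>\<alpha> r\<close>.\<close>

definition shadows_path :: "'a::metric_space set \<Rightarrow> real \<Rightarrow> (real \<Rightarrow> 'a) \<Rightarrow> bool" where
  "shadows_path M \<delta> \<alpha> \<longleftrightarrow>
     (\<forall>x\<in>M. \<exists>s\<in>{0..1}. dist x (\<alpha> s) < \<delta>) \<and>
     (\<forall>l r. 0 \<le> l \<and> l < r \<and> r \<le> 1 \<longrightarrow>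
        (\<exists>x y. dist (\<alpha> l) x < \<delta> \<and> dist (\<alpha> r) y < \<delta> \<and>
          path_component {x \<in> M. \<exists>s\<in>{l..r}. dist x (\<alpha> s) < \<delta>} x y))"

text \<open>Points of the two disjoint walls have distance at least some \<open>c > 0\<close>. Points at heights
  closer than \<open>c\<close> to each other therefore differ in their components in \<open>X\<close>, so the parts of the
  walls at heights within \<open>c / 4\<close> of \<open>1/2\<close> have disjoint projections.\<close>

lemma DDP_disjoint_shadows:
  fixes X :: "'a::metric_space set" and \<alpha> :: "bool \<Rightarrow> real \<Rightarrow> 'a"
  assumes ddp: "disjoint_disks_property (X \<times> (UNIV :: real set))"
    and \<alpha>: "\<And>i. continuous_on {0..1} (\<alpha> i)" "\<And>i. \<alpha> i ` {0..1} \<subseteq> X" and d: "0 < \<delta>"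
  obtains M where "M True \<inter> M False = {}" "\<And>i. M i \<subseteq> X" "\<And>i. shadows_path (M i) \<delta> (\<alpha> i)"
proof -
  define f where "f i z = (\<alpha> i (fst z), snd z)" for i and z :: "real \<times> real"
  have f: "continuous_on unit_square (f i)" "f i ` unit_square \<subseteq> X \<times> UNIV" for i
  proof -
    show "continuous_on unit_square (f i)"
      unfolding f_def by (intro continuous_intros continuous_on_compose2[OF \<alpha>(1)]) auto
    show "f i ` unit_square \<subseteq> X \<times> UNIV" unfolding f_def using \<alpha>(2)[of i] by auto
  qed
  have "0 < min \<delta> (1/4)" using d by simp
  then obtain g1 g2 where g12: "continuous_on unit_square g1" "g1 ` unit_square \<subseteq> X \<times> UNIV"
    "continuous_on unit_square g2" "g2 ` unit_square \<subseteq> X \<times> UNIV"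
    "\<And>z. z \<in> unit_square \<Longrightarrow> dist (f True z) (g1 z) < min \<delta> (1/4)"
    "\<And>z. z \<in> unit_square \<Longrightarrow> dist (f False z) (g2 z) < min \<delta> (1/4)"
    "g1 ` unit_square \<inter> g2 ` unit_square = {}"
    by (rule DDP_approximation[OF ddp f f]) (rule that; assumption)
  define g where "g i = (if i then g1 else g2)" for i
  have g: "continuous_on unit_square (g i)" "g i ` unit_square \<subseteq> X \<times> UNIV"
    "\<And>z. z \<in> unit_square \<Longrightarrow> dist (f i z) (g i z) < min \<delta> (1/4)" for i
    using g12 unfolding g_def by (cases i; simp)+
  have cd: "continuous_on (unit_square \<times> unit_square) (\<lambda>p. dist (g1 (fst p)) (g2 (snd p)))"
    by (intro continuous_intros continuous_on_compose2[OF g12(1)] continuous_on_compose2[OF g12(3)]) auto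
  have pd: "0 < dist (g1 (fst p)) (g2 (snd p))" if "p \<in> unit_square \<times> unit_square" for p
  proof -
    have "fst p \<in> unit_square" "snd p \<in> unit_square" using that by (simp_all only: mem_Times_iff)
    then have "g1 (fst p) \<noteq> g2 (snd p)" using g12(7) by (metis disjoint_iff imageI)
    then show ?thesis by simp
  qed
  obtain c where c: "0 < c" "\<And>p. p \<in> unit_square \<times> unit_square \<Longrightarrow> c \<le> dist (g1 (fst p)) (g2 (snd p))"
    by (rule compact_pos_lower_bound[OF compact_Times[OF compact_unit_square compact_unit_square] cd pd])
       (assumption, rule that)
  define \<eta> where "\<eta> = c / 4"
  have \<eta>: "0 < \<eta>" using c(1) unfolding \<eta>_def by simp
  define M where "M i = (\<lambda>z. fst (g i z)) ` {z \<in> unit_square. \<bar>snd (g i z) - 1/2\<bar> < \<eta>}" for i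
  have near: "dist (\<alpha> i (fst z)) (fst (g i z)) < \<delta>" "\<bar>snd z - snd (g i z)\<bar> < 1/4" if "z \<in> unit_square" for i z
  proof -
    have "dist (\<alpha> i (fst z)) (fst (g i z)) \<le> dist (f i z) (g i z)"
      "\<bar>snd z - snd (g i z)\<bar> \<le> dist (f i z) (g i z)"
      using dist_fst_le[of "f i z" "g i z"] dist_snd_le[of "f i z" "g i z"]
      unfolding f_def by (auto simp: dist_real_def)
    then show "dist (\<alpha> i (fst z)) (fst (g i z)) < \<delta>" "\<bar>snd z - snd (g i z)\<bar> < 1/4"
      using g(3)[OF that, of i] by linarith+
  qed
  show ?thesis
  proof (rule that[of M])
    have False if "z \<in> unit_square" "\<bar>snd (g1 z) - 1/2\<bar> < \<eta>" "z' \<in> unit_square" "\<bar>snd (g2 z') - 1/2\<bar> < \<eta>"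
      and "fst (g1 z) = fst (g2 z')" for z z'
    proof -
      have "dist (g1 z) (g2 z') = \<bar>snd (g1 z) - snd (g2 z')\<bar>"
        using that(5) by (simp add: dist_prod_def dist_real_def)
      also have "\<dots> < 2 * \<eta>" using that(2,4) by linarith
      finally show False using c(2)[of "(z, z')"] that(1,3) c(1) unfolding \<eta>_def by simp
    qed
    then show "M True \<inter> M False = {}" unfolding M_def g_def by fastforce
    show "M i \<subseteq> X" for i unfolding M_def using g(2)[of i] by fastforce
    show "shadows_path (M i) \<delta> (\<alpha> i)" for i
      unfolding shadows_path_def
    proof (intro conjI ballI allI impI)
      fix x assume "x \<in> M i"
      then obtain z where z: "z \<in> unit_square" "x = fst (g i z)" unfolding M_def by blast
      then show "\<exists>s\<in>{0..1}. dist x (\<alpha> i s) < \<delta>"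
        using near(1)[OF z(1), of i] by (intro bexI[of _ "fst z"]) (auto simp: dist_commute mem_Times_iff)
    next
      fix l r :: real assume lr: "0 \<le> l \<and> l < r \<and> r \<le> 1"
      let ?B = "{l..r} \<times> {0..1::real}"
      have BQ: "?B \<subseteq> unit_square" using lr by auto
      have "continuous_on ?B (\<lambda>z. snd (g i z))"
        by (intro continuous_on_snd continuous_on_subset[OF g(1) BQ])
      moreover have "snd (g i (s, 0)) < 1/2" "1/2 < snd (g i (s, 1))" if "s \<in> {l..r}" for s
        using near(2)[of "(s, 0)" i] near(2)[of "(s, 1)" i] that lr
        by (auto simp: abs_if split: if_splits)
      ultimately obtain y y' where y: "y \<in> {0..1}" "y' \<in> {0..1}"
        "path_component {z \<in> ?B. \<bar>snd (g i z) - 1/2\<bar> < \<eta>} (l, y) (r, y')"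
        using level_crossing_path[of l r "\<lambda>z. snd (g i z)" "1/2" \<eta>] lr \<eta> by blast
      then obtain p where p: "path p" "path_image p \<subseteq> {z \<in> ?B. \<bar>snd (g i z) - 1/2\<bar> < \<eta>}"
        "pathstart p = (l, y)" "pathfinish p = (r, y')" unfolding path_component_def by blast
      have pB: "p t \<in> ?B" "\<bar>snd (g i (p t)) - 1/2\<bar> < \<eta>" if "t \<in> {0..1}" for t
        using subsetD[OF p(2)[unfolded path_image_def] imageI[OF that]] by blast+
      let ?h = "\<lambda>t. fst (g i (p t))"
      have "path ?h"
        unfolding path_def
        by (intro continuous_on_fst continuous_on_compose2[OF g(1) p(1)[unfolded path_def]]
              image_subsetI subsetD[OF BQ pB(1)])
      moreover have "path_image ?h \<subseteq> {x \<in> M i. \<exists>s\<in>{l..r}. dist x (\<alpha> i s) < \<delta>}"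
      proof -
        have "?h t \<in> M i" "dist (?h t) (\<alpha> i (fst (p t))) < \<delta>" "fst (p t) \<in> {l..r}" if "t \<in> {0..1}" for t
        proof -
          have pQ: "p t \<in> unit_square" by (rule subsetD[OF BQ pB(1)[OF that]])
          show "?h t \<in> M i"
            unfolding M_def by (intro image_eqI[of _ _ "p t"] CollectI conjI refl pQ pB(2)[OF that])
          show "dist (?h t) (\<alpha> i (fst (p t))) < \<delta>" using near(1)[OF pQ, of i] by (simp add: dist_commute)
          show "fst (p t) \<in> {l..r}" using pB(1)[OF that] by (auto simp: mem_Times_iff)
        qed
        then show ?thesis unfolding path_image_def by blast
      qed
      moreover have "pathstart ?h = fst (g i (l, y))" "pathfinish ?h = fst (g i (r, y'))"
        using p(3,4) by (auto simp: pathstart_def pathfinish_def)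
      ultimately have "path_component {x \<in> M i. \<exists>s\<in>{l..r}. dist x (\<alpha> i s) < \<delta>} (fst (g i (l, y))) (fst (g i (r, y')))"
        unfolding path_component_def by blast
      moreover have "dist (\<alpha> i l) (fst (g i (l, y))) < \<delta>" "dist (\<alpha> i r) (fst (g i (r, y'))) < \<delta>"
        using near(1)[of "(l, y)" i] near(1)[of "(r, y')" i] y lr by auto
      ultimately show "\<exists>x y. dist (\<alpha> i l) x < \<delta> \<and> dist (\<alpha> i r) y < \<delta> \<and>
          path_component {x \<in> M i. \<exists>s\<in>{l..r}. dist x (\<alpha> i s) < \<delta>} x y" by blast
    qed
  qed
qed

text \<open>Between two mesh points the path runs inside the shadow; near the mesh points it runs in
  small balls, where it returns to \<open>\<alpha>\<close>. It thus lies in the shadow except in balls around finitely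
  many points known in advance.\<close>

lemma path_along_shadow:
  fixes \<alpha> :: "real \<Rightarrow> 'a::metric_space" and n :: nat
  assumes n: "0 < n" and osc: "\<And>m s t. m < n \<Longrightarrow> s \<in> {m / n..Suc m / n} \<Longrightarrow> t \<in> {m / n..Suc m / n} \<Longrightarrow>
      dist (\<alpha> s) (\<alpha> t) < e"
    and M: "M \<subseteq> X" "shadows_path M \<delta> \<alpha>" and \<delta>: "\<delta> \<le> \<kappa>"
    and loc: "\<forall>p\<in>\<alpha> ` {0..1}. \<forall>y\<in>X. dist p y < \<delta> \<longrightarrow> path_component (X \<inter> ball p \<kappa>) p y"
  obtains \<beta> where "continuous_on {0..1} \<beta>" "\<beta> ` {0..1} \<subseteq> X"
    "\<beta> ` {0..1} \<subseteq> M \<union> (\<Union>m\<in>{..n}. ball (\<alpha> (m / n)) \<kappa>)"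
    "\<And>t. t \<in> {0..1} \<Longrightarrow> dist (\<alpha> t) (\<beta> t) < e + \<kappa>"
proof -
  define S where "S m = {x \<in> X. (x \<in> M \<or> x \<in> ball (\<alpha> (m / n)) \<kappa> \<or> x \<in> ball (\<alpha> (Suc m / n)) \<kappa>) \<and>
      (\<exists>s\<in>{m / n..Suc m / n}. dist x (\<alpha> s) < \<kappa>)}" for m :: nat
  have "path_component (S m) (\<alpha> (m / n)) (\<alpha> (Suc m / n))" if m: "m < n" for m
  proof -
    note lr = mesh_interval[OF m]
    have "\<exists>x y. dist (\<alpha> (m / n)) x < \<delta> \<and> dist (\<alpha> (Suc m / n)) y < \<delta> \<and>
        path_component {x \<in> M. \<exists>s\<in>{m / n..Suc m / n}. dist x (\<alpha> s) < \<delta>} x y"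
      by (intro M(2)[unfolded shadows_path_def, THEN conjunct2, THEN spec, THEN spec, THEN mp] conjI lr(1-3))
    then obtain x y where xy: "dist (\<alpha> (m / n)) x < \<delta>" "dist (\<alpha> (Suc m / n)) y < \<delta>"
        "path_component {x \<in> M. \<exists>s\<in>{m / n..Suc m / n}. dist x (\<alpha> s) < \<delta>} x y"
      by (elim exE conjE) (rule that)
    have sub: "{x \<in> M. \<exists>s\<in>{m / n..Suc m / n}. dist x (\<alpha> s) < \<delta>} \<subseteq> S m"
    proof
      fix z assume "z \<in> {x \<in> M. \<exists>s\<in>{m / n..Suc m / n}. dist x (\<alpha> s) < \<delta>}"
      then obtain s where s: "z \<in> M" "s \<in> {m / n..Suc m / n}" "dist z (\<alpha> s) < \<delta>" by blast
      then show "z \<in> S m" unfolding S_def using M(1) \<delta> by (intro CollectI conjI bexI[of _ s]) auto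
    qed
    have xyX: "x \<in> X" "y \<in> X" using path_component_mem[OF xy(3)] M(1) by blast+
    have ends: "\<alpha> (m / n) \<in> \<alpha> ` {0..1}" "\<alpha> (Suc m / n) \<in> \<alpha> ` {0..1}"
      using subsetD[OF lr(4)] lr(2) by auto
    have "path_component (X \<inter> ball (\<alpha> (m / n)) \<kappa>) (\<alpha> (m / n)) x"
      using loc ends(1) xyX(1) xy(1) by blast
    then have 1: "path_component (S m) (\<alpha> (m / n)) x"
      by (rule path_component_of_subset[rotated])
         (use lr in \<open>auto simp: S_def dist_commute intro!: bexI[of _ "m / n"]\<close>)
    have "path_component (X \<inter> ball (\<alpha> (Suc m / n)) \<kappa>) (\<alpha> (Suc m / n)) y"
      using loc ends(2) xyX(2) xy(2) by blast
    then have 2: "path_component (S m) (\<alpha> (Suc m / n)) y"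
      by (rule path_component_of_subset[rotated])
         (use lr in \<open>auto simp: S_def dist_commute intro!: bexI[of _ "Suc m / n"]\<close>)
    have 3: "path_component (S m) x y" by (rule path_component_of_subset[OF sub xy(3)])
    show ?thesis
      by (rule path_component_trans[OF path_component_trans[OF 1 3] path_component_sym[OF 2]])
  qed
  then obtain \<beta> where \<beta>: "continuous_on {0..1} \<beta>" "\<And>m. m < n \<Longrightarrow> \<beta> ` {m / n..Suc m / n} \<subseteq> S m"
    using assemble_path[OF n, of S \<alpha>] by blast
  note cell = mesh_cover[OF n]
  show ?thesis
  proof (rule that[OF \<beta>(1)])
    show "\<beta> ` {0..1} \<subseteq> X"
    proof (rule image_subsetI)
      fix t :: real assume "t \<in> {0..1}"
      then obtain m where "m < n" "\<beta> t \<in> S m" using cell \<beta>(2) by blast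
      then show "\<beta> t \<in> X" unfolding S_def by blast
    qed
    show "\<beta> ` {0..1} \<subseteq> M \<union> (\<Union>m\<in>{..n}. ball (\<alpha> (m / n)) \<kappa>)"
    proof (rule image_subsetI)
      fix t :: real assume "t \<in> {0..1}"
      then obtain m where m: "m < n" "\<beta> t \<in> S m" using cell \<beta>(2) by blast
      then have "\<beta> t \<in> M \<or> \<beta> t \<in> ball (\<alpha> (m / n)) \<kappa> \<or> \<beta> t \<in> ball (\<alpha> (Suc m / n)) \<kappa>"
        unfolding S_def by blast
      moreover have "m \<in> {..n}" "Suc m \<in> {..n}" using m(1) by auto
      ultimately show "\<beta> t \<in> M \<union> (\<Union>m\<in>{..n}. ball (\<alpha> (m / n)) \<kappa>)" by blast
    qed
    fix t :: real assume "t \<in> {0..1}"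
    then obtain m where m: "m < n" "\<beta> t \<in> S m" "t \<in> {m / n..Suc m / n}" using cell \<beta>(2) by blast
    then obtain s where s: "s \<in> {m / n..Suc m / n}" "dist (\<beta> t) (\<alpha> s) < \<kappa>" unfolding S_def by blast
    then show "dist (\<alpha> t) (\<beta> t) < e + \<kappa>"
      using osc[OF m(1) m(3) s(1)] dist_triangle[of "\<alpha> t" "\<beta> t" "\<alpha> s"] by (simp add: dist_commute)
  qed
qed

lemma path_mesh:
  fixes \<alpha> :: "real \<Rightarrow> 'a::metric_space"
  assumes c: "continuous_on {0..1} \<alpha>" and e: "0 < e"
  shows "\<exists>N>0. \<forall>n\<ge>N. \<forall>m<n. \<forall>s\<in>{real m / real n..real (Suc m) / real n}. \<forall>t\<in>{real m / real n..real (Suc m) / real n}. dist (\<alpha> s) (\<alpha> t) < e"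
proof -
  have "uniformly_continuous_on {0..1} \<alpha>" by (rule compact_uniformly_continuous[OF c compact_Icc])
  then obtain d where d: "0 < d" "\<And>s t. s \<in> {0..1} \<Longrightarrow> t \<in> {0..1} \<Longrightarrow> dist s t < d \<Longrightarrow> dist (\<alpha> s) (\<alpha> t) < e"
    unfolding uniformly_continuous_on_def using e by (metis dist_commute)
  obtain N where N: "N > 0" "1 / real N < d" using d(1) by (metis gr0I inverse_eq_divide real_arch_inverse of_nat_0_less_iff)
  show ?thesis
  proof (intro exI[of _ N] conjI allI impI ballI N(1))
    fix n m :: nat and s t :: real
    assume n: "N \<le> n" "m < n" and st: "s \<in> {m / n..Suc m / n}" "t \<in> {m / n..Suc m / n}"
    have n0: "n > 0" using n by simp
    have "s \<in> {0..1}" "t \<in> {0..1}" using st mesh_interval(4)[OF n(2)] by blast+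
    moreover have "dist s t < d"
    proof -
      have "\<bar>s - t\<bar> \<le> Suc m / n - m / n" using st by auto
      also have "\<dots> = 1 / n" using n0 by (simp add: field_simps)
      also have "\<dots> \<le> 1 / N" using n(1) N(1) by (intro divide_left_mono) auto
      finally show ?thesis using N(2) by (simp add: dist_real_def)
    qed
    ultimately show "dist (\<alpha> s) (\<alpha> t) < e" by (rule d(2))
  qed
qed

text \<open>A special case of separating two paths, needed to make the balls at mesh points harmless in
  general. First \<open>\<alpha>\<close> is moved off \<open>x\<close> at the mesh points, which only takes a point different from
  \<open>x\<close> nearby. Then \<open>\<alpha>\<close> follows its shadow, while the constant path at \<open>x\<close> is replaced by a single
  point of the disjoint shadow.\<close>

lemma point_off_path:
  fixes X :: "'a::metric_space set"
  assumes X: "homeomorphic_to_ENR X" and ddp: "disjoint_disks_property (X \<times> (UNIV :: real set))"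
    and x: "x \<in> X" and c: "continuous_on {0..1} \<alpha>" "\<alpha> ` {0..1} \<subseteq> X" and e: "0 < e"
  shows "\<exists>x' \<beta>. x' \<in> X \<and> dist x x' < e \<and> continuous_on {0..1} \<beta> \<and> \<beta> ` {0..1} \<subseteq> X \<and>
    (\<forall>t\<in>{0..1::real}. dist (\<alpha> t) (\<beta> t) < e) \<and> x' \<notin> \<beta> ` {0..1}"
proof -
  have e10: "0 < e / 10" using e by simp
  have cK: "compact (\<alpha> ` {0..1})" by (rule compact_continuous_image[OF c(1) compact_Icc])
  obtain n where n: "0 < n" "\<forall>m<n. \<forall>s\<in>{real m / real n..real (Suc m) / real n}.
      \<forall>t\<in>{real m / real n..real (Suc m) / real n}. dist (\<alpha> s) (\<alpha> t) < e / 10"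
    using path_mesh[OF c(1) e10] by blast
  define Z where "Z = (\<lambda>m. real m / real n) ` {..n}"
  have Z: "finite Z" "Z \<subseteq> {0..1}" unfolding Z_def using n(1) by (auto simp: field_simps)
  obtain d where d: "0 < d"
    "\<forall>(Z :: real set) A a w. continuous_on Z a \<and> a ` Z \<subseteq> \<alpha> ` {0..1} \<and>
        closedin (top_of_set Z) A \<and> continuous_on A w \<and> w ` A \<subseteq> X \<and>
        (\<forall>z\<in>A. dist (a z) (w z) < d) \<longrightarrow>
       (\<exists>b. continuous_on Z b \<and> b ` Z \<subseteq> X \<and> (\<forall>z\<in>A. b z = w z) \<and> (\<forall>z\<in>Z. dist (a z) (b z) < e / 10))"
    using ENR_controlled_extension[where 'b = real, OF X cK c(2) e10] by (elim exE conjE) (rule that)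
  \<comment> \<open>at the mesh points where \<open>\<alpha>\<close> meets \<open>x\<close>, the new value is \<open>y\<close>\<close>
  obtain y where y: "y \<in> X" "y \<noteq> x" "dist x y < d"
    using DDP_no_isolated_point[OF ddp x d(1)] by blast
  define w where "w t = (if \<alpha> t = x then y else \<alpha> t)" for t
  have "\<exists>b. continuous_on {0..1} b \<and> b ` {0..1} \<subseteq> X \<and> (\<forall>z\<in>Z. b z = w z) \<and>
      (\<forall>z\<in>{0..1}. dist (\<alpha> z) (b z) < e / 10)"
  proof (rule d(2)[rule_format], intro conjI)
    show "closedin (top_of_set {0..1}) Z" using Z by (intro closed_subset finite_imp_closed)
    show "continuous_on Z w" by (rule continuous_on_finite[OF Z(1)])
    show "w ` Z \<subseteq> X" using c(2) Z(2) y(1) unfolding w_def by auto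
    show "\<forall>z\<in>Z. dist (\<alpha> z) (w z) < d" using y(3) d(1) unfolding w_def by auto
  qed (use c in auto)
  then obtain \<gamma> where \<gamma>: "continuous_on {0..1} \<gamma>" "\<gamma> ` {0..1} \<subseteq> X" "\<forall>z\<in>Z. \<gamma> z = w z"
      "\<forall>z\<in>{0..1}. dist (\<alpha> z) (\<gamma> z) < e / 10"
    by (elim exE conjE) (rule that)
  have off: "\<gamma> z \<noteq> x" if "z \<in> Z" for z using \<gamma>(3) that y(2) unfolding w_def by auto
  define r where "r = Min (insert (e / 10) ((\<lambda>z. dist (\<gamma> z) x) ` Z)) / 3"
  have r: "0 < r" "r \<le> e / 30" "\<And>z. z \<in> Z \<Longrightarrow> 3 * r \<le> dist (\<gamma> z) x"
  proof -
    have "Min (insert (e / 10) ((\<lambda>z. dist (\<gamma> z) x) ` Z)) > 0" using off e10 Z(1) by (simp add: Min_gr_iff)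
    then show "0 < r" unfolding r_def by simp
    have "Min (insert (e / 10) ((\<lambda>z. dist (\<gamma> z) x) ` Z)) \<le> e / 10" using Z(1) by (intro Min_le) auto
    then show "r \<le> e / 30" unfolding r_def by simp
    show "3 * r \<le> dist (\<gamma> z) x" if "z \<in> Z" for z
      using Z(1) that Min_le[of "insert (e / 10) ((\<lambda>z. dist (\<gamma> z) x) ` Z)" "dist (\<gamma> z) x"]
      unfolding r_def by simp
  qed
  have cK': "compact (\<gamma> ` {0..1})" by (rule compact_continuous_image[OF \<gamma>(1) compact_Icc])
  obtain \<delta>0 where \<delta>0: "0 < \<delta>0"
      "\<forall>p\<in>\<gamma> ` {0..1}. \<forall>y\<in>X. dist p y < \<delta>0 \<longrightarrow> path_component (X \<inter> ball p r) p y"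
    using ENR_local_paths[OF X cK' \<gamma>(2) r(1)] by (elim exE conjE) (rule that)
  define \<delta> where "\<delta> = min \<delta>0 r"
  have \<delta>: "0 < \<delta>" "\<delta> \<le> r" "\<delta> \<le> \<delta>0" using \<delta>0(1) r(1) unfolding \<delta>_def by auto
  define a where "a i = (if i then (\<lambda>t. x) else \<gamma>)" for i
  have a: "continuous_on {0..1} (a i)" "a i ` {0..1} \<subseteq> X" for i
    using \<gamma>(1,2) x unfolding a_def by (cases i; auto)+
  obtain M where M: "M True \<inter> M False = {}" "\<And>i. M i \<subseteq> X" "\<And>i. shadows_path (M i) \<delta> (a i)"
    by (rule DDP_disjoint_shadows[OF ddp a \<delta>(1)]) (rule that; assumption)
  have "\<exists>x y. path_component {x \<in> M True. \<exists>s\<in>{0..1}. dist x (a True s) < \<delta>} x y"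
    using M(3)[of True, unfolded shadows_path_def, THEN conjunct2, THEN spec[of _ 0], THEN spec[of _ 1]]
    by auto
  then obtain x' where "x' \<in> {x \<in> M True. \<exists>s\<in>{0..1}. dist x (a True s) < \<delta>}"
    using path_component_mem(1) by blast
  then have x': "x' \<in> M True" "dist x x' < \<delta>" unfolding a_def by (auto simp: dist_commute)
  have osc: "dist (\<gamma> s) (\<gamma> t) < 3 * (e / 10)"
    if "m < n" "s \<in> {m / n..Suc m / n}" "t \<in> {m / n..Suc m / n}" for m s t
  proof -
    have st: "s \<in> {0..1}" "t \<in> {0..1}" using mesh_interval(4)[OF that(1)] that(2,3) by blast+
    have "dist (\<alpha> s) (\<alpha> t) < e / 10" using n(2) that by blast
    moreover have "dist (\<alpha> s) (\<gamma> s) < e / 10" "dist (\<alpha> t) (\<gamma> t) < e / 10" using \<gamma>(4) st by auto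
    ultimately show ?thesis
      using dist_triangle[of "\<gamma> s" "\<gamma> t" "\<alpha> s"] dist_triangle[of "\<alpha> s" "\<gamma> t" "\<alpha> t"]
      by (simp add: dist_commute)
  qed
  have sh: "shadows_path (M False) \<delta> \<gamma>" using M(3)[of False] unfolding a_def by simp
  have loc: "\<forall>p\<in>\<gamma> ` {0..1}. \<forall>y\<in>X. dist p y < \<delta> \<longrightarrow> path_component (X \<inter> ball p r) p y"
    using \<delta>0(2) \<delta>(3) by (meson less_le_trans)
  obtain \<beta> where \<beta>: "continuous_on {0..1} \<beta>" "\<beta> ` {0..1} \<subseteq> X"
    "\<beta> ` {0..1} \<subseteq> M False \<union> (\<Union>m\<in>{..n}. ball (\<gamma> (m / n)) r)"
    "\<And>t. t \<in> {0..1} \<Longrightarrow> dist (\<gamma> t) (\<beta> t) < 3 * (e / 10) + r"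
    by (rule path_along_shadow[OF n(1) osc M(2)[of False] sh \<delta>(2) loc]) (assumption+, rule that)
  have "x' \<notin> \<beta> ` {0..1}"
  proof
    assume "x' \<in> \<beta> ` {0..1}"
    then consider "x' \<in> M False" | m where "m \<le> n" "dist (\<gamma> (m / n)) x' < r" using \<beta>(3) by auto
    then show False
    proof cases
      case 1
      then show False using M(1) x'(1) by blast
    next
      case 2
      then have "3 * r \<le> dist (\<gamma> (m / n)) x" by (intro r(3)) (auto simp: Z_def)
      then show False using 2(2) x'(2) \<delta>(2) dist_triangle[of "\<gamma> (m / n)" x x'] r(1)
        by (simp add: dist_commute)
    qed
  qed
  moreover have "dist (\<alpha> t) (\<beta> t) < e" if "t \<in> {0..1}" for t
    using \<beta>(4)[OF that] bspec[OF \<gamma>(4) that] dist_triangle[of "\<alpha> t" "\<beta> t" "\<gamma> t"] r(2) e by simp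
  moreover have "dist x x' < e" using x'(2) \<delta>(2) r(2) e by simp
  moreover have "x' \<in> X" using x'(1) M(2) by blast
  ultimately show ?thesis using \<beta>(1,2) by blast
qed

text \<open>Each path is first moved off the mesh points of the other one. Then both follow disjoint
  shadows, except in balls around their own mesh points, and these are so small that the other
  path does not meet them.\<close>

lemma DDP_imp_disjoint_paths:
  fixes X :: "'a::metric_space set"
  assumes X: "homeomorphic_to_ENR X" and ddp: "disjoint_disks_property (X \<times> (UNIV :: real set))"
  shows "disjoint_paths_property X"
  unfolding disjoint_paths_property_def
proof (intro allI impI, elim conjE)
  fix \<alpha>1 \<alpha>2 :: "real \<Rightarrow> 'a" and e :: real
  assume c: "continuous_on {0..1} \<alpha>1" "\<alpha>1 ` {0..1} \<subseteq> X" "continuous_on {0..1} \<alpha>2" "\<alpha>2 ` {0..1} \<subseteq> X"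
    and e: "0 < e"
  define \<alpha> where "\<alpha> i = (if i then \<alpha>1 else \<alpha>2)" for i
  have \<alpha>: "continuous_on {0..1} (\<alpha> i)" "\<alpha> i ` {0..1} \<subseteq> X" for i
    using c unfolding \<alpha>_def by (cases i; simp)+
  have e10: "0 < e / 10" using e by simp
  obtain N where N: "\<And>i. (0::nat) < N i" "\<And>i. \<forall>n\<ge>N i. \<forall>m<n. \<forall>s\<in>{real m / real n..real (Suc m) / real n}.
      \<forall>t\<in>{real m / real n..real (Suc m) / real n}. dist (\<alpha> i s) (\<alpha> i t) < e / 10"
    using path_mesh[OF \<alpha>(1) e10] by metis
  define n where "n = max (N True) (N False)"
  have n: "0 < n" "N i \<le> n" for i using N(1)[of True] unfolding n_def by (auto, cases i) auto
  define Z where "Z = (\<lambda>m. real m / real n) ` {..n}"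
  have Z: "finite Z" "Z \<subseteq> {0..1}" unfolding Z_def using n(1) by (auto simp: field_simps)
  define a0 where "a0 i z = \<alpha> i (fst z)" for i and z :: "real \<times> real"
  have a0: "disk_pair X a0"
    unfolding disk_pair_def a0_def
    by (intro allI conjI continuous_on_compose2[OF \<alpha>(1)] continuous_intros) (use \<alpha>(2) in \<open>auto simp: image_subset_iff\<close>)
  define line where "line = {0..1::real} \<times> {0::real}"
  have line: "compact line" "line \<subseteq> unit_square" unfolding line_def by (auto intro: compact_Times)
  \<comment> \<open>the paths are treated as the bottom sides of two disks, so that finitely many separations can
    be combined\<close>
  define P where "P = (\<lambda>(i, z). (i, {(z, 0::real)}, \<not> i, line)) ` (UNIV \<times> Z)"
  obtain b where b: "disk_pair X b" "close_pairs (e / 10) a0 b"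
    "\<And>i A i' A'. (i, A, i', A') \<in> P \<Longrightarrow> b i ` A \<inter> b i' ` A' = {}"
  proof (rule separate_finitely_many[OF a0 e10, of P])
    show "finite P" unfolding P_def using Z(1) by simp
    fix i A i' A' assume "(i, A, i', A') \<in> P"
    then obtain s where P: "A = {(s, 0)}" "i' = (\<not> i)" "A' = line" "s \<in> Z" unfolding P_def by auto
    then have s: "s \<in> {0..1}" using Z(2) by blast
    show "compact A \<and> A \<subseteq> unit_square \<and> compact A' \<and> A' \<subseteq> unit_square"
      using line s unfolding P by auto
    fix a :: "bool \<Rightarrow> real \<times> real \<Rightarrow> 'a" and r :: real assume a: "disk_pair X a" and r: "0 < r"
    obtain d where d: "0 < d"
      "\<forall>(A :: bool \<Rightarrow> _) w.
       (\<forall>i. compact (A i) \<and> A i \<subseteq> unit_square \<and> continuous_on (A i) (w i) \<and> w i ` A i \<subseteq> X \<and>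
         (\<forall>z\<in>A i. dist (a i z) (w i z) < d)) \<longrightarrow>
       (\<exists>b. disk_pair X b \<and> close_pairs r a b \<and> (\<forall>i. \<forall>z\<in>A i. b i z = w i z))"
      using disk_pair_extension[OF X a r] by (elim exE conjE) (rule that)
    have ca: "continuous_on unit_square (a k)" "\<And>z. z \<in> unit_square \<Longrightarrow> a k z \<in> X" for k
      using a unfolding disk_pair_def by blast+
    have "a i (s, 0) \<in> X" using s by (intro ca) auto
    moreover have "continuous_on {0..1} (\<lambda>t. a (\<not> i) (t, 0))"
      by (rule continuous_on_compose2[OF ca(1)]) (auto intro!: continuous_intros)
    moreover have "(\<lambda>t. a (\<not> i) (t, 0)) ` {0..1} \<subseteq> X" by (intro image_subsetI ca) auto
    ultimately have "\<exists>x' \<beta>. x' \<in> X \<and> dist (a i (s, 0)) x' < d \<and> continuous_on {0..1} \<beta> \<and>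
        \<beta> ` {0..1} \<subseteq> X \<and> (\<forall>t\<in>{0..1::real}. dist (a (\<not> i) (t, 0)) (\<beta> t) < d) \<and> x' \<notin> \<beta> ` {0..1}"
      by (rule point_off_path[OF X ddp _ _ _ d(1)])
    then obtain x' \<beta> where x': "x' \<in> X" "dist (a i (s, 0)) x' < d" "continuous_on {0..1} \<beta>"
        "\<beta> ` {0..1} \<subseteq> X" "\<forall>t\<in>{0..1::real}. dist (a (\<not> i) (t, 0)) (\<beta> t) < d" "x' \<notin> \<beta> ` {0..1}"
      by (elim exE conjE) (rule that)
    define w where "w k z = (if k = i then x' else \<beta> (fst z))" for k and z :: "real \<times> real"
    define S where "S k = (if k = i then {(s, 0)} else line)" for k
    have "\<exists>b. disk_pair X b \<and> close_pairs r a b \<and> (\<forall>k. \<forall>z\<in>S k. b k z = w k z)"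
    proof (rule d(2)[THEN spec, THEN spec, THEN mp], intro allI)
      fix k
      have "continuous_on line (\<lambda>z. \<beta> (fst z))"
        by (rule continuous_on_compose2[OF x'(3)]) (auto simp: line_def intro: continuous_intros)
      then show "compact (S k) \<and> S k \<subseteq> unit_square \<and> continuous_on (S k) (w k) \<and> w k ` S k \<subseteq> X \<and>
         (\<forall>z\<in>S k. dist (a k z) (w k z) < d)"
        using line s x'(1,2,4,5) unfolding S_def w_def by (cases "k = i") (auto simp: line_def)
    qed
    then obtain b where b: "disk_pair X b" "close_pairs r a b" "\<forall>k. \<forall>z\<in>S k. b k z = w k z"
      by (elim exE conjE) (rule that)
    have "b i (s, 0) = x'" using b(3)[rule_format, of "(s, 0)" i] unfolding S_def w_def by simp
    moreover have "b (\<not> i) z = \<beta> (fst z)" if "z \<in> line" for z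
      using b(3)[rule_format, of z "\<not> i"] that unfolding S_def w_def by simp
    moreover have "fst z \<in> {0..1}" if "z \<in> line" for z using that unfolding line_def by auto
    ultimately have "b i ` A \<inter> b i' ` A' = {}" unfolding P using x'(6) by auto
    then show "\<exists>b. disk_pair X b \<and> close_pairs r a b \<and> b i ` A \<inter> b i' ` A' = {}" using b by blast
  qed (rule that; assumption)
  define g where "g i t = b i (t, 0)" for i and t :: real
  have cb: "continuous_on unit_square (b i)" "\<And>z. z \<in> unit_square \<Longrightarrow> b i z \<in> X" for i
    using b(1) unfolding disk_pair_def by blast+
  have g: "continuous_on {0..1} (g i)" "g i ` {0..1} \<subseteq> X" for i
  proof -
    show "continuous_on {0..1} (g i)"
      unfolding g_def by (rule continuous_on_compose2[OF cb(1)]) (auto intro!: continuous_intros)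
    show "g i ` {0..1} \<subseteq> X" unfolding g_def by (intro image_subsetI cb) auto
  qed
  have g\<alpha>: "dist (\<alpha> i t) (g i t) < e / 10" if "t \<in> {0..1}" for i t
    using b(2)[unfolded close_pairs_def, THEN spec[of _ i], THEN bspec[of _ _ "(t, 0)"]] that
    unfolding g_def a0_def by simp
  have off: "g i z \<noteq> g (\<not> i) t" if "z \<in> Z" "t \<in> {0..1}" for i z t
  proof -
    have "(i, {(z, 0)}, \<not> i, line) \<in> P" unfolding P_def using that(1) by (intro image_eqI[of _ _ "(i, z)"]) auto
    from b(3)[OF this] show ?thesis using that(2) unfolding g_def line_def by auto
  qed
  have "\<exists>d>0. \<forall>z\<in>Z. \<forall>t\<in>{0..1}. d \<le> dist (g i z) (g (\<not> i) t)" for i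
  proof -
    have cd: "continuous_on (Z \<times> {0..1}) (\<lambda>p. dist (g i (fst p)) (g (\<not> i) (snd p)))"
      by (intro continuous_intros continuous_on_compose2[OF g(1)]) (use Z(2) in auto)
    have pd: "0 < dist (g i (fst p)) (g (\<not> i) (snd p))" if "p \<in> Z \<times> {0..1}" for p
      using off[of "fst p" "snd p" i] that by (simp add: mem_Times_iff)
    obtain d where "0 < d" "\<And>p. p \<in> Z \<times> {0..1} \<Longrightarrow> d \<le> dist (g i (fst p)) (g (\<not> i) (snd p))"
      by (rule compact_pos_lower_bound[OF compact_Times[OF finite_imp_compact[OF Z(1)] compact_Icc] cd pd])
         (assumption, rule that)
    then show ?thesis by (intro exI[of _ d]) auto
  qed
  then obtain d where d: "\<And>i. 0 < d i" "\<And>i. \<forall>z\<in>Z. \<forall>t\<in>{0..1}. d i \<le> dist (g i z) (g (\<not> i) t)"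
    by metis
  \<comment> \<open>now each path has distance at least \<open>3 * r\<close> from the mesh points of the other one; points
    within \<open>r\<close> of the other one are then not in the balls of radius \<open>r\<close> around these mesh points\<close>
  define r where "r = min (e / 30) (min (d True) (d False) / 3)"
  have r: "0 < r" "r \<le> e / 30" "3 * r \<le> d i" for i using e d(1) unfolding r_def by (auto, cases i) auto
  have "\<exists>\<delta>>0. \<forall>p\<in>g i ` {0..1}. \<forall>y\<in>X. dist p y < \<delta> \<longrightarrow> path_component (X \<inter> ball p r) p y" for i
    by (rule ENR_local_paths[OF X compact_continuous_image[OF g(1) compact_Icc] g(2) r(1)])
  then obtain \<delta>0 where \<delta>0: "\<And>i. 0 < \<delta>0 i"
      "\<And>i. \<forall>p\<in>g i ` {0..1}. \<forall>y\<in>X. dist p y < \<delta>0 i \<longrightarrow> path_component (X \<inter> ball p r) p y"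
    by metis
  define \<delta> where "\<delta> = min r (min (\<delta>0 True) (\<delta>0 False))"
  have \<delta>: "0 < \<delta>" "\<delta> \<le> r" "\<delta> \<le> \<delta>0 i" for i using \<delta>0(1) r(1) unfolding \<delta>_def by (auto, cases i) auto
  obtain M where M: "M True \<inter> M False = {}" "\<And>i. M i \<subseteq> X" "\<And>i. shadows_path (M i) \<delta> (g i)"
    by (rule DDP_disjoint_shadows[OF ddp g \<delta>(1)]) (rule that; assumption)
  have "\<exists>\<beta>. continuous_on {0..1} \<beta> \<and> \<beta> ` {0..1} \<subseteq> X \<and>
    \<beta> ` {0..1} \<subseteq> M i \<union> (\<Union>m\<in>{..n}. ball (g i (m / n)) r) \<and>
    (\<forall>t\<in>{0..1}. dist (g i t) (\<beta> t) < 3 * (e / 10) + r)" for i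
  proof -
    have osc: "dist (g i s) (g i t) < 3 * (e / 10)"
      if "m < n" "s \<in> {m / n..Suc m / n}" "t \<in> {m / n..Suc m / n}" for m s t
    proof -
      have st: "s \<in> {0..1}" "t \<in> {0..1}" using mesh_interval(4)[OF that(1)] that(2,3) by blast+
      have "dist (\<alpha> i s) (\<alpha> i t) < e / 10" using N(2)[of i] n(2)[of i] that by blast
      then show ?thesis
        using g\<alpha>[OF st(1), of i] g\<alpha>[OF st(2), of i]
          dist_triangle[of "g i s" "g i t" "\<alpha> i s"] dist_triangle[of "\<alpha> i s" "g i t" "\<alpha> i t"]
        by (simp add: dist_commute)
    qed
    have loc: "\<forall>p\<in>g i ` {0..1}. \<forall>y\<in>X. dist p y < \<delta> \<longrightarrow> path_component (X \<inter> ball p r) p y"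
      using \<delta>0(2)[of i] \<delta>(3)[of i] by (meson less_le_trans)
    obtain \<beta> where "continuous_on {0..1} \<beta>" "\<beta> ` {0..1} \<subseteq> X"
      "\<beta> ` {0..1} \<subseteq> M i \<union> (\<Union>m\<in>{..n}. ball (g i (m / n)) r)"
      "\<And>t. t \<in> {0..1} \<Longrightarrow> dist (g i t) (\<beta> t) < 3 * (e / 10) + r"
      by (rule path_along_shadow[OF n(1) osc M(2)[of i] M(3)[of i] \<delta>(2) loc]) (assumption+, rule that)
    then show ?thesis by blast
  qed
  then obtain \<beta> where \<beta>: "\<And>i. continuous_on {0..1} (\<beta> i)" "\<And>i. \<beta> i ` {0..1} \<subseteq> X"
    "\<And>i. \<beta> i ` {0..1} \<subseteq> M i \<union> (\<Union>m\<in>{..n}. ball (g i (m / n)) r)"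
    "\<And>i. \<forall>t\<in>{0..1}. dist (g i t) (\<beta> i t) < 3 * (e / 10) + r"
    by metis
  have far: False if x: "x \<in> ball (g i (m / n)) r" "m \<le> n" "t \<in> {0..1}" "dist x (g (\<not> i) t) < r" for i x m t
  proof -
    have "real m / real n \<in> Z" using that(2) unfolding Z_def by blast
    then have "3 * r \<le> dist (g i (m / n)) (g (\<not> i) t)" using d(2)[of i] that(3) r(3)[of i] by fastforce
    then show False
      using that(1,4) dist_triangle[of "g i (m / n)" "g (\<not> i) t" x] r(1) by simp
  qed
  have disj: "\<beta> True ` {0..1} \<inter> \<beta> False ` {0..1} = {}"
  proof (rule ccontr)
    assume "\<beta> True ` {0..1} \<inter> \<beta> False ` {0..1} \<noteq> {}"
    then obtain x where x: "x \<in> \<beta> i ` {0..1}" for i by (metis (full_types) disjoint_iff)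
    have near: "\<exists>t\<in>{0..1}. dist x (g i t) < r" for i
    proof -
      have "x \<in> M i \<or> (\<exists>m\<le>n. dist (g i (m / n)) x < r)" using \<beta>(3)[of i] x[of i] by auto
      then show ?thesis
      proof
        assume "x \<in> M i"
        then have "\<exists>t\<in>{0..1}. dist x (g i t) < \<delta>" using M(3)[of i] unfolding shadows_path_def by blast
        then show ?thesis using \<delta>(2) by (meson less_le_trans)
      next
        assume "\<exists>m\<le>n. dist (g i (m / n)) x < r"
        then obtain m where m: "m \<le> n" "dist (g i (m / n)) x < r" by blast
        then have "real m / real n \<in> {0..1}" using Z(2) unfolding Z_def by blast
        then show ?thesis using m(2) by (metis dist_commute)
      qed
    qed
    have "x \<in> M i" for i
    proof (rule ccontr)
      assume "x \<notin> M i"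
      then obtain m where "m \<le> n" "x \<in> ball (g i (m / n)) r" using \<beta>(3)[of i] x[of i] by blast
      then show False using near[of "\<not> i"] far by blast
    qed
    then show False using M(1) by blast
  qed
  have cl: "dist (\<alpha> i t) (\<beta> i t) < e" if "t \<in> {0..1}" for i t
    using g\<alpha>[OF that, of i] bspec[OF \<beta>(4)[of i] that] dist_triangle[of "\<alpha> i t" "\<beta> i t" "g i t"] r(2) e
    by simp
  show "\<exists>\<beta>1 \<beta>2. continuous_on {0..1} \<beta>1 \<and> \<beta>1 ` {0..1} \<subseteq> X \<and> continuous_on {0..1} \<beta>2 \<and> \<beta>2 ` {0..1} \<subseteq> X \<and>
      (\<forall>t\<in>{0..1}. dist (\<alpha>1 t) (\<beta>1 t) < e) \<and> (\<forall>t\<in>{0..1}. dist (\<alpha>2 t) (\<beta>2 t) < e) \<and>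
      \<beta>1 ` {0..1} \<inter> \<beta>2 ` {0..1} = {}"
    using \<beta>(1,2) cl[of _ True] cl[of _ False] disj unfolding \<alpha>_def
    by (intro exI[of _ "\<beta> True"] exI[of _ "\<beta> False"]) simp
qed

section \<open>Concordances from disjoint disks\<close>

text \<open>Disjoint disks near \<open>z \<mapsto> (a i z, snd z)\<close> fail to be concordances only because their heights
  at \<open>snd z = 0\<close> and \<open>snd z = 1\<close> are wrong. Once the ends of \<open>a True\<close> and \<open>a False\<close> are disjoint,
  the components in \<open>X\<close> stay apart for all times near the ends, so heights may be corrected there.\<close>

lemma DDP_imp_DCP:
  fixes X :: "'a::metric_space set"
  assumes X: "homeomorphic_to_ENR X" and ddp: "disjoint_disks_property (X \<times> (UNIV :: real set))"
  shows "disjoint_path_concordances_property X"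
  unfolding disjoint_path_concordances_property_def
proof (intro allI impI, elim conjE)
  fix f1 f2 :: "real \<times> real \<Rightarrow> 'a" and e :: real
  assume f: "path_homotopy X f1" "path_homotopy X f2" and e: "0 < e"
  have dpp: "disjoint_paths_property X" by (rule DDP_imp_disjoint_paths[OF X ddp])
  define f where "f i = (if i then f1 else f2)" for i
  have df: "disk_pair X f"
    using f unfolding disk_pair_def f_def path_homotopy_def by auto
  define P where "P = (\<lambda>c::real. (True, {0..1::real} \<times> {c}, False, {0..1::real} \<times> {c})) ` {0, 1}"
  have e2: "0 < e / 2" using e by simp
  obtain a where a: "disk_pair X a" "close_pairs (e / 2) f a"
    "\<And>i A i' A'. (i, A, i', A') \<in> P \<Longrightarrow> a i ` A \<inter> a i' ` A' = {}"
  proof (rule separate_finitely_many_arcs[OF X dpp df e2, of P])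
    show "finite P" unfolding P_def by simp
    show "arc_like A \<and> arc_like A' \<and> (i = i' \<longrightarrow> A \<inter> A' = {})" if "(i, A, i', A') \<in> P" for i A i' A'
      using that arc_like_segments(1)[of 0] arc_like_segments(1)[of 1] unfolding P_def by auto
  qed (rule that; assumption)
  have ends: "a True (s, c) \<noteq> a False (t, c)" if "s \<in> {0..1}" "t \<in> {0..1}" "c \<in> {0, 1}" for s t c
  proof -
    have "(True, {0..1} \<times> {c}, False, {0..1} \<times> {c}) \<in> P" unfolding P_def using that(3) by blast
    moreover have "(s, c) \<in> {0..1} \<times> {c}" "(t, c) \<in> {0..1} \<times> {c}" using that by auto
    ultimately show ?thesis using a(3) by (metis disjoint_iff imageI)
  qed
  have ca: "continuous_on unit_square (a i)" "\<And>z. z \<in> unit_square \<Longrightarrow> a i z \<in> X" for i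
    using a(1) unfolding disk_pair_def by blast+
  have cQ: "compact (unit_square \<times> unit_square)" by (intro compact_Times compact_unit_square)
  \<comment> \<open>near each end, the components in \<open>X\<close> are a definite distance apart\<close>
  have "\<exists>m>0. \<forall>z\<in>unit_square. \<forall>z'\<in>unit_square.
      m \<le> \<bar>snd z - c\<bar> + \<bar>snd z' - c\<bar> + dist (a True z) (a False z')" if c: "c \<in> {0, 1}" for c
  proof -
    have cd: "continuous_on (unit_square \<times> unit_square)
        (\<lambda>p. \<bar>snd (fst p) - c\<bar> + \<bar>snd (snd p) - c\<bar> + dist (a True (fst p)) (a False (snd p)))"
      by (intro continuous_intros continuous_on_compose2[OF ca(1)]) auto
    have pd: "0 < \<bar>snd (fst p) - c\<bar> + \<bar>snd (snd p) - c\<bar> + dist (a True (fst p)) (a False (snd p))"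
      if p: "p \<in> unit_square \<times> unit_square" for p
    proof (rule ccontr)
      assume "\<not> ?thesis"
      then have "dist (a True (fst p)) (a False (snd p)) \<le> 0" "snd (fst p) = c" "snd (snd p) = c"
        using zero_le_dist[of "a True (fst p)" "a False (snd p)"] by linarith+
      moreover have "fst (fst p) \<in> {0..1}" "fst (snd p) \<in> {0..1}" using p by (auto simp: mem_Times_iff)
      ultimately show False using ends[OF _ _ c, of "fst (fst p)" "fst (snd p)"] by (metis dist_le_zero_iff prod.collapse)
    qed
    obtain m where "0 < m" "\<And>p. p \<in> unit_square \<times> unit_square \<Longrightarrow>
        m \<le> \<bar>snd (fst p) - c\<bar> + \<bar>snd (snd p) - c\<bar> + dist (a True (fst p)) (a False (snd p))"
      by (rule compact_pos_lower_bound[OF cQ cd pd]) (assumption, rule that)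
    then show ?thesis by (intro exI[of _ m]) (metis SigmaI fst_conv snd_conv)
  qed
  from this[of 0] this[of 1] obtain m0 m1 where m0: "0 < m0" "0 < m1"
    "\<forall>z\<in>unit_square. \<forall>z'\<in>unit_square. m0 \<le> \<bar>snd z - 0\<bar> + \<bar>snd z' - 0\<bar> + dist (a True z) (a False z')"
    "\<forall>z\<in>unit_square. \<forall>z'\<in>unit_square. m1 \<le> \<bar>snd z - 1\<bar> + \<bar>snd z' - 1\<bar> + dist (a True z) (a False z')"
    by auto
  define m where "m = min m0 m1"
  have m: "0 < m" "\<And>z z' c. z \<in> unit_square \<Longrightarrow> z' \<in> unit_square \<Longrightarrow> c \<in> {0, 1} \<Longrightarrow>
      m \<le> \<bar>snd z - c\<bar> + \<bar>snd z' - c\<bar> + dist (a True z) (a False z')"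
  proof -
    show "0 < m" using m0(1,2) unfolding m_def by simp
    fix z z' :: "real \<times> real" and c :: real
    assume z: "z \<in> unit_square" "z' \<in> unit_square" and c: "c \<in> {0, 1}"
    show "m \<le> \<bar>snd z - c\<bar> + \<bar>snd z' - c\<bar> + dist (a True z) (a False z')"
      using bspec[OF bspec[OF m0(3) z(1)] z(2)] bspec[OF bspec[OF m0(4) z(1)] z(2)] c
      unfolding m_def by (cases "c = 0") simp_all
  qed
  define \<eta> where "\<eta> = min (1/20) (m / 20)"
  have \<eta>: "0 < \<eta>" "\<eta> \<le> 1/20" "\<eta> \<le> m / 20" using m(1) unfolding \<eta>_def by auto
  define \<epsilon> where "\<epsilon> = min \<eta> (e / 2)"
  have \<epsilon>: "0 < \<epsilon>" "\<epsilon> \<le> \<eta>" "\<epsilon> \<le> e / 2" using \<eta> e unfolding \<epsilon>_def by auto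
  have h: "continuous_on unit_square (\<lambda>z. (a i z, snd z))" "(\<lambda>z. (a i z, snd z)) ` unit_square \<subseteq> X \<times> UNIV" for i
  proof -
    show "continuous_on unit_square (\<lambda>z. (a i z, snd z))" by (intro continuous_intros ca(1))
    show "(\<lambda>z. (a i z, snd z)) ` unit_square \<subseteq> X \<times> UNIV"
      by (rule image_subsetI) (simp only: mem_Times_iff fst_conv ca(2) UNIV_I simp_thms)
  qed
  obtain g1 g2 where g12: "continuous_on unit_square g1" "g1 ` unit_square \<subseteq> X \<times> UNIV"
    "continuous_on unit_square g2" "g2 ` unit_square \<subseteq> X \<times> UNIV"
    "\<And>z. z \<in> unit_square \<Longrightarrow> dist (a True z, snd z) (g1 z) < \<epsilon>"
    "\<And>z. z \<in> unit_square \<Longrightarrow> dist (a False z, snd z) (g2 z) < \<epsilon>"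
    "g1 ` unit_square \<inter> g2 ` unit_square = {}"
    by (rule DDP_approximation[OF ddp h h \<epsilon>(1)]) (rule that; assumption)
  define g where "g i = (if i then g1 else g2)" for i
  have g: "continuous_on unit_square (g i)" "\<And>z. z \<in> unit_square \<Longrightarrow> g i z \<in> X \<times> UNIV"
    "\<And>z. z \<in> unit_square \<Longrightarrow> dist (a i z) (fst (g i z)) < \<epsilon>"
    "\<And>z. z \<in> unit_square \<Longrightarrow> \<bar>snd z - snd (g i z)\<bar> < \<epsilon>" for i
  proof -
    show "continuous_on unit_square (g i)" using g12(1,3) unfolding g_def by simp
    show "g i z \<in> X \<times> UNIV" if "z \<in> unit_square" for z
      using subsetD[OF g12(2) imageI[OF that]] subsetD[OF g12(4) imageI[OF that]] unfolding g_def by simp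
    have d: "dist (a i z, snd z) (g i z) < \<epsilon>" if "z \<in> unit_square" for z
      using g12(5,6)[OF that] unfolding g_def by (cases i) auto
    show "dist (a i z) (fst (g i z)) < \<epsilon>" if "z \<in> unit_square" for z
      using d[OF that] dist_fst_le[of "(a i z, snd z)" "g i z"] by simp
    show "\<bar>snd z - snd (g i z)\<bar> < \<epsilon>" if "z \<in> unit_square" for z
      using d[OF that] dist_snd_le[of "(a i z, snd z)" "g i z"] by (simp add: dist_real_def)
  qed
  \<comment> \<open>full weight for \<open>2 * \<eta> \<le> t \<le> 1 - 2 * \<eta>\<close>, none at the ends, and the bounds
    \<open>w t * \<eta> \<le> t / 2, (1 - t) / 2\<close> keep the heights in the unit interval\<close>
  define w where "w t = min 1 (min (t / (2 * \<eta>)) ((1 - t) / (2 * \<eta>)))" for t :: real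
  have w01: "0 \<le> w t" "w t \<le> 1" "w t * \<eta> \<le> t / 2" "w t * \<eta> \<le> (1 - t) / 2" if "t \<in> {0..1}" for t
  proof -
    show "0 \<le> w t" "w t \<le> 1" using that \<eta>(1) unfolding w_def by auto
    have "w t \<le> t / (2 * \<eta>)" "w t \<le> (1 - t) / (2 * \<eta>)" unfolding w_def by auto
    then show "w t * \<eta> \<le> t / 2" "w t * \<eta> \<le> (1 - t) / 2" using \<eta>(1) by (auto simp: field_simps)
  qed
  have w1: "w t = 1" if "2 * \<eta> \<le> t" "t \<le> 1 - 2 * \<eta>" for t
    using that \<eta>(1) unfolding w_def by (auto simp: min_def field_simps)
  have w0: "w 0 = 0" "w 1 = 0" unfolding w_def using \<eta>(1) by auto
  have cw: "continuous_on S w" for S unfolding w_def using \<eta>(1) by (intro continuous_intros) auto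
  define F where "F i z = (fst (g i z), snd z + w (snd z) * (snd (g i z) - snd z))" for i z
  have Fh: "\<bar>snd (F i z) - snd z\<bar> < \<eta>" "0 \<le> snd (F i z)" "snd (F i z) \<le> 1" if z: "z \<in> unit_square" for i z
  proof -
    have t: "snd z \<in> {0..1}" using z by (auto simp: mem_Times_iff)
    have "\<bar>w (snd z) * (snd (g i z) - snd z)\<bar> = w (snd z) * \<bar>snd (g i z) - snd z\<bar>"
      using w01(1)[OF t] by (simp add: abs_mult)
    also have "\<dots> \<le> w (snd z) * \<epsilon>"
      using g(4)[OF z, of i] w01(1)[OF t] by (intro mult_left_mono) auto
    finally have 1: "\<bar>w (snd z) * (snd (g i z) - snd z)\<bar> \<le> w (snd z) * \<epsilon>" .
    have 2: "w (snd z) * \<epsilon> \<le> w (snd z) * \<eta>" using \<epsilon>(2) w01(1)[OF t] by (intro mult_left_mono) auto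
    have 3: "w (snd z) * \<eta> \<le> 1/2 * snd z" "w (snd z) * \<eta> \<le> 1/2 * (1 - snd z)"
      using w01(3,4)[OF t] by auto
    show "0 \<le> snd (F i z)" "snd (F i z) \<le> 1" using 1 2 3 t unfolding F_def by auto
    have "\<bar>w (snd z) * (snd (g i z) - snd z)\<bar> \<le> 1 * \<bar>snd (g i z) - snd z\<bar>"
      unfolding abs_mult using w01(1,2)[OF t] by (intro mult_right_mono) auto
    then show "\<bar>snd (F i z) - snd z\<bar> < \<eta>" using g(4)[OF z, of i] \<epsilon>(2) unfolding F_def by auto
  qed
  have conc: "path_concordance X (F i)" for i
    unfolding path_concordance_def
  proof (intro conjI ballI)
    show "continuous_on unit_square (F i)"
      unfolding F_def by (intro continuous_intros g(1) continuous_on_compose2[OF cw[of UNIV]]) auto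
    have FX: "fst (F i z) \<in> X" if "z \<in> unit_square" for z
      using g(2)[OF that, of i] unfolding F_def by (auto simp: mem_Times_iff)
    show "F i ` unit_square \<subseteq> X \<times> {0..1}"
    proof (rule image_subsetI)
      fix z assume "z \<in> unit_square"
      then show "F i z \<in> X \<times> {0..1}" using FX Fh(2,3)[of z i] by (simp only: mem_Times_iff atLeastAtMost_iff)
    qed
    fix c :: real assume c: "c \<in> {0, 1}"
    show "F i ` ({0..1} \<times> {c}) \<subseteq> X \<times> {c}"
    proof (rule image_subsetI)
      fix z :: "real \<times> real" assume z: "z \<in> {0..1} \<times> {c}"
      then have "z \<in> unit_square" "snd z = c" using c by (auto simp: mem_Times_iff)
      moreover have "w c = 0" using w0 c by auto
      ultimately show "F i z \<in> X \<times> {c}" using FX[of z] by (simp add: mem_Times_iff F_def)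
    qed
  qed
  have ne: "F True z \<noteq> F False z'" if z: "z \<in> unit_square" "z' \<in> unit_square" for z z'
  proof
    assume eq: "F True z = F False z'"
    have fst: "fst (g True z) = fst (g False z')" using eq unfolding F_def by simp
    have close: "\<bar>snd z - snd z'\<bar> < 2 * \<eta>"
      using Fh(1)[OF z(1), of True] Fh(1)[OF z(2), of False] eq by auto
    have "dist (a True z) (a False z') < 2 * \<epsilon>"
      using g(3)[OF z(1), of True] g(3)[OF z(2), of False] fst
        dist_triangle2[of "a True z" "a False z'" "fst (g True z)"] by simp
    then have d: "dist (a True z) (a False z') < 2 * \<eta>" using \<epsilon>(2) by linarith
    \<comment> \<open>nearer to the ends, the bound \<open>m\<close> excludes an intersection\<close>
    have mid: "4 * \<eta> \<le> snd z \<and> snd z \<le> 1 - 4 * \<eta>"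
    proof (rule ccontr)
      assume n: "\<not> ?thesis"
      have t: "snd z \<in> {0..1}" "snd z' \<in> {0..1}" using z by (auto simp: mem_Times_iff)
      then consider "snd z < 4 * \<eta>" | "1 - snd z < 4 * \<eta>" using n by auto
      then show False
      proof cases
        case 1
        then show False using m(2)[OF z, of 0] t close d \<eta>(1,3) by auto
      next
        case 2
        then show False using m(2)[OF z, of 1] t close d \<eta>(1,3) by auto
      qed
    qed
    then have "w (snd z) = 1" "w (snd z') = 1" using close \<eta>(1) by (auto intro!: w1)
    then have "g True z = g False z'" using eq unfolding F_def by (simp add: prod_eq_iff)
    then show False using g12(7) z unfolding g_def by (metis (full_types) disjoint_iff imageI)
  qed
  have cl: "dist (f i z) (fst (F i z)) < e" if z: "z \<in> unit_square" for i z
    using a(2)[unfolded close_pairs_def, THEN spec[of _ i], THEN bspec[OF _ z]] g(3)[OF z, of i] \<epsilon>(3)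
      dist_triangle[of "f i z" "fst (g i z)" "a i z"] unfolding F_def by simp
  show "\<exists>F1 F2. path_concordance X F1 \<and> path_concordance X F2 \<and> F1 ` unit_square \<inter> F2 ` unit_square = {} \<and>
     (\<forall>z\<in>unit_square. dist (f1 z) (fst (F1 z)) < e) \<and> (\<forall>z\<in>unit_square. dist (f2 z) (fst (F2 z)) < e)"
  proof (rule exI[of _ "F True"], rule exI[of _ "F False"], intro conjI conc)
    show "F True ` unit_square \<inter> F False ` unit_square = {}"
    proof (rule equals0I, elim IntE imageE)
      fix x z z' assume "x = F True z" "z \<in> unit_square" "x = F False z'" "z' \<in> unit_square"
      then show False using ne[of z z'] by simp
    qed
    show "\<forall>z\<in>unit_square. dist (f1 z) (fst (F True z)) < e"
      by (rule ballI) (use cl[of _ True] in \<open>simp only: f_def if_True\<close>)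
    show "\<forall>z\<in>unit_square. dist (f2 z) (fst (F False z)) < e"
      by (rule ballI) (use cl[of _ False] in \<open>simp only: f_def if_False\<close>)
  qed
qed

section \<open>Resolving intersections by concordances\<close>

text \<open>The map \<open>(q, u)\<close>, with \<open>u\<close> rescaled from \<open>[c - \<eta>, c + \<eta>]\<close> to \<open>[0, 1]\<close>, embeds \<open>T\<close> in the
  square. Through its inverse \<open>f'\<close> becomes a path homotopy whose time is the rescaled height. In a
  concordance disjoint from one of \<open>f\<close>, the end conditions say that the height on the two sides
  \<open>u = c - \<eta>\<close> and \<open>u = c + \<eta>\<close> of \<open>T\<close> is the old one; this is the last conjunct.\<close>

lemma cell_against_strip:
  fixes X :: "'a::metric_space set" and q u :: "real \<times> real \<Rightarrow> real" and c \<eta> \<delta> :: real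
  assumes dcp: "disjoint_path_concordances_property X"
    and f: "continuous_on unit_square f" "\<And>z. z \<in> unit_square \<Longrightarrow> f z \<in> X"
    and f': "continuous_on unit_square f'" "\<And>z. z \<in> unit_square \<Longrightarrow> f' z \<in> X"
    and T: "compact T" "T \<subseteq> unit_square" "continuous_on T q" "q ` T \<subseteq> {0..1}"
    and u: "continuous_on T u" "\<And>z. z \<in> T \<Longrightarrow> \<bar>u z - c\<bar> \<le> \<eta>"
    and inj: "inj_on (\<lambda>z. (q z, u z)) T"
    and \<eta>: "0 < \<eta>" and \<delta>: "0 < \<delta>"
  shows "\<exists>F G. continuous_on unit_square F \<and> (\<forall>z\<in>unit_square. F z \<in> X \<times> {0..1}) \<and>
     continuous_on T G \<and> (\<forall>z\<in>T. G z \<in> X \<times> {0..1}) \<and>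
     (\<forall>z\<in>unit_square. \<forall>z'\<in>T. F z \<noteq> G z') \<and>
     (\<forall>z\<in>unit_square. dist (f z) (fst (F z)) < \<delta>) \<and> (\<forall>z\<in>T. dist (f' z) (fst (G z)) < \<delta>) \<and>
     (\<forall>z\<in>T. \<bar>u z - c\<bar> = \<eta> \<longrightarrow> \<eta> * (2 * snd (G z) - 1) = u z - c)"
proof -
  define \<Psi> where "\<Psi> z = (q z, (u z - c + \<eta>) / (2 * \<eta>))" for z
  have \<Psi>c: "continuous_on T \<Psi>" unfolding \<Psi>_def using \<eta> by (intro continuous_intros T u(1)) auto
  have \<Psi>Q: "\<Psi> z \<in> unit_square" if "z \<in> T" for z
  proof -
    have "q z \<in> {0..1}" using T(4) that by blast
    moreover have "(u z - c + \<eta>) / (2 * \<eta>) \<in> {0..1}" using u(2)[OF that] \<eta> by (auto simp: field_simps abs_le_iff)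
    ultimately show ?thesis unfolding \<Psi>_def by (intro SigmaI)
  qed
  have \<Psi>i: "inj_on \<Psi> T"
  proof (rule inj_onI)
    fix z z' assume z: "z \<in> T" "z' \<in> T" "\<Psi> z = \<Psi> z'"
    then have "(q z, u z) = (q z', u z')" using \<eta> unfolding \<Psi>_def by (simp add: field_simps)
    then show "z = z'" using inj_onD[OF inj _ z(1,2)] by simp
  qed
  obtain \<Phi> where \<Phi>: "continuous_on UNIV \<Phi>" "range \<Phi> \<subseteq> unit_square" "\<And>z. z \<in> T \<Longrightarrow> \<Phi> (\<Psi> z) = z"
    by (rule inverse_extension[OF T(1,2) \<Psi>c \<Psi>i]) (rule that; assumption)
  have ph1: "path_homotopy X f" unfolding path_homotopy_def using f by blast
  have ph2: "path_homotopy X (\<lambda>z. f' (\<Phi> z))"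
    unfolding path_homotopy_def
  proof
    show "continuous_on unit_square (\<lambda>z. f' (\<Phi> z))"
      by (rule continuous_on_compose2[OF f'(1) continuous_on_subset[OF \<Phi>(1)]]) (use \<Phi>(2) in auto)
    show "(\<lambda>z. f' (\<Phi> z)) ` unit_square \<subseteq> X"
      by (rule image_subsetI, rule f'(2), rule subsetD[OF \<Phi>(2) rangeI])
  qed
  obtain F1 F2 where F: "path_concordance X F1" "path_concordance X F2"
      "F1 ` unit_square \<inter> F2 ` unit_square = {}"
      "\<And>z. z \<in> unit_square \<Longrightarrow> dist (f z) (fst (F1 z)) < \<delta>"
      "\<And>z. z \<in> unit_square \<Longrightarrow> dist (f' (\<Phi> z)) (fst (F2 z)) < \<delta>"
    by (rule DCP_approximation[OF dcp ph1 ph2 \<delta>]) (rule that; assumption)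
  have F1: "continuous_on unit_square F1" "\<And>z. z \<in> unit_square \<Longrightarrow> F1 z \<in> X \<times> {0..1}"
    using F(1) unfolding path_concordance_def by blast+
  have F2: "continuous_on unit_square F2" "\<And>z. z \<in> unit_square \<Longrightarrow> F2 z \<in> X \<times> {0..1}"
     "\<And>s e. s \<in> {0..1} \<Longrightarrow> e \<in> {0,1} \<Longrightarrow> F2 (s, e) \<in> X \<times> {e}"
    using F(2) unfolding path_concordance_def by blast+
  show ?thesis
  proof (rule exI[of _ F1], rule exI[of _ "\<lambda>z. F2 (\<Psi> z)"], intro conjI ballI impI)
    show "continuous_on T (\<lambda>z. F2 (\<Psi> z))"
      by (rule continuous_on_compose2[OF F2(1) \<Psi>c]) (rule image_subsetI, rule \<Psi>Q)
    show "F1 z \<noteq> F2 (\<Psi> z')" if "z \<in> unit_square" "z' \<in> T" for z z'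
      using F(3) imageI[OF that(1), of F1] imageI[OF \<Psi>Q[OF that(2)], of F2] by (metis disjoint_iff)
    show "dist (f' z) (fst (F2 (\<Psi> z))) < \<delta>" if "z \<in> T" for z
      using F(5)[OF \<Psi>Q[OF that]] \<Phi>(3)[OF that] by simp
    show "\<eta> * (2 * snd (F2 (\<Psi> z)) - 1) = u z - c" if z: "z \<in> T" "\<bar>u z - c\<bar> = \<eta>" for z
    proof -
      have q: "q z \<in> {0..1}" using T(4) z(1) by blast
      have "u z - c = - \<eta> \<or> u z - c = \<eta>" using z(2) by linarith
      then show ?thesis
      proof
        assume e: "u z - c = - \<eta>"
        then have "\<Psi> z = (q z, 0)" unfolding \<Psi>_def by simp
        then show ?thesis using F2(3)[OF q, of 0] e by (simp add: mem_Times_iff)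
      next
        assume e: "u z - c = \<eta>"
        then have "\<Psi> z = (q z, 1)" unfolding \<Psi>_def using \<eta> by simp
        then show ?thesis using F2(3)[OF q, of 1] e by (simp add: mem_Times_iff)
      qed
    qed
  qed (use F1 F2 F(4) \<Psi>Q in blast)+
qed

text \<open>Here \<open>u i\<close> are the heights of the disks. The set \<open>K i j\<close> is a cell on which disk \<open>i\<close> has
  constant height \<open>c i j\<close>; the points of the other disk that it may meet at nearly that height lie
  in a strip inside \<open>V i j\<close> that \<open>(q i j, u (\<not> i))\<close> embeds (\<open>capture\<close>, \<open>inj\<close>). Disjoint
  concordances prescribe new values on the cell and on the strip. By \<open>gap\<close>, and because the height
  is kept at the sides of a strip, no two of the prescriptions for one disk conflict, so they
  extend simultaneously. Two points outside all cells have distant images (\<open>walls\<close>) and need no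
  attention.\<close>

lemma concordance_assembly:
  fixes X :: "'a::metric_space set" and a and u :: "bool \<Rightarrow> real \<times> real \<Rightarrow> real" and J :: "bool \<Rightarrow> 'j set" and c :: "bool \<Rightarrow> 'j \<Rightarrow> real"
    and K V :: "bool \<Rightarrow> 'j \<Rightarrow> (real \<times> real) set" and q :: "bool \<Rightarrow> 'j \<Rightarrow> real \<times> real \<Rightarrow> real"
  assumes X: "homeomorphic_to_ENR X" and dcp: "disjoint_path_concordances_property X"
    and a: "disk_pair X a" and u: "\<And>i. continuous_on unit_square (u i)"
    and \<epsilon>: "0 < \<epsilon>" and \<eta>: "0 < \<eta>" and J: "\<And>i. finite (J i)"
    and gap: "\<And>i j i' j'. j \<in> J i \<Longrightarrow> j' \<in> J i' \<Longrightarrow> (i, j) \<noteq> (i', j') \<Longrightarrow> 10 * \<eta> < \<bar>c i j - c i' j'\<bar>"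
    and K: "\<And>i j. j \<in> J i \<Longrightarrow> compact (K i j)" "\<And>i j. j \<in> J i \<Longrightarrow> K i j \<subseteq> unit_square"
      "\<And>i j z. j \<in> J i \<Longrightarrow> z \<in> K i j \<Longrightarrow> u i z = c i j"
    and V: "\<And>i j. j \<in> J i \<Longrightarrow> compact (V i j)" "\<And>i j. j \<in> J i \<Longrightarrow> V i j \<subseteq> unit_square"
      "\<And>i j. j \<in> J i \<Longrightarrow> continuous_on (V i j) (q i j)" "\<And>i j. j \<in> J i \<Longrightarrow> q i j ` V i j \<subseteq> {0..1}"
    and inj: "\<And>i j. j \<in> J i \<Longrightarrow>
      inj_on (\<lambda>z. (q i j z, u (\<not> i) z)) {z \<in> V i j. \<bar>u (\<not> i) z - c i j\<bar> \<le> \<eta>}"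
    and capture: "\<And>i j z z'. j \<in> J i \<Longrightarrow> z \<in> K i j \<Longrightarrow> z' \<in> unit_square \<Longrightarrow>
      \<bar>u (\<not> i) z' - c i j\<bar> \<le> \<eta> \<Longrightarrow> dist (a i z) (a (\<not> i) z') < 2 * \<epsilon> \<Longrightarrow> z' \<in> V i j"
    and walls: "\<And>z z'. z \<in> unit_square \<Longrightarrow> z' \<in> unit_square \<Longrightarrow> z \<notin> (\<Union>j\<in>J True. K True j) \<Longrightarrow>
      z' \<notin> (\<Union>j\<in>J False. K False j) \<Longrightarrow> 2 * \<epsilon> \<le> dist (a True z) (a False z')"
  shows "\<exists>b v. disk_pair X b \<and> close_pairs \<epsilon> a b \<and>
    (\<forall>i. continuous_on unit_square (v i) \<and> (\<forall>z\<in>unit_square. \<bar>v i z - u i z\<bar> \<le> 2 * \<eta>)) \<and>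
    (\<forall>z\<in>unit_square. \<forall>z'\<in>unit_square. b True z = b False z' \<longrightarrow> v True z \<noteq> v False z')"
proof -
  obtain \<delta> where \<delta>: "0 < \<delta>"
      "\<forall>(A :: bool \<Rightarrow> _) w.
       (\<forall>i. compact (A i) \<and> A i \<subseteq> unit_square \<and> continuous_on (A i) (w i) \<and> w i ` A i \<subseteq> X \<and>
         (\<forall>z\<in>A i. dist (a i z) (w i z) < \<delta>)) \<longrightarrow>
       (\<exists>b. disk_pair X b \<and> close_pairs \<epsilon> a b \<and> (\<forall>i. \<forall>z\<in>A i. b i z = w i z))"
    using disk_pair_extension[OF X a \<epsilon>] by (elim exE conjE) (rule that)
  have ca: "continuous_on unit_square (a i)" "\<And>z. z \<in> unit_square \<Longrightarrow> a i z \<in> X" for i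
    using a unfolding disk_pair_def by blast+
  define T where "T i j = {z \<in> V i j. \<bar>u (\<not> i) z - c i j\<bar> \<le> \<eta>}" for i j
  have T: "compact (T i j)" "T i j \<subseteq> unit_square" "T i j \<subseteq> V i j"
    "continuous_on (T i j) (u (\<not> i))" if j: "j \<in> J i" for i j
  proof -
    show 1: "T i j \<subseteq> V i j" unfolding T_def by blast
    then show 2: "T i j \<subseteq> unit_square" using V(2)[OF j] by blast
    show "continuous_on (T i j) (u (\<not> i))" by (rule continuous_on_subset[OF u 2])
    have "T i j = V i j \<inter> (\<lambda>z. u (\<not> i) z - c i j) -` {- \<eta>..\<eta>}" unfolding T_def by (auto simp: abs_le_iff)
    moreover have "continuous_on (V i j) (\<lambda>z. u (\<not> i) z - c i j)"
      by (intro continuous_intros continuous_on_subset[OF u V(2)[OF j]])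
    ultimately show "compact (T i j)"
      using continuous_closedin_preimage[of "V i j" _ "{- \<eta>..\<eta>}"] closedin_compact[OF V(1)[OF j]] by simp
  qed
  have Tu: "\<bar>u (\<not> i) z - c i j\<bar> \<le> \<eta>" if "z \<in> T i j" for i j z using that unfolding T_def by blast
  define good where "good i j F G \<longleftrightarrow>
     continuous_on unit_square F \<and> (\<forall>z\<in>unit_square. F z \<in> X \<times> {0..1}) \<and>
     continuous_on (T i j) G \<and> (\<forall>z\<in>T i j. G z \<in> X \<times> {0..1}) \<and>
     (\<forall>z\<in>unit_square. \<forall>z'\<in>T i j. F z \<noteq> G z') \<and>
     (\<forall>z\<in>unit_square. dist (a i z) (fst (F z)) < \<delta>) \<and> (\<forall>z\<in>T i j. dist (a (\<not> i) z) (fst (G z)) < \<delta>) \<and>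
     (\<forall>z\<in>T i j. \<bar>u (\<not> i) z - c i j\<bar> = \<eta> \<longrightarrow> \<eta> * (2 * snd (G z) - 1) = u (\<not> i) z - c i j)" for i j F G
  have "\<exists>F G. good i j F G" if j: "j \<in> J i" for i j
    unfolding good_def
  proof (rule cell_against_strip[where q = "q i j", OF dcp ca ca T(1,2)[OF j]])
    show "continuous_on (T i j) (q i j)" by (rule continuous_on_subset[OF V(3)[OF j] T(3)[OF j]])
    show "q i j ` T i j \<subseteq> {0..1}" using V(4)[OF j] T(3)[OF j] by blast
    show "inj_on (\<lambda>z. (q i j z, u (\<not> i) z)) (T i j)" unfolding T_def by (rule inj[OF j])
  qed (assumption | rule T(4)[OF j] Tu \<eta> \<delta>(1))+
  then have "\<forall>i j. \<exists>P. j \<in> J i \<longrightarrow> good i j (fst P) (snd P)" by fastforce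
  then have "\<exists>P. \<forall>i j. j \<in> J i \<longrightarrow> good i j (fst (P i j)) (snd (P i j))"
    unfolding choice_iff .
  then obtain P where P: "\<forall>i j. j \<in> J i \<longrightarrow> good i j (fst (P i j)) (snd (P i j))" ..
  define F where "F i j = fst (P i j)" for i j
  define G where "G i j = snd (P i j)" for i j
  have FG: "good i j (F i j) (G i j)" if "j \<in> J i" for i j using P that unfolding F_def G_def by blast
  have F: "continuous_on unit_square (F i j)" "\<And>z. z \<in> unit_square \<Longrightarrow> F i j z \<in> X \<times> {0..1}"
      "\<And>z. z \<in> unit_square \<Longrightarrow> dist (a i z) (fst (F i j z)) < \<delta>"
      "\<And>z z'. z \<in> unit_square \<Longrightarrow> z' \<in> T i j \<Longrightarrow> F i j z \<noteq> G i j z'"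
    if "j \<in> J i" for i j using FG[OF that] unfolding good_def by blast+
  have G: "continuous_on (T i j) (G i j)" "\<And>z. z \<in> T i j \<Longrightarrow> G i j z \<in> X \<times> {0..1}"
      "\<And>z. z \<in> T i j \<Longrightarrow> dist (a (\<not> i) z) (fst (G i j z)) < \<delta>"
      "\<And>z. z \<in> T i j \<Longrightarrow> \<bar>u (\<not> i) z - c i j\<bar> = \<eta> \<Longrightarrow> \<eta> * (2 * snd (G i j z) - 1) = u (\<not> i) z - c i j"
    if "j \<in> J i" for i j using FG[OF that] unfolding good_def by blast+
  \<comment> \<open>The changes of disk \<open>i\<close> are prescribed on sets \<open>B i (k, j)\<close> of three kinds: its own cells
    (\<open>k = 0\<close>), its strips against the cells of the other disk (\<open>k = 1\<close>), and collars of these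
    strips (\<open>k = 2\<close>), where the height must not change, so that no further points enter the
    critical heights. The component in \<open>X\<close> is free on the collars. Here \<open>W\<close> is the prescribed
    component in \<open>X\<close>, and \<open>h\<close> the prescribed change of height.\<close>
  define I where "I i = {0::nat} \<times> J i \<union> {1, 2} \<times> J (\<not> i)" for i
  define B where "B i p = (case p of (k, j) \<Rightarrow> if k = 0 then K i j else if k = 1 then T (\<not> i) j
      else {z \<in> unit_square. \<eta> \<le> \<bar>u i z - c (\<not> i) j\<bar> \<and> \<bar>u i z - c (\<not> i) j\<bar> \<le> 4 * \<eta>})" for i and p :: "nat \<times> 'j"
  define W where "W i p = (case p of (k, j) \<Rightarrow> if k = 0 then (\<lambda>z. fst (F i j z)) else (\<lambda>z. fst (G (\<not> i) j z)))"
    for i and p :: "nat \<times> 'j"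
  define h where "h i p = (case p of (k, j) \<Rightarrow> if k = 0 then (\<lambda>z. \<eta> * (2 * snd (F i j z) - 1))
      else if k = 1 then (\<lambda>z. \<eta> * (2 * snd (G (\<not> i) j z) - 1) - (u i z - c (\<not> i) j)) else (\<lambda>z. 0))"
    for i and p :: "nat \<times> 'j"
  have I: "finite (I i)" for i unfolding I_def using J by simp
  have Icases: "(\<exists>j\<in>J i. p = (0, j)) \<or> (\<exists>j\<in>J (\<not> i). p = (1, j)) \<or> (\<exists>j\<in>J (\<not> i). p = (2, j))" if "p \<in> I i" for i p
    using that unfolding I_def by auto
  have T': "compact (T (\<not> i) j)" "T (\<not> i) j \<subseteq> unit_square" if "j \<in> J (\<not> i)" for i j
    using T[OF that] by blast+
  have B: "compact (B i p)" "B i p \<subseteq> unit_square" if p: "p \<in> I i" for i p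
  proof -
    have Z: "compact {z \<in> unit_square. \<eta> \<le> \<bar>u i z - x\<bar> \<and> \<bar>u i z - x\<bar> \<le> 4 * \<eta>}" for x
    proof -
      have "{z \<in> unit_square. \<eta> \<le> \<bar>u i z - x\<bar> \<and> \<bar>u i z - x\<bar> \<le> 4 * \<eta>} =
          unit_square \<inter> (\<lambda>z. \<bar>u i z - x\<bar>) -` {\<eta>..4 * \<eta>}" by auto
      moreover have "continuous_on unit_square (\<lambda>z. \<bar>u i z - x\<bar>)" by (intro continuous_intros u)
      ultimately show ?thesis
        using continuous_closedin_preimage[of unit_square _ "{\<eta>..4 * \<eta>}"] closedin_compact[OF compact_unit_square]
        by simp
    qed
    have "compact (B i p) \<and> B i p \<subseteq> unit_square"
      using Icases[OF p]
    proof (elim disjE bexE)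
      fix j assume j: "j \<in> J i" "p = (0, j)"
      show ?thesis unfolding j(2) B_def using K(1,2)[OF j(1)] by (simp del: subset_iff)
    next
      fix j assume j: "j \<in> J (\<not> i)" "p = (1, j)"
      show ?thesis unfolding j(2) B_def using T'[OF j(1)] by simp
    next
      fix j assume j: "j \<in> J (\<not> i)" "p = (2, j)"
      have eq: "B i (2, j) = {z \<in> unit_square. \<eta> \<le> \<bar>u i z - c (\<not> i) j\<bar> \<and> \<bar>u i z - c (\<not> i) j\<bar> \<le> 4 * \<eta>}"
        unfolding B_def by simp
      show ?thesis unfolding j(2) eq by (rule conjI[OF Z]) blast
    qed
    then show "compact (B i p)" "B i p \<subseteq> unit_square" by blast+
  qed
  have Bu: "\<exists>i' j. j \<in> J i' \<and> p = (k, j) \<and> (k = 0 \<longleftrightarrow> i' = i) \<and> \<bar>u i z - c i' j\<bar> \<le> 4 * \<eta>"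
    if p: "p \<in> I i" "z \<in> B i p" "fst p = k" for i p z k
    using Icases[OF p(1)]
  proof (elim disjE bexE)
    fix j assume j: "j \<in> J i" "p = (0, j)"
    then have "u i z = c i j" using K(3) p(2) unfolding B_def by simp
    then show ?thesis using j p(3) \<eta> by (intro exI[of _ i] exI[of _ j]) simp
  next
    fix j assume j: "j \<in> J (\<not> i)" "p = (1, j)"
    then have "\<bar>u i z - c (\<not> i) j\<bar> \<le> \<eta>" using Tu[of z "\<not> i" j] p(2) unfolding B_def by simp
    then show ?thesis using j p(3) \<eta> by (intro exI[of _ "\<not> i"] exI[of _ j]) auto
  next
    fix j assume j: "j \<in> J (\<not> i)" "p = (2, j)"
    then have "\<bar>u i z - c (\<not> i) j\<bar> \<le> 4 * \<eta>" using p(2) unfolding B_def by simp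
    then show ?thesis using j p(3) \<eta> by (intro exI[of _ "\<not> i"] exI[of _ j]) auto
  qed
  have overlap: "snd p = snd p' \<and> (fst p = 0 \<longleftrightarrow> fst p' = 0)"
    if p: "p \<in> I i" "p' \<in> I i" "z \<in> B i p" "z \<in> B i p'" for i p p' z
  proof -
    obtain i1 j1 where 1: "j1 \<in> J i1" "p = (fst p, j1)" "fst p = 0 \<longleftrightarrow> i1 = i" "\<bar>u i z - c i1 j1\<bar> \<le> 4 * \<eta>"
      using Bu[OF p(1,3) refl] by (elim exE conjE) (rule that)
    obtain i2 j2 where 2: "j2 \<in> J i2" "p' = (fst p', j2)" "fst p' = 0 \<longleftrightarrow> i2 = i" "\<bar>u i z - c i2 j2\<bar> \<le> 4 * \<eta>"
      using Bu[OF p(2,4) refl] by (elim exE conjE) (rule that)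
    have "(i1, j1) = (i2, j2)"
    proof (rule ccontr)
      assume "(i1, j1) \<noteq> (i2, j2)"
      then have "10 * \<eta> < \<bar>c i1 j1 - c i2 j2\<bar>" by (rule gap[OF 1(1) 2(1)])
      then show False using 1(4) 2(4) \<eta> by linarith
    qed
    then show ?thesis using 1(2,3) 2(2,3) by (metis prod.inject snd_conv)
  qed
  have G': "continuous_on (T (\<not> i) j) (G (\<not> i) j)" "\<And>z. z \<in> T (\<not> i) j \<Longrightarrow> G (\<not> i) j z \<in> X \<times> {0..1}"
      "\<And>z. z \<in> T (\<not> i) j \<Longrightarrow> dist (a i z) (fst (G (\<not> i) j z)) < \<delta>"
      "\<And>z. z \<in> T (\<not> i) j \<Longrightarrow> \<bar>u i z - c (\<not> i) j\<bar> = \<eta> \<Longrightarrow> \<eta> * (2 * snd (G (\<not> i) j z) - 1) = u i z - c (\<not> i) j"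
    if "j \<in> J (\<not> i)" for i j
    using G[OF that] by simp_all
  have he: "h i (1, j) z = 0" if "j \<in> J (\<not> i)" "z \<in> B i (1, j)" "z \<in> B i (2, j)" for i j z
  proof -
    have z: "z \<in> T (\<not> i) j" "\<eta> \<le> \<bar>u i z - c (\<not> i) j\<bar>" using that unfolding B_def by auto
    then have "\<bar>u i z - c (\<not> i) j\<bar> = \<eta>" using Tu[of z "\<not> i" j] by simp
    then show ?thesis using G'(4)[OF that(1) z(1)] unfolding h_def by simp
  qed
  have ch: "continuous_on (B i p) (h i p)" if p: "p \<in> I i" for i p
    using Icases[OF p]
  proof (elim disjE bexE)
    fix j assume j: "j \<in> J i" "p = (0, j)"
    show ?thesis unfolding j(2) B_def h_def
      by (simp, intro continuous_intros continuous_on_subset[OF F(1)[OF j(1)] K(2)[OF j(1)]])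
  next
    fix j assume j: "j \<in> J (\<not> i)" "p = (1, j)"
    show ?thesis unfolding j(2) B_def h_def
      by (simp, intro continuous_intros G'(1)[OF j(1)] continuous_on_subset[OF u T'(2)[OF j(1)]])
  next
    fix j assume j: "j \<in> J (\<not> i)" "p = (2, j)"
    show ?thesis unfolding j(2) h_def by simp
  qed
  have agree: "h i p z = h i p' z" if p: "p \<in> I i" "p' \<in> I i" "z \<in> B i p" "z \<in> B i p'" for i p p' z
  proof (cases "p = p'")
    case False
    then have "fst p \<noteq> 0" "fst p' \<noteq> 0" "snd p = snd p'" "fst p \<noteq> fst p'"
      using overlap[OF p] Icases[OF p(1)] Icases[OF p(2)] by (auto simp: prod_eq_iff)
    then obtain j where "j \<in> J (\<not> i)" "p = (1, j) \<and> p' = (2, j) \<or> p = (2, j) \<and> p' = (1, j)"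
      using Icases[OF p(1)] Icases[OF p(2)] by auto
    moreover have "h i (2, j) z = 0" for j unfolding h_def by simp
    ultimately show ?thesis using he p(3,4) by metis
  qed simp
  have hb: "norm (h i p z) \<le> 2 * \<eta>" if p: "p \<in> I i" "z \<in> B i p" for i p z
  proof -
    have s: "\<bar>\<eta> * (2 * x - 1)\<bar> \<le> \<eta>" if "x \<in> {0..1}" for x
    proof -
      have "\<bar>\<eta> * (2 * x - 1)\<bar> = \<eta> * \<bar>2 * x - 1\<bar>" using \<eta> by (simp add: abs_mult)
      also have "\<dots> \<le> \<eta> * 1" using that \<eta> by (intro mult_left_mono) auto
      finally show ?thesis by simp
    qed
    show ?thesis
      using Icases[OF p(1)]
    proof (elim disjE bexE)
      fix j assume j: "j \<in> J i" "p = (0, j)"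
      then have "z \<in> unit_square" using p(2) K(2)[OF j(1)] unfolding B_def by auto
      then have "snd (F i j z) \<in> {0..1}" using F(2)[OF j(1)] by (simp add: mem_Times_iff)
      then show ?thesis using s[of "snd (F i j z)"] \<eta> unfolding h_def j(2) by simp
    next
      fix j assume j: "j \<in> J (\<not> i)" "p = (1, j)"
      then have z: "z \<in> T (\<not> i) j" using p(2) unfolding B_def by simp
      then have "snd (G (\<not> i) j z) \<in> {0..1}" using G'(2)[OF j(1) z] by (simp add: mem_Times_iff)
      then show ?thesis using s[of "snd (G (\<not> i) j z)"] Tu[OF z] unfolding h_def j(2) by simp
    next
      fix j assume j: "j \<in> J (\<not> i)" "p = (2, j)"
      then show ?thesis using \<eta> unfolding h_def by simp
    qed
  qed
  have "\<exists>e. continuous_on unit_square e \<and> (\<forall>p\<in>I i. \<forall>z\<in>B i p. e z = h i p z) \<and>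
      (\<forall>z\<in>unit_square. \<bar>e z\<bar> \<le> 2 * \<eta>)" for i
  proof -
    obtain g where g: "continuous_on (\<Union>p\<in>I i. B i p) g" "\<And>p z. p \<in> I i \<Longrightarrow> z \<in> B i p \<Longrightarrow> g z = h i p z"
    proof (rule finite_closed_pasting[where I = "I i" and B = "B i" and f = "h i", OF I])
      show "closed (B i p)" if "p \<in> I i" for p by (rule compact_imp_closed[OF B(1)[OF that]])
    qed (assumption | rule ch agree that)+
    have "compact (\<Union>p\<in>I i. B i p)" using I B(1) by (intro compact_UN) auto
    then have cl: "closedin (top_of_set unit_square) (\<Union>p\<in>I i. B i p)"
      using B(2) by (intro closed_subset compact_imp_closed) blast+
    have nb: "norm (g z) \<le> 2 * \<eta>" if "z \<in> (\<Union>p\<in>I i. B i p)" for z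
      using that g(2) hb by (metis UN_E)
    obtain e where e: "continuous_on unit_square e" "\<And>z. z \<in> (\<Union>p\<in>I i. B i p) \<Longrightarrow> e z = g z"
      "\<And>z. z \<in> unit_square \<Longrightarrow> norm (e z) \<le> 2 * \<eta>"
      by (rule Tietze[OF g(1) cl _ nb]) (use \<eta> in simp, assumption, rule that)
    show ?thesis
    proof (rule exI[of _ e], intro conjI ballI e(1))
      show "e z = h i p z" if "p \<in> I i" "z \<in> B i p" for p z using e(2)[of z] g(2)[OF that] that by auto
      show "\<bar>e z\<bar> \<le> 2 * \<eta>" if "z \<in> unit_square" for z using e(3)[OF that] by simp
    qed
  qed
  then have "\<exists>e. \<forall>i. continuous_on unit_square (e i) \<and> (\<forall>p\<in>I i. \<forall>z\<in>B i p. e i z = h i p z) \<and>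
      (\<forall>z\<in>unit_square. \<bar>e i z\<bar> \<le> 2 * \<eta>)"
    by (intro choice allI)
  then obtain e where e': "\<forall>i. continuous_on unit_square (e i) \<and> (\<forall>p\<in>I i. \<forall>z\<in>B i p. e i z = h i p z) \<and>
      (\<forall>z\<in>unit_square. \<bar>e i z\<bar> \<le> 2 * \<eta>)" ..
  note e = conjunct1[OF spec[OF e']] conjunct1[OF conjunct2[OF spec[OF e']]] conjunct2[OF conjunct2[OF spec[OF e']]]
  \<comment> \<open>the component in \<open>X\<close> is prescribed on cells and strips only\<close>
  define I' where "I' i = {0::nat} \<times> J i \<union> {1} \<times> J (\<not> i)" for i
  have I'I: "I' i \<subseteq> I i" "finite (I' i)" for i unfolding I'_def I_def using J by auto
  have I'cases: "(\<exists>j\<in>J i. p = (0, j)) \<or> (\<exists>j\<in>J (\<not> i). p = (1, j))" if "p \<in> I' i" for i p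
    using that unfolding I'_def by auto
  have W: "continuous_on (B i p) (W i p)" "\<And>z. z \<in> B i p \<Longrightarrow> W i p z \<in> X"
     "\<And>z. z \<in> B i p \<Longrightarrow> dist (a i z) (W i p z) < \<delta>" if p: "p \<in> I' i" for i p
  proof -
    have "continuous_on (B i p) (W i p) \<and> (\<forall>z\<in>B i p. W i p z \<in> X \<and> dist (a i z) (W i p z) < \<delta>)"
      using I'cases[OF p]
    proof (elim disjE bexE)
      fix j assume j: "j \<in> J i" "p = (0, j)"
      have BK: "B i p = K i j" "W i p = (\<lambda>z. fst (F i j z))" unfolding B_def W_def j(2) by simp_all
      show ?thesis unfolding BK
      proof (intro conjI ballI)
        show "continuous_on (K i j) (\<lambda>z. fst (F i j z))"
          by (intro continuous_intros continuous_on_subset[OF F(1)[OF j(1)] K(2)[OF j(1)]])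
        fix z assume "z \<in> K i j"
        then have "z \<in> unit_square" using K(2)[OF j(1)] by blast
        then show "fst (F i j z) \<in> X" "dist (a i z) (fst (F i j z)) < \<delta>"
          using F(2,3)[OF j(1), of z] by (simp_all add: mem_Times_iff)
      qed
    next
      fix j assume j: "j \<in> J (\<not> i)" "p = (1, j)"
      have BK: "B i p = T (\<not> i) j" "W i p = (\<lambda>z. fst (G (\<not> i) j z))" unfolding B_def W_def j(2) by simp_all
      show ?thesis unfolding BK
      proof (intro conjI ballI)
        show "continuous_on (T (\<not> i) j) (\<lambda>z. fst (G (\<not> i) j z))"
          by (intro continuous_intros G'(1)[OF j(1)])
        fix z assume "z \<in> T (\<not> i) j"
        then show "fst (G (\<not> i) j z) \<in> X" "dist (a i z) (fst (G (\<not> i) j z)) < \<delta>"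
          using G'(2,3)[OF j(1), of z] by (simp_all add: mem_Times_iff)
      qed
    qed
    then show "continuous_on (B i p) (W i p)" "\<And>z. z \<in> B i p \<Longrightarrow> W i p z \<in> X"
     "\<And>z. z \<in> B i p \<Longrightarrow> dist (a i z) (W i p z) < \<delta>" by blast+
  qed
  have agreeW: "W i p z = W i p' z" if p: "p \<in> I' i" "p' \<in> I' i" "z \<in> B i p" "z \<in> B i p'" for i p p' z
  proof -
    have "p = p'" using overlap[OF subsetD[OF I'I(1) p(1)] subsetD[OF I'I(1) p(2)] p(3,4)]
      I'cases[OF p(1)] I'cases[OF p(2)] by auto
    then show ?thesis by simp
  qed
  have "\<exists>g. continuous_on (\<Union>p\<in>I' i. B i p) g \<and> (\<forall>p\<in>I' i. \<forall>z\<in>B i p. g z = W i p z)" for i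
  proof -
    obtain g where "continuous_on (\<Union>p\<in>I' i. B i p) g" "\<And>p z. p \<in> I' i \<Longrightarrow> z \<in> B i p \<Longrightarrow> g z = W i p z"
    proof (rule finite_closed_pasting[where I = "I' i" and B = "B i" and f = "W i", OF I'I(2)])
      show "closed (B i p)" if "p \<in> I' i" for p
        by (rule compact_imp_closed[OF B(1)[OF subsetD[OF I'I(1) that]]])
    qed (assumption | rule W(1) agreeW that)+
    then show ?thesis by blast
  qed
  then have "\<exists>g. \<forall>i. continuous_on (\<Union>p\<in>I' i. B i p) (g i) \<and> (\<forall>p\<in>I' i. \<forall>z\<in>B i p. g i z = W i p z)"
    by (intro choice allI)
  then obtain g where g': "\<forall>i. continuous_on (\<Union>p\<in>I' i. B i p) (g i) \<and> (\<forall>p\<in>I' i. \<forall>z\<in>B i p. g i z = W i p z)" ..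
  note g = conjunct1[OF spec[OF g']] conjunct2[OF spec[OF g']]
  have "\<exists>b. disk_pair X b \<and> close_pairs \<epsilon> a b \<and> (\<forall>i. \<forall>z\<in>(\<Union>p\<in>I' i. B i p). b i z = g i z)"
  proof (rule \<delta>(2)[THEN spec, THEN spec, THEN mp], intro allI conjI)
    fix i
    show "compact (\<Union>p\<in>I' i. B i p)"
      by (rule compact_UN[OF I'I(2) B(1)[OF subsetD[OF I'I(1)]]])
    show "(\<Union>p\<in>I' i. B i p) \<subseteq> unit_square" by (rule UN_least, rule B(2)[OF subsetD[OF I'I(1)]])
    show "continuous_on (\<Union>p\<in>I' i. B i p) (g i)" by (rule g(1))
    show "g i ` (\<Union>p\<in>I' i. B i p) \<subseteq> X"
    proof (rule image_subsetI, elim UN_E)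
      fix z p assume "p \<in> I' i" "z \<in> B i p"
      then show "g i z \<in> X" using g(2)[of i] W(2) by simp
    qed
    show "\<forall>z\<in>(\<Union>p\<in>I' i. B i p). dist (a i z) (g i z) < \<delta>"
    proof (intro ballI, elim UN_E)
      fix z p assume "p \<in> I' i" "z \<in> B i p"
      then show "dist (a i z) (g i z) < \<delta>" using g(2)[of i] W(3) by simp
    qed
  qed
  then obtain b where b: "disk_pair X b" "close_pairs \<epsilon> a b" "\<forall>i. \<forall>z\<in>(\<Union>p\<in>I' i. B i p). b i z = g i z"
    by (elim exE conjE) (rule that)
  have bW: "b i z = W i p z" if "p \<in> I' i" "z \<in> B i p" for i p z
    using bspec[OF spec[OF b(3), of i] UN_I[where B = "B i", OF that]] bspec[OF bspec[OF g(2) that(1)] that(2)] by simp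
  define v where "v i z = u i z + e i z" for i z
  have vu: "\<bar>v i z - u i z\<bar> \<le> 2 * \<eta>" if "z \<in> unit_square" for i z
    using bspec[OF e(3)[of i] that] unfolding v_def by simp
  have bF: "b i z = fst (F i j z)" "v i z = c i j + \<eta> * (2 * snd (F i j z) - 1)"
    if j: "j \<in> J i" and z: "z \<in> K i j" for i j z
  proof -
    have "(0, j) \<in> I' i" "(0, j) \<in> I i" "z \<in> B i (0, j)" using j z unfolding I'_def I_def B_def by auto
    then have "b i z = W i (0, j) z" "e i z = h i (0, j) z"
      using bW e(2)[of i] by blast+
    then show "b i z = fst (F i j z)" "v i z = c i j + \<eta> * (2 * snd (F i j z) - 1)"
      using K(3)[OF j z] unfolding W_def v_def h_def by simp_all
  qed
  have bG: "b (\<not> i) z = fst (G i j z)" "v (\<not> i) z = c i j + \<eta> * (2 * snd (G i j z) - 1)"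
    if j: "j \<in> J i" and z: "z \<in> T i j" for i j z
  proof -
    have p: "(1, j) \<in> I' (\<not> i)" "(1, j) \<in> I (\<not> i)" "z \<in> B (\<not> i) (1, j)"
      using j z unfolding I'_def I_def B_def by auto
    show "b (\<not> i) z = fst (G i j z)" using bW[OF p(1,3)] unfolding W_def by simp
    have "e (\<not> i) z = h (\<not> i) (1, j) z" using e(2)[of "\<not> i"] p(2,3) by blast
    then show "v (\<not> i) z = c i j + \<eta> * (2 * snd (G i j z) - 1)" unfolding v_def h_def by simp
  qed
  have key: False if j: "j \<in> J i" and z: "z \<in> K i j" "z' \<in> unit_square" and d: "dist (a i z) (a (\<not> i) z') < 2 * \<epsilon>"
    and eq: "b i z = b (\<not> i) z'" "v i z = v (\<not> i) z'" for i j z z'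
  proof -
    have zQ: "z \<in> unit_square" using z(1) K(2)[OF j] by blast
    have s: "snd (F i j z) \<in> {0..1}" using F(2)[OF j zQ] by (simp add: mem_Times_iff)
    have "\<bar>v i z - c i j\<bar> = \<eta> * \<bar>2 * snd (F i j z) - 1\<bar>" using bF(2)[OF j z(1)] \<eta> by (simp add: abs_mult)
    also have "\<dots> \<le> \<eta> * 1" using s \<eta> by (intro mult_left_mono) auto
    finally have 1: "\<bar>v (\<not> i) z' - c i j\<bar> \<le> \<eta>" using eq(2) by simp
    \<comment> \<open>the height of \<open>z'\<close> changed by at most \<open>2 * \<eta>\<close>, so \<open>z'\<close> is in the strip or in its collar;
      the collar kept its height\<close>
    have 2: "\<bar>u (\<not> i) z' - c i j\<bar> \<le> \<eta>"
    proof (rule ccontr)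
      assume n: "\<not> ?thesis"
      moreover have "\<bar>u (\<not> i) z' - c i j\<bar> \<le> 4 * \<eta>" using vu[OF z(2), of "\<not> i"] 1 \<eta> by linarith
      ultimately have "(2, j) \<in> I (\<not> i)" "z' \<in> B (\<not> i) (2, j)" using j z(2) unfolding I_def B_def by auto
      then have "e (\<not> i) z' = h (\<not> i) (2, j) z'" using e(2)[of "\<not> i"] by blast
      then have "v (\<not> i) z' = u (\<not> i) z'" unfolding v_def h_def by simp
      then show False using 1 n by simp
    qed
    have zT: "z' \<in> T i j" using capture[OF j z 2 d] 2 unfolding T_def by blast
    have "fst (F i j z) = fst (G i j z')" using bF(1)[OF j z(1)] bG(1)[OF j zT] eq(1) by simp
    moreover have "snd (F i j z) = snd (G i j z')" using bF(2)[OF j z(1)] bG(2)[OF j zT] eq(2) \<eta> by simp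
    ultimately show False using F(4)[OF j zQ zT] by (simp add: prod_eq_iff)
  qed
  have "v True z \<noteq> v False z'" if z: "z \<in> unit_square" "z' \<in> unit_square" "b True z = b False z'" for z z'
  proof
    assume v: "v True z = v False z'"
    have bd: "dist (a i z) (b i z) < \<epsilon>" if "z \<in> unit_square" for i z
      using b(2) that unfolding close_pairs_def by blast
    have d: "dist (a True z) (a False z') < 2 * \<epsilon>"
      using bd[OF z(1), of True] bd[OF z(2), of False] z(3)
        dist_triangle2[of "a True z" "a False z'" "b True z"] by simp
    then have "z \<in> (\<Union>j\<in>J True. K True j) \<or> z' \<in> (\<Union>j\<in>J False. K False j)" using walls[OF z(1,2)] by linarith
    then show False
    proof (elim disjE UN_E)
      fix j assume "j \<in> J True" "z \<in> K True j"
      from key[OF this z(2)] show False using d z(3) v by simp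
    next
      fix j assume "j \<in> J False" "z' \<in> K False j"
      from key[OF this z(1)] show False using d z(3) v by (simp add: dist_commute)
    qed
  qed
  moreover have "continuous_on unit_square (v i)" for i
    unfolding v_def by (intro continuous_intros u e(1))
  ultimately show ?thesis
    using b(1,2) vu by (intro exI[of _ b] exI[of _ v] conjI allI ballI impI)
qed

section \<open>Heights whose integer levels are arcs\<close>

text \<open>The largest \<open>L\<close>-Lipschitz function below \<open>h\<close> is close to \<open>h\<close> for large \<open>L\<close>, by uniform
  continuity.\<close>

lemma Lipschitz_approximation:
  fixes h :: "real \<times> real \<Rightarrow> real"
  assumes h: "continuous_on unit_square h" and e: "0 < e"
  obtains L g where "0 < L" "\<And>z z'. \<bar>g z - g z'\<bar> \<le> L * dist z z'"
    "\<And>z. z \<in> unit_square \<Longrightarrow> \<bar>g z - h z\<bar> \<le> e"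
proof -
  have "compact (h ` unit_square)" by (rule compact_continuous_image[OF h compact_unit_square])
  then have "bounded (h ` unit_square)" by (rule compact_imp_bounded)
  then obtain B where B: "0 < B" "\<And>z. z \<in> unit_square \<Longrightarrow> \<bar>h z\<bar> \<le> B"
    unfolding bounded_pos by auto
  have "uniformly_continuous_on unit_square h"
    by (rule compact_uniformly_continuous[OF h compact_unit_square])
  then obtain d where d: "0 < d" "\<And>z z'. z \<in> unit_square \<Longrightarrow> z' \<in> unit_square \<Longrightarrow> dist z' z < d \<Longrightarrow> dist (h z') (h z) < e"
    unfolding uniformly_continuous_on_def using e by metis
  define L where "L = 2 * B / d"
  have L: "0 < L" using B(1) d(1) unfolding L_def by simp
  define g where "g z = (INF w\<in>unit_square. h w + L * dist z w)" for z
  have ne: "unit_square \<noteq> {}" by auto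
  have lb: "- B \<le> h w + L * dist z w" if "w \<in> unit_square" for z w
  proof -
    have "0 \<le> L * dist z w" using L by simp
    then show ?thesis using B(2)[OF that] by linarith
  qed
  have bdd: "bdd_below ((\<lambda>w. h w + L * dist z w) ` unit_square)" for z
    by (rule bdd_belowI2[of _ "- B"]) (rule lb)
  have one: "g z \<le> g z' + L * dist z z'" for z z'
  proof -
    have "g z - L * dist z z' \<le> g z'"
      unfolding g_def[of z']
    proof (rule cINF_greatest[OF ne])
      fix w assume w: "w \<in> unit_square"
      have "g z \<le> h w + L * dist z w" unfolding g_def by (rule cINF_lower[OF bdd w])
      also have "\<dots> \<le> h w + L * (dist z z' + dist z' w)"
        using L dist_triangle[of z w z'] by (intro add_left_mono mult_left_mono) auto
      finally show "g z - L * dist z z' \<le> h w + L * dist z' w" by (simp add: algebra_simps)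
    qed
    then show ?thesis by simp
  qed
  show ?thesis
  proof (rule that[OF L])
    show "\<bar>g z - g z'\<bar> \<le> L * dist z z'" for z z'
      using one[of z z'] one[of z' z] by (simp add: dist_commute abs_le_iff)
    fix z assume z: "z \<in> unit_square"
    have "g z \<le> h z + L * dist z z" unfolding g_def by (rule cINF_lower[OF bdd z])
    moreover have "h z - e \<le> g z"
      unfolding g_def
    proof (rule cINF_greatest[OF ne])
      fix w assume w: "w \<in> unit_square"
      show "h z - e \<le> h w + L * dist z w"
      proof (cases "dist z w < d")
        case True
        then have "\<bar>h w - h z\<bar> < e" using d(2)[OF z w] by (simp add: dist_real_def dist_commute)
        moreover have "0 \<le> L * dist z w" using L by simp
        ultimately show ?thesis by linarith
      next
        case False
        then have "L * d \<le> L * dist z w" using L by (intro mult_left_mono) auto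
        then have "2 * B \<le> L * dist z w" using d(1) unfolding L_def by simp
        then show ?thesis using B(2)[OF z] B(2)[OF w] e by linarith
      qed
    qed
    ultimately show "\<bar>g z - h z\<bar> \<le> e" using e by simp
  qed
qed

lemma arcsin_sin_shift:
  fixes \<theta> :: real and n :: int
  assumes "\<bar>\<theta> - n * pi\<bar> \<le> pi / 2"
  shows "arcsin (sin \<theta>) = cos (pi * n) * (\<theta> - n * pi)"
proof -
  let ?x = "\<theta> - n * pi"
  have "sin \<theta> = sin (?x + pi * n)" by (simp add: algebra_simps)
  also have "\<dots> = sin ?x * cos (pi * n)" unfolding sin_add by simp
  finally have s: "sin \<theta> = sin ?x * cos (pi * n)" .
  have x: "- (pi / 2) \<le> ?x" "?x \<le> pi / 2" using assms by linarith+
  show ?thesis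
  proof (cases "even n")
    case True
    then have "cos (pi * n) = 1" by simp
    then show ?thesis using s arcsin_sin[OF x] by simp
  next
    case False
    then have c: "cos (pi * n) = -1" by simp
    have "sin \<theta> = sin (- ?x)" using s c by (metis mult_minus1_right sin_minus)
    then have "arcsin (sin \<theta>) = arcsin (sin (- ?x))" by simp
    also have "\<dots> = - ?x" using x by (intro arcsin_sin) auto
    finally show ?thesis using c by simp
  qed
qed

text \<open>A small function of slope \<open>\<plusminus>L\<close> off a discrete set \<open>N\<close> of corners. As it beats any Lipschitz
  function of smaller constant, adding it makes that function injective between corners. The
  interval \<open>[-1, 2]\<close> leaves room around the unit interval.\<close>

lemma zigzag:
  fixes L e :: real
  assumes L: "0 < L" and e: "0 < e"
  obtains zig :: "real \<Rightarrow> real" and N where "continuous_on UNIV zig" "\<And>x. \<bar>zig x\<bar> \<le> e"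
    "finite (N \<inter> {-1..2})"
    "\<And>x0 \<rho> x x'. \<forall>n\<in>N. \<rho> < \<bar>x0 - n\<bar> \<Longrightarrow> \<bar>x - x0\<bar> \<le> \<rho> \<Longrightarrow> \<bar>x' - x0\<bar> \<le> \<rho> \<Longrightarrow>
       \<bar>zig x - zig x'\<bar> = L * \<bar>x - x'\<bar>"
proof -
  define w where "w = 2 * L / e"
  have w: "0 < w" using L e unfolding w_def by simp
  \<comment> \<open>the triangle wave \<open>arcsin \<circ> sin\<close> has slope \<open>\<plusminus>1\<close>; its corners are the odd multiples of
    \<open>pi / 2\<close>\<close>
  define zig where "zig x = e / 2 * arcsin (sin (w * x))" for x
  define N where "N = range (\<lambda>k::int. (k + 1/2) * pi / w)"
  have "\<bar>zig x\<bar> \<le> e" for x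
  proof -
    have "\<bar>arcsin (sin (w * x))\<bar> \<le> pi / 2" using arcsin_bounded[of "sin (w * x)"] by (auto simp: abs_le_iff)
    also have "\<dots> \<le> 2" using pi_less_4 by simp
    finally have "e / 2 * \<bar>arcsin (sin (w * x))\<bar> \<le> e / 2 * 2" using e by (intro mult_left_mono) auto
    then show ?thesis unfolding zig_def using e by (simp add: abs_mult)
  qed
  moreover have "continuous_on UNIV zig"
    unfolding zig_def by (intro continuous_intros) auto
  moreover have "finite (N \<inter> {-1..2})"
  proof -
    define m where "m = \<lceil>2 * w / pi\<rceil> + 1"
    have "N \<inter> {-1..2} \<subseteq> (\<lambda>k::int. (k + 1/2) * pi / w) ` {-m..m}"
    proof
      fix x assume "x \<in> N \<inter> {-1..2}"
      then obtain k :: int where k: "x = (k + 1/2) * pi / w" "-1 \<le> x" "x \<le> 2" unfolding N_def by auto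
      have "x * w / pi = k + 1/2" using k(1) w by simp
      moreover have "x * w / pi \<le> 2 * w / pi" "- (2 * w / pi) \<le> x * w / pi"
      proof -
        have "x * w \<le> 2 * w" "- (2 * w) \<le> x * w"
          using k(2,3) w mult_right_mono[of x 2 w] mult_right_mono[of "-2" x w] by auto
        then show "x * w / pi \<le> 2 * w / pi" "- (2 * w / pi) \<le> x * w / pi"
          by (auto simp: divide_right_mono minus_divide_left simp del: minus_divide_left[symmetric])
      qed
      ultimately have "k \<le> m" "- m \<le> k" unfolding m_def by linarith+
      then show "x \<in> (\<lambda>k::int. (k + 1/2) * pi / w) ` {-m..m}" using k(1) by auto
    qed
    then show ?thesis by (rule finite_subset) simp
  qed
  moreover have "\<bar>zig x - zig x'\<bar> = L * \<bar>x - x'\<bar>"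
    if n: "\<forall>n\<in>N. \<rho> < \<bar>x0 - n\<bar>" and x: "\<bar>x - x0\<bar> \<le> \<rho>" "\<bar>x' - x0\<bar> \<le> \<rho>" for x0 \<rho> x x'
  proof -
    define k where "k = \<lfloor>w * x0 / pi + 1/2\<rfloor>"
    have "k \<le> w * x0 / pi + 1/2" "w * x0 / pi + 1/2 < k + 1" unfolding k_def by linarith+
    then have "(k - 1/2) * pi \<le> w * x0" "w * x0 \<le> (k + 1/2) * pi" by (auto simp: field_simps)
    then have lo: "(k - 1/2) * pi / w \<le> x0" and hi: "x0 \<le> (k + 1/2) * pi / w" using w by (auto simp: field_simps)
    have "(of_int (k - 1) + 1/2) * pi / w \<in> N" "(k + 1/2) * pi / w \<in> N" unfolding N_def by blast+
    then have "\<rho> < \<bar>x0 - (k - 1/2) * pi / w\<bar>" "\<rho> < \<bar>x0 - (k + 1/2) * pi / w\<bar>" using n by fastforce+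
    then have b: "(k - 1/2) * pi / w + \<rho> < x0" "x0 < (k + 1/2) * pi / w - \<rho>" using lo hi by linarith+
    have *: "arcsin (sin (w * y)) = cos (pi * k) * (w * y - k * pi)" if "\<bar>y - x0\<bar> \<le> \<rho>" for y
    proof (rule arcsin_sin_shift)
      have "(k - 1/2) * pi / w < y" "y < (k + 1/2) * pi / w" using b that by linarith+
      then have "(k - 1/2) * pi < w * y" "w * y < (k + 1/2) * pi" using w by (auto simp: field_simps)
      then show "\<bar>w * y - k * pi\<bar> \<le> pi / 2" by (intro abs_leI) (simp_all add: algebra_simps)
    qed
    define C where "C = cos (pi * k)"
    have C: "\<bar>C\<bar> = 1" unfolding C_def by simp
    have "zig x - zig x' = e / 2 * (C * (w * (x - x')))"
      unfolding zig_def *[OF x(1)] *[OF x(2)] C_def[symmetric] by (simp add: algebra_simps)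
    then have "\<bar>zig x - zig x'\<bar> = \<bar>e / 2\<bar> * (\<bar>C\<bar> * (\<bar>w\<bar> * \<bar>x - x'\<bar>))" by (simp only: abs_mult)
    also have "\<dots> = e / 2 * (w * \<bar>x - x'\<bar>)" using e w C by simp
    also have "\<dots> = L * \<bar>x - x'\<bar>" unfolding w_def using e by simp
    finally show ?thesis .
  qed
  ultimately show ?thesis using that by blast
qed

text \<open>After adding zigzags in both variables to a Lipschitz approximation, the height is injective
  along horizontal lines where the first variable is between corners, and along vertical lines
  where the second one is. Both fail only near the finitely many points where both variables are
  corners, and a generic additive constant keeps the heights of these points off the integers.\<close>

lemma height_with_thin_levels:
  fixes h :: "real \<times> real \<Rightarrow> real"
  assumes h: "continuous_on unit_square h"
  obtains H \<rho> \<zeta> where "continuous_on UNIV H" "\<And>z. z \<in> unit_square \<Longrightarrow> \<bar>H z - h z\<bar> \<le> 1" "0 < \<rho>" "0 < \<zeta>"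
    "\<And>z0. z0 \<in> unit_square \<Longrightarrow> infdist (H z0) \<int> \<le> \<zeta> \<Longrightarrow>
       inj_on (\<lambda>z. (fst z, H z)) (cball z0 \<rho>) \<or> inj_on (\<lambda>z. (snd z, H z)) (cball z0 \<rho>)"
proof -
  obtain L g where g: "0 < L" "\<And>z z'. \<bar>g z - g z'\<bar> \<le> L * dist z z'"
    "\<And>z. z \<in> unit_square \<Longrightarrow> \<bar>g z - h z\<bar> \<le> 1/4"
    using Lipschitz_approximation[OF h, of "1/4"] by (metis zero_less_divide_1_iff zero_less_numeral)
  have L1: "0 < L + 1" using g(1) by simp
  have e8: "0 < (1/8 :: real)" by simp
  obtain zig :: "real \<Rightarrow> real" and N where zig: "continuous_on UNIV zig" "\<And>x. \<bar>zig x\<bar> \<le> 1/8"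
    "finite (N \<inter> {-1..2})"
    "\<And>x0 \<rho> x x'. \<forall>n\<in>N. \<rho> < \<bar>x0 - n\<bar> \<Longrightarrow> \<bar>x - x0\<bar> \<le> \<rho> \<Longrightarrow> \<bar>x' - x0\<bar> \<le> \<rho> \<Longrightarrow>
       \<bar>zig x - zig x'\<bar> = (L + 1) * \<bar>x - x'\<bar>"
    by (rule zigzag[OF L1 e8]) (rule that; assumption)
  define G where "G z = g z + zig (fst z) + zig (snd z)" for z
  define F where "F = (N \<inter> {-1..2}) \<times> (N \<inter> {-1..2})"
  have F: "finite F" unfolding F_def using zig(3) by simp
  \<comment> \<open>only countably many constants put one of the finitely many corner points on an integer level\<close>
  have cI: "countable (\<int> :: real set)" unfolding Ints_def by simp
  have "countable (\<Union>z\<in>F. (\<lambda>k. k - G z) ` \<int>)"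
    by (intro countable_UN countable_finite[OF F] countable_image cI)
  moreover have "uncountable {0<..<1/4 :: real}" by (simp add: uncountable_open_interval)
  ultimately have "\<not> {0<..<1/4} \<subseteq> (\<Union>z\<in>F. (\<lambda>k. k - G z) ` \<int>)" using countable_subset by blast
  then obtain c where c: "c \<in> {0<..<1/4}" "\<And>z. z \<in> F \<Longrightarrow> c \<notin> (\<lambda>k. k - G z) ` \<int>" by blast
  have c': "G z + c \<notin> \<int>" if "z \<in> F" for z
  proof
    assume "G z + c \<in> \<int>"
    then have "c \<in> (\<lambda>k. k - G z) ` \<int>" by (intro image_eqI[of _ _ "G z + c"]) simp_all
    then show False using c(2)[OF that] by blast
  qed
  define H where "H z = G z + c" for z
  have cg: "continuous_on UNIV g"
  proof (rule continuous_onI)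
    fix z :: "real \<times> real" and r :: real assume r: "0 < r"
    show "\<exists>d>0. \<forall>x'\<in>UNIV. dist x' z < d \<longrightarrow> dist (g x') (g z) \<le> r"
    proof (intro exI[of _ "r / L"] conjI ballI impI)
      show "0 < r / L" using r g(1) by simp
      fix x' assume "dist x' z < r / L"
      then have "L * dist x' z \<le> r" using g(1) by (simp add: field_simps)
      then show "dist (g x') (g z) \<le> r" using g(2)[of x' z] by (simp add: dist_real_def)
    qed
  qed
  have cH: "continuous_on UNIV H"
    unfolding H_def G_def
    by (intro continuous_intros cg continuous_on_compose2[OF zig(1)]) auto
  have close: "\<bar>H z - h z\<bar> \<le> 1" if "z \<in> unit_square" for z
  proof -
    have "0 < c" "c < 1/4" using c(1) by auto
    then show ?thesis
      using g(3)[OF that] zig(2)[of "fst z"] zig(2)[of "snd z"] unfolding H_def G_def by linarith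
  qed
  have ne: "(\<int> :: real set) \<noteq> {}" by auto
  \<comment> \<open>heights within \<open>\<zeta>\<close> of the integers occur only away from the corner points\<close>
  define \<zeta> where "\<zeta> = Min (insert 1 ((\<lambda>z. infdist (H z) \<int>) ` F)) / 2"
  have pos: "0 < infdist (H z) \<int>" if "z \<in> F" for z
  proof -
    have "H z \<notin> \<int>" using c'[OF that] unfolding H_def by simp
    then show ?thesis
      using in_closed_iff_infdist_zero[OF closed_Ints ne, of "H z"] infdist_nonneg[of "H z" \<int>] by linarith
  qed
  have \<zeta>: "0 < \<zeta>" "\<And>z. z \<in> F \<Longrightarrow> 2 * \<zeta> \<le> infdist (H z) \<int>"
  proof -
    have "0 < Min (insert 1 ((\<lambda>z. infdist (H z) \<int>) ` F))" using F pos by (simp add: Min_gr_iff)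
    then show "0 < \<zeta>" unfolding \<zeta>_def by simp
    show "2 * \<zeta> \<le> infdist (H z) \<int>" if "z \<in> F" for z unfolding \<zeta>_def using F that by simp
  qed
  let ?Q = "{-1..2} \<times> {-1..2 :: real}"
  have "uniformly_continuous_on ?Q H"
    by (rule compact_uniformly_continuous[OF continuous_on_subset[OF cH]]) (auto intro: compact_Times)
  then obtain d where d: "0 < d" "\<And>z z'. z \<in> ?Q \<Longrightarrow> z' \<in> ?Q \<Longrightarrow> dist z' z < d \<Longrightarrow> dist (H z') (H z) < \<zeta>"
    unfolding uniformly_continuous_on_def using \<zeta>(1) by metis
  define \<rho> where "\<rho> = min (d / 3) 1"
  have \<rho>: "0 < \<rho>" "\<rho> \<le> 1" "2 * \<rho> < d" using d(1) unfolding \<rho>_def by auto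
  have far: "(\<forall>n\<in>N. \<rho> < \<bar>fst z0 - n\<bar>) \<or> (\<forall>n\<in>N. \<rho> < \<bar>snd z0 - n\<bar>)"
    if z0: "z0 \<in> unit_square" "infdist (H z0) \<int> \<le> \<zeta>" for z0
  proof (rule ccontr)
    assume "\<not> ?thesis"
    then obtain n n' where n: "n \<in> N" "n' \<in> N" "\<bar>fst z0 - n\<bar> \<le> \<rho>" "\<bar>snd z0 - n'\<bar> \<le> \<rho>" by force
    have 0: "0 \<le> fst z0" "fst z0 \<le> 1" "0 \<le> snd z0" "snd z0 \<le> 1" using z0(1) by (auto simp: mem_Times_iff)
    then have "n \<in> {-1..2}" "n' \<in> {-1..2}" using n(3,4) \<rho>(2) by auto
    then have nF: "(n, n') \<in> F" and nQ: "(n, n') \<in> ?Q" using n(1,2) unfolding F_def by auto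
    have zQ: "z0 \<in> ?Q" using 0 by (auto simp: mem_Times_iff)
    have "dist z0 (n, n') \<le> \<bar>fst z0 - n\<bar> + \<bar>snd z0 - n'\<bar>"
      unfolding dist_prod_def dist_real_def by (simp add: sqrt_sum_squares_le_sum_abs)
    then have "dist (n, n') z0 < d" using n(3,4) \<rho>(3) by (simp add: dist_commute)
    then have "dist (H (n, n')) (H z0) < \<zeta>" by (rule d(2)[OF zQ nQ])
    moreover have "infdist (H (n, n')) \<int> \<le> infdist (H z0) \<int> + dist (H (n, n')) (H z0)" by (rule infdist_triangle)
    ultimately show False using \<zeta>(2)[OF nF] z0(2) by linarith
  qed
  have main: "inj_on (\<lambda>z. (fst z, H z)) (cball z0 \<rho>) \<or> inj_on (\<lambda>z. (snd z, H z)) (cball z0 \<rho>)"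
    if z0: "z0 \<in> unit_square" "infdist (H z0) \<int> \<le> \<zeta>" for z0
  proof -
    have bd: "\<bar>fst z - fst z0\<bar> \<le> \<rho>" "\<bar>snd z - snd z0\<bar> \<le> \<rho>" if "z \<in> cball z0 \<rho>" for z
      using that dist_fst_le[of z z0] dist_snd_le[of z z0] by (auto simp: dist_real_def dist_commute)
    show ?thesis
      using far[OF z0]
    proof
      assume n: "\<forall>n\<in>N. \<rho> < \<bar>fst z0 - n\<bar>"
      have "inj_on (\<lambda>z. (snd z, H z)) (cball z0 \<rho>)"
      proof (rule inj_onI)
        fix z z' assume z: "z \<in> cball z0 \<rho>" "z' \<in> cball z0 \<rho>" "(snd z, H z) = (snd z', H z')"
        have zz: "\<bar>zig (fst z) - zig (fst z')\<bar> = (L + 1) * \<bar>fst z - fst z'\<bar>"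
          using n bd(1)[OF z(1)] bd(1)[OF z(2)] by (intro zig(4)) auto
        have "dist z z' = \<bar>fst z - fst z'\<bar>" using z(3) by (simp add: dist_prod_def dist_real_def)
        then have "\<bar>g z - g z'\<bar> \<le> L * \<bar>fst z - fst z'\<bar>" using g(2)[of z z'] by simp
        moreover have "g z - g z' = - (zig (fst z) - zig (fst z'))"
        proof -
          have "snd z = snd z'" "H z = H z'" using z(3) by simp_all
          then show ?thesis unfolding H_def G_def by simp
        qed
        ultimately have "\<bar>fst z - fst z'\<bar> \<le> 0" using zz by (simp add: algebra_simps)
        then show "z = z'" using z(3) by (simp add: prod_eq_iff)
      qed
      then show ?thesis ..
    next
      assume n: "\<forall>n\<in>N. \<rho> < \<bar>snd z0 - n\<bar>"
      have "inj_on (\<lambda>z. (fst z, H z)) (cball z0 \<rho>)"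
      proof (rule inj_onI)
        fix z z' assume z: "z \<in> cball z0 \<rho>" "z' \<in> cball z0 \<rho>" "(fst z, H z) = (fst z', H z')"
        have zz: "\<bar>zig (snd z) - zig (snd z')\<bar> = (L + 1) * \<bar>snd z - snd z'\<bar>"
          using n bd(2)[OF z(1)] bd(2)[OF z(2)] by (intro zig(4)) auto
        have "dist z z' = \<bar>snd z - snd z'\<bar>" using z(3) by (simp add: dist_prod_def dist_real_def)
        then have "\<bar>g z - g z'\<bar> \<le> L * \<bar>snd z - snd z'\<bar>" using g(2)[of z z'] by simp
        moreover have "g z - g z' = - (zig (snd z) - zig (snd z'))"
        proof -
          have "fst z = fst z'" "H z = H z'" using z(3) by simp_all
          then show ?thesis unfolding H_def G_def by simp
        qed
        ultimately have "\<bar>snd z - snd z'\<bar> \<le> 0" using zz by (simp add: algebra_simps)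
        then show "z = z'" using z(3) by (simp add: prod_eq_iff)
      qed
      then show ?thesis ..
    qed
  qed
  show ?thesis by (rule that[OF cH close \<rho>(1) \<zeta>(1) main])
qed

text \<open>In a small ball around one of its points, a level set embeds in a line by the first or
  second coordinate; finitely many such balls cover the integer levels.\<close>

lemma level_set_arcs:
  fixes H :: "real \<times> real \<Rightarrow> real"
  assumes H: "continuous_on UNIV H" and \<rho>: "0 < \<rho>" and r: "0 < r"
    and chart: "\<And>z0. z0 \<in> unit_square \<Longrightarrow> H z0 \<in> \<int> \<Longrightarrow>
       inj_on (\<lambda>z. (fst z, H z)) (cball z0 \<rho>) \<or> inj_on (\<lambda>z. (snd z, H z)) (cball z0 \<rho>)"
  obtains \<A> where "finite \<A>" "\<Union>\<A> = {z \<in> unit_square. H z \<in> \<int>}"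
    "\<And>A. A \<in> \<A> \<Longrightarrow> arc_like A" "\<And>A z z'. A \<in> \<A> \<Longrightarrow> z \<in> A \<Longrightarrow> z' \<in> A \<Longrightarrow> dist z z' < r"
proof -
  let ?C = "{z \<in> unit_square. H z \<in> \<int>}"
  have HQ: "continuous_on unit_square H" by (rule continuous_on_subset[OF H]) simp
  have cC: "compact ?C"
  proof -
    have "?C = unit_square \<inter> H -` \<int>" by auto
    then show ?thesis
      using continuous_closedin_preimage[OF HQ closed_Ints] closedin_compact[OF compact_unit_square] by simp
  qed
  have "uniformly_continuous_on unit_square H"
    by (rule compact_uniformly_continuous[OF HQ compact_unit_square])
  then obtain d where d: "0 < d" "\<And>z z'. z \<in> unit_square \<Longrightarrow> z' \<in> unit_square \<Longrightarrow> dist z' z < d \<Longrightarrow> dist (H z') (H z) < 1"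
    unfolding uniformly_continuous_on_def by (metis zero_less_one)
  define s where "s = min (min d \<rho>) (r / 3)"
  have s: "0 < s" "s \<le> d" "s \<le> \<rho>" "s \<le> r / 3" using d(1) \<rho> r unfolding s_def by auto
  define A where "A z0 = {z \<in> unit_square \<inter> cball z0 s. H z = H z0}" for z0
  obtain Z where Z: "Z \<subseteq> ?C" "finite Z" "?C \<subseteq> (\<Union>z\<in>Z. ball z s)"
  proof (rule compactE_image[OF cC, of ?C "\<lambda>z. ball z s"])
    show "?C \<subseteq> (\<Union>z\<in>?C. ball z s)" using s(1) by force
  qed auto
  show ?thesis
  proof (rule that[of "A ` Z"])
    show "finite (A ` Z)" using Z(2) by simp
    show "\<Union>(A ` Z) = ?C"
    proof
      have "H z \<in> \<int>" if "z \<in> A z0" "z0 \<in> Z" for z z0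
        using that Z(1) unfolding A_def by auto
      then show "\<Union>(A ` Z) \<subseteq> ?C" unfolding A_def by blast
      show "?C \<subseteq> \<Union>(A ` Z)"
      proof
        fix z assume z: "z \<in> ?C"
        then obtain z0 where z0: "z0 \<in> Z" "dist z0 z < s" using Z(3) by auto
        have C0: "z0 \<in> unit_square" "H z0 \<in> \<int>" using z0(1) Z(1) by blast+
        have zC: "z \<in> unit_square" "H z \<in> \<int>" using z by blast+
        have "\<bar>H z - H z0\<bar> < 1" using d(2)[OF C0(1) zC(1)] z0(2) s(2) by (simp add: dist_commute dist_real_def)
        then have "H z = H z0" using Ints_eq_abs_less1[OF zC(2) C0(2)] by simp
        then have "z \<in> A z0" unfolding A_def using zC(1) z0(2) by auto
        then show "z \<in> \<Union>(A ` Z)" using z0(1) by blast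
      qed
    qed
    fix A' assume "A' \<in> A ` Z"
    then obtain z0 where z0: "z0 \<in> Z" "A' = A z0" by blast
    have C0: "z0 \<in> unit_square" "H z0 \<in> \<int>" using z0(1) Z(1) by blast+
    show "dist z z' < r" if "z \<in> A'" "z' \<in> A'" for z z'
      using that dist_triangle[of z z' z0] s(4) r unfolding z0(2) A_def by (auto simp: dist_commute)
    have "A z0 = (unit_square \<inter> cball z0 s) \<inter> H -` {H z0}" unfolding A_def by auto
    moreover have c: "compact (unit_square \<inter> cball z0 s)" by (intro compact_Int_closed compact_unit_square closed_cball)
    moreover have "continuous_on (unit_square \<inter> cball z0 s) H" by (rule continuous_on_subset[OF H]) simp
    ultimately have "compact (A z0)"
      using continuous_closedin_preimage[of "unit_square \<inter> cball z0 s" H "{H z0}"] closedin_compact[OF c] by simp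
    moreover have AQ: "A z0 \<subseteq> unit_square" unfolding A_def by blast
    moreover have "\<exists>q :: real \<times> real \<Rightarrow> real. continuous_on (A z0) q \<and> q ` A z0 \<subseteq> {0..1} \<and> inj_on q (A z0)"
    proof -
      have sub: "z \<in> cball z0 \<rho>" "H z = H z0" if "z \<in> A z0" for z
        using that s(3) unfolding A_def by auto
      have im: "fst ` A z0 \<subseteq> {0..1}" "snd ` A z0 \<subseteq> {0..1}" using AQ by (auto simp: mem_Times_iff)
      have "inj_on q (A z0)" if "inj_on (\<lambda>z. (q z, H z)) (cball z0 \<rho>)" for q :: "real \<times> real \<Rightarrow> real"
        by (rule inj_onI) (use inj_onD[OF that] sub in auto)
      then have "inj_on fst (A z0) \<or> inj_on snd (A z0)" using chart[OF C0] by blast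
      then show ?thesis
      proof
        assume "inj_on fst (A z0)"
        then show ?thesis using im by (intro exI[of _ fst] conjI continuous_intros)
      next
        assume "inj_on snd (A z0)"
        then show ?thesis using im by (intro exI[of _ snd] conjI continuous_intros)
      qed
    qed
    ultimately show "arc_like A'" unfolding arc_like_def z0(2) by blast
  qed
qed

lemma square_grid:
  assumes r: "0 < r"
  obtains \<S> \<G> where "finite \<S>" "\<Union>\<S> = unit_square" "\<And>S. S \<in> \<S> \<Longrightarrow> compact S"
    "\<And>S z z'. S \<in> \<S> \<Longrightarrow> z \<in> S \<Longrightarrow> z' \<in> S \<Longrightarrow> dist z z' < r"
    "finite \<G>" "\<And>A. A \<in> \<G> \<Longrightarrow> arc_like A" "\<Union>\<G> \<noteq> {}"
    "\<And>S S'. S \<in> \<S> \<Longrightarrow> S' \<in> \<S> \<Longrightarrow> S \<noteq> S' \<Longrightarrow> S \<inter> S' \<subseteq> \<Union>\<G>"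
proof -
  obtain N where N: "0 < N" "2 / real N < r"
  proof -
    obtain N where "N \<noteq> 0" "inverse (real N) < r / 2" using real_arch_inverse[of "r / 2"] r by auto
    then show ?thesis by (intro that[of N]) (auto simp: field_simps)
  qed
  define I where "I m = {real m / real N..real (Suc m) / real N}" for m
  have Isub: "I m \<subseteq> {0..1}" if "m < N" for m using mesh_interval(4)[OF that] unfolding I_def .
  have Idist: "\<bar>x - x'\<bar> \<le> 1 / N" if "x \<in> I m" "x' \<in> I m" for x x' m
  proof -
    have "real (Suc m) / N = real m / N + 1 / N" by (simp add: add_divide_distrib)
    then show ?thesis using that unfolding I_def by auto
  qed
  have Iint: "\<exists>k\<le>N. x = k / N" if "x \<in> I m" "x \<in> I m'" "m < m'" "m' < N" for x m m'
  proof -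
    have "real (Suc m) / N \<le> real m' / N" using that(3) by (intro divide_right_mono) auto
    then have "x = m' / N" using that(1,2) unfolding I_def by auto
    then show ?thesis using that(4) by (intro exI[of _ m']) auto
  qed
  define \<S> where "\<S> = (\<lambda>(p, q). I p \<times> I q) ` ({..<N} \<times> {..<N})"
  define \<G> where "\<G> = (\<lambda>k. {0..1} \<times> {real k / real N}) ` {..N} \<union> (\<lambda>k. {real k / real N} \<times> {0..1::real}) ` {..N}"
  have Scase: "\<exists>p<N. \<exists>q<N. S = I p \<times> I q" if "S \<in> \<S>" for S using that unfolding \<S>_def by auto
  have line: "(x, y) \<in> \<Union>\<G>" if "x \<in> {0..1}" "y \<in> {0..1}" "(\<exists>k\<le>N. x = k / N) \<or> (\<exists>k\<le>N. y = k / N)" for x y :: real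
    using that unfolding \<G>_def by fastforce
  show ?thesis
  proof (rule that[of \<S> \<G>])
    show "finite \<S>" "finite \<G>" unfolding \<S>_def \<G>_def by auto
    show "\<Union>\<S> = unit_square"
    proof
      show "\<Union>\<S> \<subseteq> unit_square"
      proof (rule Union_least)
        fix S assume "S \<in> \<S>"
        then obtain p q where "p < N" "q < N" "S = I p \<times> I q" using Scase by blast
        then show "S \<subseteq> unit_square" using Isub by (simp add: Sigma_mono)
      qed
      show "unit_square \<subseteq> \<Union>\<S>"
      proof
        fix z :: "real \<times> real" assume z: "z \<in> unit_square"
        then have "fst z \<in> {0..1}" "snd z \<in> {0..1}" by (simp_all only: mem_Times_iff)
        then obtain p q where "p < N" "fst z \<in> I p" "q < N" "snd z \<in> I q"
          using mesh_cover[OF N(1)] unfolding I_def by meson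
        then show "z \<in> \<Union>\<S>" unfolding \<S>_def
          by (intro UnionI[of "I p \<times> I q"]) (auto simp: mem_Times_iff)
      qed
    qed
    show "compact S" if S: "S \<in> \<S>" for S
      using Scase[OF S] unfolding I_def by (auto intro: compact_Times)
    show "dist z z' < r" if S: "S \<in> \<S>" and z: "z \<in> S" "z' \<in> S" for S z z'
    proof -
      obtain p q where "S = I p \<times> I q" using Scase[OF S] by blast
      then have "\<bar>fst z - fst z'\<bar> \<le> 1 / N" "\<bar>snd z - snd z'\<bar> \<le> 1 / N"
        using z Idist by (auto simp: mem_Times_iff)
      moreover have "dist z z' \<le> \<bar>fst z - fst z'\<bar> + \<bar>snd z - snd z'\<bar>"
        unfolding dist_prod_def dist_real_def by (simp add: sqrt_sum_squares_le_sum_abs)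
      ultimately show ?thesis using N(2) by simp
    qed
    show "arc_like A" if "A \<in> \<G>" for A
    proof -
      have "real k / real N \<in> {0..1}" if "k \<le> N" for k using that N(1) by (simp add: field_simps)
      then show ?thesis using that arc_like_segments unfolding \<G>_def by auto
    qed
    have "(0, 0) \<in> \<Union>\<G>" by (rule line) (auto intro: exI[of _ "0::nat"])
    then show "\<Union>\<G> \<noteq> {}" by blast
    show "S \<inter> S' \<subseteq> \<Union>\<G>" if S: "S \<in> \<S>" "S' \<in> \<S>" "S \<noteq> S'" for S S'
    proof
      fix z assume z: "z \<in> S \<inter> S'"
      obtain p q where 1: "p < N" "q < N" "S = I p \<times> I q" using Scase[OF S(1)] by blast
      obtain p' q' where 2: "p' < N" "q' < N" "S' = I p' \<times> I q'" using Scase[OF S(2)] by blast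
      obtain x y where xy: "z = (x, y)" by (cases z)
      have i: "x \<in> I p" "y \<in> I q" "x \<in> I p'" "y \<in> I q'" using z unfolding xy 1 2 by auto
      have "p \<noteq> p' \<or> q \<noteq> q'" using S(3) 1(3) 2(3) by auto
      then have "(\<exists>k\<le>N. x = k / N) \<or> (\<exists>k\<le>N. y = k / N)"
      proof
        assume "p \<noteq> p'"
        then show ?thesis using Iint[OF i(1,3)] Iint[OF i(3,1)] 1(1) 2(1) by (meson nat_neq_iff)
      next
        assume "q \<noteq> q'"
        then show ?thesis using Iint[OF i(2,4)] Iint[OF i(4,2)] 1(2) 2(2) by (meson nat_neq_iff)
      qed
      then show "z \<in> \<Union>\<G>" unfolding xy
        by (intro line subsetD[OF Isub[OF 1(1)] i(1)] subsetD[OF Isub[OF 1(2)] i(2)])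
    qed
  qed
qed

text \<open>A sum of ramps, one for each integer \<open>k\<close> from \<open>- M\<close> to \<open>M\<close>: the sum climbs by 1 within \<open>\<zeta>\<close>
  of \<open>k\<close>, has the value \<open>k\<close> at \<open>k\<close>, and is constant between two ramps.\<close>

lemma staircase:
  fixes \<zeta> :: real and M :: nat
  assumes \<zeta>: "0 < \<zeta>" "\<zeta> \<le> 1/4"
  obtains s where "continuous_on UNIV s"
    "\<And>(k::int) (y::real). \<bar>k\<bar> \<le> M \<Longrightarrow> \<bar>y - k\<bar> \<le> \<zeta> \<Longrightarrow> s y = k + (y - k) / (2 * \<zeta>)"
    "\<And>(k::int) (y::real). - int M \<le> k \<Longrightarrow> k < M \<Longrightarrow> k + \<zeta> \<le> y \<Longrightarrow> y \<le> k + 1 - \<zeta> \<Longrightarrow> s y = k + 1/2"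
proof -
  \<comment> \<open>the term of \<open>k\<close> is \<open>1/2\<close> above \<open>k + \<zeta>\<close> and \<open>-1/2\<close> below \<open>k - \<zeta>\<close>; the symmetric range of
    summation makes the sum equal \<open>k\<close> at \<open>k\<close>\<close>
  define t where "t k y = max (-1/2) (min (1/2) ((y - of_int k) / (2 * \<zeta>)))" for k :: int and y :: real
  define s where "s y = (\<Sum>k\<in>{- int M..int M}. t k y)" for y
  have hi: "t k y = 1/2" if "k + \<zeta> \<le> y" for k :: int and y :: real
    using that \<zeta>(1) unfolding t_def by (simp add: field_simps min_def max_def)
  have lo: "t k y = -1/2" if "y \<le> k - \<zeta>" for k :: int and y :: real
    using that \<zeta>(1) unfolding t_def by (auto simp: field_simps min_def max_def)
  have ev: "s y = k + t k y"
    if k: "\<bar>k\<bar> \<le> M" and y: "k - 1 + \<zeta> \<le> y" "y \<le> k + 1 - \<zeta>" for k :: int and y :: real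
  proof -
    have "{- int M..int M} = {- int M..k - 1} \<union> ({k} \<union> {k + 1..int M})" using k by auto
    then have "s y = (\<Sum>j\<in>{- int M..k - 1}. t j y) + (t k y + (\<Sum>j\<in>{k + 1..int M}. t j y))"
      unfolding s_def by (subst sum.union_disjoint | simp | subst sum.union_disjoint)+
    also have "(\<Sum>j\<in>{- int M..k - 1}. t j y) = (\<Sum>j\<in>{- int M..k - 1}. 1/2)"
    proof (rule sum.cong)
      fix j assume "j \<in> {- int M..k - 1}"
      then have "of_int j \<le> (of_int k - 1 :: real)" by auto
      then show "t j y = 1/2" using y(1) by (intro hi) linarith
    qed simp
    also have "\<dots> = (k + M) / 2" using k by simp
    also have "(\<Sum>j\<in>{k + 1..int M}. t j y) = (\<Sum>j\<in>{k + 1..int M}. -1/2)"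
    proof (rule sum.cong)
      fix j assume "j \<in> {k + 1..int M}"
      then have "of_int k + 1 \<le> (of_int j :: real)" by auto
      then show "t j y = -1/2" using y(2) by (intro lo) linarith
    qed simp
    also have "\<dots> = - (M - k) / 2" using k by (simp add: field_simps)
    finally show ?thesis by (simp add: field_simps)
  qed
  show ?thesis
  proof (rule that[of s])
    show "continuous_on UNIV s" unfolding s_def t_def using \<zeta>(1) by (intro continuous_intros) auto
    show "s y = k + (y - k) / (2 * \<zeta>)" if "\<bar>k\<bar> \<le> M" "\<bar>y - k\<bar> \<le> \<zeta>" for k :: int and y :: real
    proof -
      have "s y = k + t k y" using that \<zeta>(2) by (intro ev) (auto simp: abs_le_iff)
      moreover have "t k y = (y - k) / (2 * \<zeta>)"
      proof -
        have "-1/2 \<le> (y - k) / (2 * \<zeta>)" "(y - k) / (2 * \<zeta>) \<le> 1/2"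
          using that(2) \<zeta>(1) by (auto simp: field_simps abs_le_iff)
        then show ?thesis unfolding t_def by simp
      qed
      ultimately show ?thesis by simp
    qed
    show "s y = k + 1/2" if "- int M \<le> k" "k < M" "k + \<zeta> \<le> y" "y \<le> k + 1 - \<zeta>" for k :: int and y :: real
      using ev[of k y] hi[OF that(3)] that \<zeta>(2) by auto
  qed
qed

section \<open>Disjoint disks from concordances\<close>

text \<open>The levels of \<open>H i\<close> consist of arcs, and a small move of the disks separates the images of
  two arcs that are disjoint or belong to different disks. The first move makes points of the same
  disk that lie on integer levels and have distance at least \<open>\<rho>\<close> in the square have different
  images; this fixes a scale \<open>\<omega>\<close> in \<open>X\<close>. Only then is the grid chosen, fine enough for the images
  of its cells to be small compared with \<open>\<omega>\<close>. The second, smaller move makes the walls of the two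
  disks disjoint, which consist of the integer levels and the lines of the grid.\<close>

lemma disks_in_general_position:
  fixes X :: "'a::metric_space set" and H :: "bool \<Rightarrow> real \<times> real \<Rightarrow> real"
  assumes X: "homeomorphic_to_ENR X" and dpp: "disjoint_paths_property X"
    and f: "disk_pair X f" and e: "0 < e"
    and H: "\<And>i. continuous_on UNIV (H i)" and \<rho>: "0 < \<rho>"
    and chart: "\<And>i z0. z0 \<in> unit_square \<Longrightarrow> H i z0 \<in> \<int> \<Longrightarrow>
       inj_on (\<lambda>z. (fst z, H i z)) (cball z0 \<rho>) \<or> inj_on (\<lambda>z. (snd z, H i z)) (cball z0 \<rho>)"
  shows "\<exists>a \<S> E \<omega>. disk_pair X a \<and> close_pairs e f a \<and> 0 < \<omega> \<and>
    finite \<S> \<and> \<Union>\<S> = unit_square \<and> (\<forall>S\<in>\<S>. compact S) \<and>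
    (\<forall>i. compact (E i) \<and> E i \<noteq> {} \<and> E i \<subseteq> unit_square \<and> {z \<in> unit_square. H i z \<in> \<int>} \<subseteq> E i \<and>
       (\<forall>S\<in>\<S>. \<forall>S'\<in>\<S>. S \<noteq> S' \<longrightarrow> S \<inter> S' \<subseteq> E i) \<and>
       (\<forall>S\<in>\<S>. \<forall>z\<in>S. \<forall>z'\<in>S. dist (a i z) (a i z') < 3 * \<omega> / 8) \<and>
       (\<forall>z\<in>unit_square. \<forall>z'\<in>unit_square. H i z \<in> \<int> \<longrightarrow> H i z' \<in> \<int> \<longrightarrow> \<rho> \<le> dist z z' \<longrightarrow>
          3 * \<omega> / 4 \<le> dist (a i z) (a i z'))) \<and>
    (\<forall>z\<in>E True. \<forall>z'\<in>E False. a True z \<noteq> a False z')"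
proof -
  define C where "C i = {z \<in> unit_square. H i z \<in> \<int>}" for i
  have HQ: "continuous_on unit_square (H i)" for i by (rule continuous_on_subset[OF H]) simp
  have "\<exists>\<A>. finite \<A> \<and> \<Union>\<A> = C i \<and> (\<forall>A\<in>\<A>. arc_like A \<and> (\<forall>z\<in>A. \<forall>z'\<in>A. dist z z' < \<rho> / 2))" for i
  proof -
    have rr: "0 < \<rho> / 2" using \<rho> by simp
    obtain \<A> where B: "finite \<A>" "\<Union>\<A> = {z \<in> unit_square. H i z \<in> \<int>}"
      "\<And>A. A \<in> \<A> \<Longrightarrow> arc_like A" "\<And>A z z'. A \<in> \<A> \<Longrightarrow> z \<in> A \<Longrightarrow> z' \<in> A \<Longrightarrow> dist z z' < \<rho> / 2"
    proof (rule level_set_arcs[OF H[of i] \<rho> rr])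
      show "inj_on (\<lambda>z. (fst z, H i z)) (cball z0 \<rho>) \<or> inj_on (\<lambda>z. (snd z, H i z)) (cball z0 \<rho>)"
        if "z0 \<in> unit_square" "H i z0 \<in> \<int>" for z0 by (rule chart[OF that])
    qed (rule that; assumption)
    show ?thesis
      unfolding C_def by (rule exI[of _ \<A>], intro conjI ballI) (assumption | rule B)+
  qed
  then have "\<exists>\<A>. \<forall>i. finite (\<A> i) \<and> \<Union>(\<A> i) = C i \<and>
      (\<forall>A\<in>\<A> i. arc_like A \<and> (\<forall>z\<in>A. \<forall>z'\<in>A. dist z z' < \<rho> / 2))" by (intro choice allI)
  then obtain \<A> where A': "\<forall>i. finite (\<A> i) \<and> \<Union>(\<A> i) = C i \<and>
      (\<forall>A\<in>\<A> i. arc_like A \<and> (\<forall>z\<in>A. \<forall>z'\<in>A. dist z z' < \<rho> / 2))" ..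
  have A: "finite (\<A> i)" "\<Union>(\<A> i) = C i" "\<And>A. A \<in> \<A> i \<Longrightarrow> arc_like A"
    "\<And>A z z'. A \<in> \<A> i \<Longrightarrow> z \<in> A \<Longrightarrow> z' \<in> A \<Longrightarrow> dist z z' < \<rho> / 2" for i
  proof -
    note AA = spec[OF A', of i]
    show "finite (\<A> i)" "\<Union>(\<A> i) = C i" by (rule conjunct1[OF AA], rule conjunct1[OF conjunct2[OF AA]])
    show "arc_like A" if "A \<in> \<A> i" for A
      by (rule conjunct1[OF bspec[OF conjunct2[OF conjunct2[OF AA]] that]])
    show "dist z z' < \<rho> / 2" if "A \<in> \<A> i" "z \<in> A" "z' \<in> A" for A z z'
      by (rule bspec[OF bspec[OF conjunct2[OF bspec[OF conjunct2[OF conjunct2[OF AA]] that(1)]] that(2)] that(3)])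
  qed
  have cC: "compact (C i)" "C i \<subseteq> unit_square" for i
  proof -
    have "compact (\<Union>(\<A> i))" using A(1,3) unfolding arc_like_def by (intro compact_Union) blast+
    then show "compact (C i)" using A(2) by simp
    show "C i \<subseteq> unit_square" unfolding C_def by blast
  qed
  \<comment> \<open>Arcs have diameter less than \<open>\<rho> / 2\<close>, so arcs through points at distance at least \<open>\<rho>\<close> are
    disjoint.\<close>
  define P1 where "P1 = {(i, A, i', A'). i = i' \<and> A \<in> \<A> i \<and> A' \<in> \<A> i \<and> A \<inter> A' = {}}"
  have "finite P1"
  proof (rule finite_subset)
    show "P1 \<subseteq> (\<Union>i. {i} \<times> \<A> i \<times> {i} \<times> \<A> i)" unfolding P1_def by auto
    show "finite (\<Union>i. {i} \<times> \<A> i \<times> {i} \<times> \<A> i)" using A(1) by auto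
  qed
  have e2: "0 < e / 2" using e by simp
  obtain a1 where a1: "disk_pair X a1" "close_pairs (e / 2) f a1"
    "\<And>i A i' A'. (i, A, i', A') \<in> P1 \<Longrightarrow> a1 i ` A \<inter> a1 i' ` A' = {}"
  proof (rule separate_finitely_many_arcs[OF X dpp f e2 \<open>finite P1\<close>])
    show "arc_like A \<and> arc_like A' \<and> (i = i' \<longrightarrow> A \<inter> A' = {})" if "(i, A, i', A') \<in> P1" for i A i' A'
      using that A(3) unfolding P1_def by blast
  qed (rule that; assumption)
  have ca1: "continuous_on unit_square (a1 i)" for i using a1(1) unfolding disk_pair_def by blast
  have ne1: "a1 i z \<noteq> a1 i z'" if z: "z \<in> C i" "z' \<in> C i" "\<rho> \<le> dist z z'" for i z z'
  proof -
    obtain A where AA: "A \<in> \<A> i" "z \<in> A" using z(1) A(2) by blast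
    obtain A'' where AA': "A'' \<in> \<A> i" "z' \<in> A''" using z(2) A(2) by blast
    have "A \<inter> A'' = {}"
    proof (rule equals0I)
      fix w assume "w \<in> A \<inter> A''"
      then have "dist z w < \<rho> / 2" "dist w z' < \<rho> / 2" using A(4) AA AA' by blast+
      then show False using z(3) dist_triangle[of z z' w] by linarith
    qed
    then have "(i, A, i, A'') \<in> P1" unfolding P1_def using AA(1) AA'(1) by blast
    then show ?thesis using a1(3) AA(2) AA'(2) by blast
  qed
  have "\<exists>w>0. \<forall>z\<in>C i. \<forall>z'\<in>C i. \<rho> \<le> dist z z' \<longrightarrow> w \<le> dist (a1 i z) (a1 i z')" for i
  proof -
    let ?P = "(C i \<times> C i) \<inter> (\<lambda>p. dist (fst p) (snd p)) -` {\<rho>..}"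
    have cd: "continuous_on (C i \<times> C i) (\<lambda>p. dist (fst p) (snd p))" by (intro continuous_intros)
    have cP: "compact ?P"
      by (rule closedin_compact[OF compact_Times[OF cC(1) cC(1)] continuous_closedin_preimage[OF cd closed_atLeast]])
    have cf: "continuous_on ?P (\<lambda>p. dist (a1 i (fst p)) (a1 i (snd p)))"
      by (intro continuous_intros continuous_on_compose2[OF ca1])
         (rule image_subsetI, rule subsetD[OF cC(2)], force)+
    have pf: "0 < dist (a1 i (fst p)) (a1 i (snd p))" if "p \<in> ?P" for p
      using ne1[of "fst p" i "snd p"] that by (auto simp: mem_Times_iff)
    obtain m where "0 < m" "\<And>p. p \<in> ?P \<Longrightarrow> m \<le> dist (a1 i (fst p)) (a1 i (snd p))"
      by (rule compact_pos_lower_bound[OF cP cf pf]) (assumption, rule that)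
    then show ?thesis by (intro exI[of _ m]) auto
  qed
  then have "\<exists>w. \<forall>i. w i > 0 \<and> (\<forall>z\<in>C i. \<forall>z'\<in>C i. \<rho> \<le> dist z z' \<longrightarrow> w i \<le> dist (a1 i z) (a1 i z'))"
    by (intro choice allI)
  then obtain w where w: "\<forall>i. w i > 0 \<and> (\<forall>z\<in>C i. \<forall>z'\<in>C i. \<rho> \<le> dist z z' \<longrightarrow> w i \<le> dist (a1 i z) (a1 i z'))" ..
  define \<omega> where "\<omega> = min (w True) (w False)"
  have \<omega>: "0 < \<omega>" "\<omega> \<le> w i" for i using w unfolding \<omega>_def by (auto, cases i) auto
  have near1: "\<omega> \<le> dist (a1 i z) (a1 i z')" if "z \<in> C i" "z' \<in> C i" "\<rho> \<le> dist z z'" for i z z'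
  proof -
    have "w i \<le> dist (a1 i z) (a1 i z')" using spec[OF w, of i] that by blast
    then show ?thesis using \<omega>(2)[of i] by linarith
  qed
  have "\<exists>r>0. \<forall>z\<in>unit_square. \<forall>z'\<in>unit_square. dist z' z < r \<longrightarrow> dist (a1 i z') (a1 i z) < \<omega> / 8" for i
    using compact_uniformly_continuous[OF ca1 compact_unit_square, of i, unfolded uniformly_continuous_on_def,
        THEN spec[of _ "\<omega> / 8"]] \<omega>(1) by simp
  then have "\<exists>r. \<forall>i. r i > 0 \<and> (\<forall>z\<in>unit_square. \<forall>z'\<in>unit_square. dist z' z < r i \<longrightarrow> dist (a1 i z') (a1 i z) < \<omega> / 8)"
    by (intro choice allI)
  then obtain r where r: "\<forall>i. r i > 0 \<and> (\<forall>z\<in>unit_square. \<forall>z'\<in>unit_square. dist z' z < r i \<longrightarrow> dist (a1 i z') (a1 i z) < \<omega> / 8)" ..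
  define r0 where "r0 = min (r True) (r False)"
  have r0: "0 < r0" "r0 \<le> r i" for i using r unfolding r0_def by (auto, cases i) auto
  obtain \<S> \<G> where S: "finite \<S>" "\<Union>\<S> = unit_square" "\<And>S. S \<in> \<S> \<Longrightarrow> compact S"
    "\<And>S z z'. S \<in> \<S> \<Longrightarrow> z \<in> S \<Longrightarrow> z' \<in> S \<Longrightarrow> dist z z' < r0"
    "finite \<G>" "\<And>A. A \<in> \<G> \<Longrightarrow> arc_like A" "\<Union>\<G> \<noteq> {}"
    "\<And>S S'. S \<in> \<S> \<Longrightarrow> S' \<in> \<S> \<Longrightarrow> S \<noteq> S' \<Longrightarrow> S \<inter> S' \<subseteq> \<Union>\<G>"
    by (rule square_grid[OF r0(1)]) (rule that; assumption)
  define E where "E i = C i \<union> \<Union>\<G>" for i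
  \<comment> \<open>Moving by less than \<open>\<omega> / 8\<close> changes distances by less than \<open>\<omega> / 4\<close>.\<close>
  define P2 where "P2 = (\<lambda>(A, A'). (True, A, False, A')) ` ((\<A> True \<union> \<G>) \<times> (\<A> False \<union> \<G>))"
  have "finite P2" unfolding P2_def using A(1) S(5) by auto
  have e3: "0 < min (e / 2) (\<omega> / 8)" using e \<omega>(1) by simp
  obtain a where a: "disk_pair X a" "close_pairs (min (e / 2) (\<omega> / 8)) a1 a"
    "\<And>i A i' A'. (i, A, i', A') \<in> P2 \<Longrightarrow> a i ` A \<inter> a i' ` A' = {}"
  proof (rule separate_finitely_many_arcs[OF X dpp a1(1) e3 \<open>finite P2\<close>])
    show "arc_like A \<and> arc_like A' \<and> (i = i' \<longrightarrow> A \<inter> A' = {})" if "(i, A, i', A') \<in> P2" for i A i' A'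
    proof -
      have "A \<in> \<A> True \<union> \<G>" "A' \<in> \<A> False \<union> \<G>" "i" "\<not> i'" using that unfolding P2_def by auto
      moreover have "arc_like B" if "B \<in> \<A> k \<union> \<G>" for B k using that A(3) S(6) by blast
      ultimately show ?thesis by blast
    qed
  qed (rule that; assumption)
  have close1: "dist (a1 i z) (a i z) < \<omega> / 8" if "z \<in> unit_square" for i z
  proof -
    have "close_pairs (\<omega> / 8) a1 a" by (rule close_pairs_mono[OF a(2)]) simp
    then show ?thesis using that unfolding close_pairs_def by blast
  qed
  have "close_pairs (e / 2 + e / 2) f a" by (rule close_pairs_trans[OF a1(2) close_pairs_mono[OF a(2)]]) simp
  then have fa: "close_pairs e f a" by simp
  have sep: "a True z \<noteq> a False z'" if z: "z \<in> E True" "z' \<in> E False" for z z'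
  proof -
    obtain B where B: "B \<in> \<A> True \<union> \<G>" "z \<in> B" using z(1) A(2) unfolding E_def by blast
    obtain B' where B': "B' \<in> \<A> False \<union> \<G>" "z' \<in> B'" using z(2) A(2) unfolding E_def by blast
    have "(True, B, False, B') \<in> P2" unfolding P2_def using B(1) B'(1) by (intro image_eqI[of _ _ "(B, B')"]) auto
    then show ?thesis using a(3) B(2) B'(2) by blast
  qed
  have near: "3 * \<omega> / 4 \<le> dist (a i z) (a i z')" if z: "z \<in> C i" "z' \<in> C i" "\<rho> \<le> dist z z'" for i z z'
  proof -
    have "z \<in> unit_square" "z' \<in> unit_square" using z cC(2) by blast+
    then have "dist (a1 i z) (a i z) < \<omega> / 8" "dist (a1 i z') (a i z') < \<omega> / 8" using close1 by blast+
    moreover have "\<omega> \<le> dist (a1 i z) (a1 i z')" by (rule near1[OF z])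
    ultimately show ?thesis
      using dist_triangle[of "a1 i z" "a1 i z'" "a i z"] dist_triangle[of "a i z" "a1 i z'" "a i z'"]
      by (simp add: dist_commute)
  qed
  have cells: "dist (a i z) (a i z') < 3 * \<omega> / 8" if z: "D \<in> \<S>" "z \<in> D" "z' \<in> D" for i D z z'
  proof -
    have Q: "z \<in> unit_square" "z' \<in> unit_square" using z S(2) by blast+
    have "dist z z' < r i" using S(4)[OF z] r0(2)[of i] by simp
    then have "dist (a1 i z) (a1 i z') < \<omega> / 8" using r Q by blast
    moreover have "dist (a1 i z) (a i z) < \<omega> / 8" "dist (a1 i z') (a i z') < \<omega> / 8" using close1 Q by blast+
    ultimately show ?thesis
      using dist_triangle[of "a i z" "a i z'" "a1 i z"] dist_triangle[of "a1 i z" "a i z'" "a1 i z'"]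
      by (simp add: dist_commute)
  qed
  have cE: "compact (E i)" "E i \<noteq> {}" "E i \<subseteq> unit_square" "{z \<in> unit_square. H i z \<in> \<int>} \<subseteq> E i" for i
  proof -
    have "compact (\<Union>\<G>)" using S(5,6) unfolding arc_like_def by (intro compact_Union) blast+
    then show "compact (E i)" unfolding E_def using cC(1) by (intro compact_Un)
    show "E i \<noteq> {}" unfolding E_def using S(7) by blast
    have "\<Union>\<G> \<subseteq> unit_square" using S(6) unfolding arc_like_def by blast
    then show "E i \<subseteq> unit_square" unfolding E_def using cC(2) by blast
    show "{z \<in> unit_square. H i z \<in> \<int>} \<subseteq> E i" unfolding E_def C_def by blast
  qed
  show ?thesis
  proof (rule exI[of _ a], rule exI[of _ \<S>], rule exI[of _ E], rule exI[of _ \<omega>], intro conjI allI ballI impI)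
    show "S' \<inter> S'' \<subseteq> E i" if "S' \<in> \<S>" "S'' \<in> \<S>" "S' \<noteq> S''" for i S' S''
      using S(8)[OF that] unfolding E_def by blast
    show "3 * \<omega> / 4 \<le> dist (a i z) (a i z')"
      if "z \<in> unit_square" "z' \<in> unit_square" "H i z \<in> \<int>" "H i z' \<in> \<int>" "\<rho> \<le> dist z z'" for i z z'
      using near[of z i z'] that unfolding C_def by blast
  qed (fact a(1) fa \<omega>(1) S(1,2) cE | rule S(3) cells sep; assumption)+
qed

lemma near_integer:
  assumes "infdist y (\<int> :: real set) \<le> \<zeta>"
  obtains m :: int where "\<bar>y - m\<bar> \<le> \<zeta>"
proof -
  have ne: "(\<int> :: real set) \<noteq> {}" by auto
  obtain x :: real where "x \<in> \<int>" "infdist y \<int> = dist y x"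
    by (rule infdist_attains_inf[OF closed_Ints ne]) (rule that)
  then show ?thesis using that assms by (auto simp: Ints_def dist_real_def)
qed

lemma far_from_integers:
  fixes y \<zeta> :: real
  assumes "\<zeta> < infdist y \<int>"
  shows "\<lfloor>y\<rfloor> + \<zeta> < y" "y < \<lfloor>y\<rfloor> + 1 - \<zeta>"
proof -
  have d: "infdist y \<int> \<le> \<bar>y - of_int m\<bar>" for m :: int
    using infdist_le[of "of_int m" "\<int> :: real set" y] by (simp add: dist_real_def)
  show "\<lfloor>y\<rfloor> + \<zeta> < y" using d[of "\<lfloor>y\<rfloor>"] assms by linarith
  show "y < \<lfloor>y\<rfloor> + 1 - \<zeta>" using d[of "\<lfloor>y\<rfloor> + 1"] assms by linarith
qed

lemma half_integer_abs:
  fixes m :: int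
  shows "1/2 \<le> \<bar>real_of_int m + 1/2\<bar>"
proof (cases "0 \<le> m")
  case True
  then have "0 \<le> real_of_int m" by simp
  then show ?thesis by linarith
next
  case False
  then have "m \<le> - 1" by simp
  then have "real_of_int m \<le> - 1" by linarith
  then show ?thesis by linarith
qed

text \<open>The offsets distinguish the heights of different cells of the grid between the same two
  levels.\<close>

lemma separated_offsets:
  assumes "finite \<S>" "\<S> \<noteq> {}"
  obtains o' :: "'s \<Rightarrow> real" and \<eta> where "0 < \<eta>" "\<eta> \<le> 1/100" "\<And>S. S \<in> \<S> \<Longrightarrow> 0 < o' S" "\<And>S. S \<in> \<S> \<Longrightarrow> o' S \<le> 1/8"
    "\<And>S S'. S \<in> \<S> \<Longrightarrow> S' \<in> \<S> \<Longrightarrow> S \<noteq> S' \<Longrightarrow> 10 * \<eta> < \<bar>o' S - o' S'\<bar>"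
proof -
  obtain h where h: "bij_betw h \<S> {0..<card \<S>}" using ex_bij_betw_finite_nat[OF assms(1)] by blast
  define n where "n = card \<S>"
  have n: "0 < n" unfolding n_def using assms by (simp add: card_gt_0_iff)
  have hn: "h S < n" if "S \<in> \<S>" for S using bij_betwE[OF h] that unfolding n_def by auto
  show ?thesis
  proof (rule that[of "1 / (100 * real n)" "\<lambda>S. (real (h S) + 1) / (8 * real n)"])
    show "0 < 1 / (100 * real n)" "1 / (100 * real n) \<le> 1/100" using n by (auto simp: field_simps)
    show "0 < (real (h S) + 1) / (8 * real n)" for S using n by simp
    show "(real (h S) + 1) / (8 * real n) \<le> 1/8" if "S \<in> \<S>" for S
      using hn[OF that] n by (simp add: field_simps)
    show "10 * (1 / (100 * real n)) < \<bar>(real (h S) + 1) / (8 * real n) - (real (h S') + 1) / (8 * real n)\<bar>"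
      if S: "S \<in> \<S>" "S' \<in> \<S>" "S \<noteq> S'" for S S'
    proof -
      have "h S \<noteq> h S'" using bij_betw_imp_inj_on[OF h] S by (meson inj_onD)
      then have "1 \<le> \<bar>real (h S) - real (h S')\<bar>" by linarith
      then have "1 / (8 * n) \<le> \<bar>real (h S) - real (h S')\<bar> / (8 * n)" using n by (intro divide_right_mono) auto
      also have "\<dots> = \<bar>(real (h S) + 1) / (8 * n) - (real (h S') + 1) / (8 * n)\<bar>"
        using n by (simp add: diff_divide_distrib[symmetric] abs_divide)
      finally show ?thesis using n by (simp add: field_simps)
    qed
  qed
qed

text \<open>The new height of disk \<open>i\<close> is \<open>s (H i z) + \<sigma> i + bump i z\<close>, where \<open>s\<close> is a staircase and the
  bump is the offset of the cell containing \<open>z\<close>, switched off near integer levels. Away from the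
  walls it is \<open>k + 1/2 + \<sigma> i + os S\<close> on the part of the cell \<open>S\<close> between the levels \<open>k\<close> and
  \<open>k + 1\<close>. Since \<open>\<sigma> True - \<sigma> False = 1/2\<close>, such a plateau is, up to the small offset, at the
  height of the middle of a ramp of the other disk. There the latter has no bump, its height is an
  affine function of \<open>H (\<not> i)\<close>, and so the charts of \<open>H (\<not> i)\<close> embed the strip. The part of the
  strip whose image is near that of the cell lies in a single chart, because images of points on a
  level at distance at least \<open>\<rho>\<close> are farther apart than the image of a cell is wide.\<close>

lemma DCP_disjoint_disks_coarse:
  fixes X :: "'a::metric_space set" and h :: "bool \<Rightarrow> real \<times> real \<Rightarrow> real"
  assumes X: "homeomorphic_to_ENR X" and dcp: "disjoint_path_concordances_property X"
    and f: "disk_pair X f" and h: "\<And>i. continuous_on unit_square (h i)" and e: "0 < e"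
  shows "\<exists>b v. disk_pair X b \<and> close_pairs e f b \<and>
    (\<forall>i. continuous_on unit_square (v i) \<and> (\<forall>z\<in>unit_square. \<bar>v i z - h i z\<bar> \<le> 3)) \<and>
    (\<forall>z\<in>unit_square. \<forall>z'\<in>unit_square. b True z = b False z' \<longrightarrow> v True z \<noteq> v False z')"
proof -
  have dpp: "disjoint_paths_property X" by (rule DCP_imp_disjoint_paths[OF dcp])
  define \<sigma> where "\<sigma> i = (if i then 1/2 else 0 :: real)" for i
  have ch: "continuous_on unit_square (\<lambda>z. h i z - \<sigma> i)" for i by (intro continuous_intros h)
  have "\<exists>P. continuous_on UNIV (fst P) \<and> (\<forall>z\<in>unit_square. \<bar>fst P z - (h i z - \<sigma> i)\<bar> \<le> 1) \<and>
     0 < fst (snd P) \<and> 0 < snd (snd P) \<and>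
     (\<forall>z0. z0 \<in> unit_square \<and> infdist (fst P z0) \<int> \<le> snd (snd P) \<longrightarrow>
       inj_on (\<lambda>z. (fst z, fst P z)) (cball z0 (fst (snd P))) \<or> inj_on (\<lambda>z. (snd z, fst P z)) (cball z0 (fst (snd P))))"
    for i
  proof -
    obtain H \<rho> \<zeta> where "continuous_on UNIV H" "\<And>z. z \<in> unit_square \<Longrightarrow> \<bar>H z - (h i z - \<sigma> i)\<bar> \<le> 1" "0 < \<rho>" "0 < \<zeta>"
    "\<And>z0. z0 \<in> unit_square \<Longrightarrow> infdist (H z0) \<int> \<le> \<zeta> \<Longrightarrow>
       inj_on (\<lambda>z. (fst z, H z)) (cball z0 \<rho>) \<or> inj_on (\<lambda>z. (snd z, H z)) (cball z0 \<rho>)"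
      by (rule height_with_thin_levels[OF ch]) (rule that; assumption)
    then show ?thesis by (intro exI[of _ "(H, \<rho>, \<zeta>)"]) (simp del: mem_Times_iff)
  qed
  then have "\<exists>P. \<forall>i. continuous_on UNIV (fst (P i)) \<and> (\<forall>z\<in>unit_square. \<bar>fst (P i) z - (h i z - \<sigma> i)\<bar> \<le> 1) \<and>
     0 < fst (snd (P i)) \<and> 0 < snd (snd (P i)) \<and>
     (\<forall>z0. z0 \<in> unit_square \<and> infdist (fst (P i) z0) \<int> \<le> snd (snd (P i)) \<longrightarrow>
       inj_on (\<lambda>z. (fst z, fst (P i) z)) (cball z0 (fst (snd (P i)))) \<or>
       inj_on (\<lambda>z. (snd z, fst (P i) z)) (cball z0 (fst (snd (P i)))))" by (intro choice allI)
  then obtain P where P: "\<forall>i. continuous_on UNIV (fst (P i)) \<and> (\<forall>z\<in>unit_square. \<bar>fst (P i) z - (h i z - \<sigma> i)\<bar> \<le> 1) \<and>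
     0 < fst (snd (P i)) \<and> 0 < snd (snd (P i)) \<and>
     (\<forall>z0. z0 \<in> unit_square \<and> infdist (fst (P i) z0) \<int> \<le> snd (snd (P i)) \<longrightarrow>
       inj_on (\<lambda>z. (fst z, fst (P i) z)) (cball z0 (fst (snd (P i)))) \<or>
       inj_on (\<lambda>z. (snd z, fst (P i) z)) (cball z0 (fst (snd (P i)))))" ..
  define H where "H i = fst (P i)" for i
  define \<rho> where "\<rho> = min (fst (snd (P True))) (fst (snd (P False)))"
  define \<zeta>0 where "\<zeta>0 = min (snd (snd (P True))) (snd (snd (P False)))"
  have H: "continuous_on UNIV (H i)" "\<And>z. z \<in> unit_square \<Longrightarrow> \<bar>H i z - (h i z - \<sigma> i)\<bar> \<le> 1" for i
    using spec[OF P, of i] unfolding H_def by blast+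
  have Pp: "0 < fst (snd (P i))" "0 < snd (snd (P i))" for i using spec[OF P, of i] by blast+
  have \<rho>: "0 < \<rho>" "\<rho> \<le> fst (snd (P i))" and \<zeta>0: "0 < \<zeta>0" "\<zeta>0 \<le> snd (snd (P i))" for i
    using Pp unfolding \<rho>_def \<zeta>0_def by (cases i; simp)+
  have chart: "inj_on (\<lambda>z. (fst z, H i z)) (cball z0 \<rho>) \<or> inj_on (\<lambda>z. (snd z, H i z)) (cball z0 \<rho>)"
    if z0: "z0 \<in> unit_square" "infdist (H i z0) \<int> \<le> \<zeta>0" for i z0
  proof -
    have sub: "cball z0 \<rho> \<subseteq> cball z0 (fst (snd (P i)))" using \<rho>(2) by (rule subset_cball)
    have "infdist (fst (P i) z0) \<int> \<le> snd (snd (P i))" using z0(2) \<zeta>0(2)[of i] unfolding H_def by linarith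
    then have "inj_on (\<lambda>z. (fst z, H i z)) (cball z0 (fst (snd (P i)))) \<or>
       inj_on (\<lambda>z. (snd z, H i z)) (cball z0 (fst (snd (P i))))"
      using spec[OF P, of i] z0(1) unfolding H_def by blast
    then show ?thesis using inj_on_subset[OF _ sub] by blast
  qed
  have HQ: "continuous_on unit_square (H i)" for i by (rule continuous_on_subset[OF H(1)]) simp
  have cI: "continuous_on unit_square (\<lambda>z. infdist (H i z) \<int>)" for i by (intro continuous_intros HQ)
  have ZI: "(\<int> :: real set) \<noteq> {}" by auto
  have e2: "0 < e / 2" using e by simp
  have "\<exists>a \<S> E \<omega>. disk_pair X a \<and> close_pairs (e / 2) f a \<and> 0 < \<omega> \<and>
    finite \<S> \<and> \<Union>\<S> = unit_square \<and> (\<forall>S\<in>\<S>. compact S) \<and>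
    (\<forall>i. compact (E i) \<and> E i \<noteq> {} \<and> E i \<subseteq> unit_square \<and> {z \<in> unit_square. H i z \<in> \<int>} \<subseteq> E i \<and>
       (\<forall>S\<in>\<S>. \<forall>S'\<in>\<S>. S \<noteq> S' \<longrightarrow> S \<inter> S' \<subseteq> E i) \<and>
       (\<forall>S\<in>\<S>. \<forall>z\<in>S. \<forall>z'\<in>S. dist (a i z) (a i z') < 3 * \<omega> / 8) \<and>
       (\<forall>z\<in>unit_square. \<forall>z'\<in>unit_square. H i z \<in> \<int> \<longrightarrow> H i z' \<in> \<int> \<longrightarrow> \<rho> \<le> dist z z' \<longrightarrow>
          3 * \<omega> / 4 \<le> dist (a i z) (a i z'))) \<and>
    (\<forall>z\<in>E True. \<forall>z'\<in>E False. a True z \<noteq> a False z')"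
  proof (rule disks_in_general_position[OF X dpp f e2 H(1) \<rho>(1)])
    fix i z0 assume "z0 \<in> unit_square" "H i z0 \<in> \<int>"
    then show "inj_on (\<lambda>z. (fst z, H i z)) (cball z0 \<rho>) \<or> inj_on (\<lambda>z. (snd z, H i z)) (cball z0 \<rho>)"
      using \<zeta>0(1) by (intro chart) simp_all
  qed
  then obtain a \<S> E \<omega> where a: "disk_pair X a" "close_pairs (e / 2) f a" and \<omega>: "0 < \<omega>"
    and S: "finite \<S>" "\<Union>\<S> = unit_square" "\<forall>S\<in>\<S>. compact S"
    and E': "\<forall>i. compact (E i) \<and> E i \<noteq> {} \<and> E i \<subseteq> unit_square \<and> {z \<in> unit_square. H i z \<in> \<int>} \<subseteq> E i \<and>
       (\<forall>S\<in>\<S>. \<forall>S'\<in>\<S>. S \<noteq> S' \<longrightarrow> S \<inter> S' \<subseteq> E i) \<and>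
       (\<forall>S\<in>\<S>. \<forall>z\<in>S. \<forall>z'\<in>S. dist (a i z) (a i z') < 3 * \<omega> / 8) \<and>
       (\<forall>z\<in>unit_square. \<forall>z'\<in>unit_square. H i z \<in> \<int> \<longrightarrow> H i z' \<in> \<int> \<longrightarrow> \<rho> \<le> dist z z' \<longrightarrow>
          3 * \<omega> / 4 \<le> dist (a i z) (a i z'))"
    and sep: "\<forall>z\<in>E True. \<forall>z'\<in>E False. a True z \<noteq> a False z'"
    by (elim exE conjE) (rule that)
  have E: "compact (E i)" "E i \<noteq> {}" "E i \<subseteq> unit_square" "{z \<in> unit_square. H i z \<in> \<int>} \<subseteq> E i"
       "\<And>S S'. S \<in> \<S> \<Longrightarrow> S' \<in> \<S> \<Longrightarrow> S \<noteq> S' \<Longrightarrow> S \<inter> S' \<subseteq> E i"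
       "\<And>S z z'. S \<in> \<S> \<Longrightarrow> z \<in> S \<Longrightarrow> z' \<in> S \<Longrightarrow> dist (a i z) (a i z') < 3 * \<omega> / 8"
       "\<And>z z'. z \<in> unit_square \<Longrightarrow> z' \<in> unit_square \<Longrightarrow> H i z \<in> \<int> \<Longrightarrow> H i z' \<in> \<int> \<Longrightarrow> \<rho> \<le> dist z z' \<Longrightarrow>
          3 * \<omega> / 4 \<le> dist (a i z) (a i z')" for i
  proof -
    note 1 = spec[OF E', of i] note 2 = conjunct2[OF 1] note 3 = conjunct2[OF 2] note 4 = conjunct2[OF 3]
    note 5 = conjunct2[OF 4] note 6 = conjunct2[OF 5]
    show "compact (E i)" "E i \<noteq> {}" "E i \<subseteq> unit_square" "{z \<in> unit_square. H i z \<in> \<int>} \<subseteq> E i"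
      by (fact conjunct1[OF 1] conjunct1[OF 2] conjunct1[OF 3] conjunct1[OF 4])+
    show "S \<inter> S' \<subseteq> E i" if "S \<in> \<S>" "S' \<in> \<S>" "S \<noteq> S'" for S S'
      by (rule mp[OF bspec[OF bspec[OF conjunct1[OF 5] that(1)] that(2)] that(3)])
    show "dist (a i z) (a i z') < 3 * \<omega> / 8" if "S \<in> \<S>" "z \<in> S" "z' \<in> S" for S z z'
      by (rule bspec[OF bspec[OF bspec[OF conjunct1[OF 6] that(1)] that(2)] that(3)])
    show "3 * \<omega> / 4 \<le> dist (a i z) (a i z')"
      if "z \<in> unit_square" "z' \<in> unit_square" "H i z \<in> \<int>" "H i z' \<in> \<int>" "\<rho> \<le> dist z z'" for z z'
      by (rule mp[OF mp[OF mp[OF bspec[OF bspec[OF conjunct2[OF 6] that(1)] that(2)] that(3)] that(4)] that(5)])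
  qed
  have ca: "continuous_on unit_square (a i)" for i using a(1) unfolding disk_pair_def by blast
  have cQQ: "compact (unit_square \<times> unit_square)" by (intro compact_Times compact_unit_square)
  have clE: "closed (E i)" for i by (rule compact_imp_closed[OF E(1)])
  \<comment> \<open>The walls have disjoint images, so points of the two disks at distance less than \<open>\<xi> = \<mu> / 4\<close>
    from the walls have images at distance at least \<open>\<mu> / 2\<close>, and \<open>\<epsilon>\<close> is the admissible change in
    \<open>X\<close>.\<close>
  have cda: "continuous_on (unit_square \<times> unit_square) (\<lambda>p. dist (a i (fst p)) (a j (snd p)))" for i j
    by (intro continuous_intros continuous_on_compose2[OF ca]) auto
  have cmu: "continuous_on (unit_square \<times> unit_square)
      (\<lambda>p. infdist (fst p) (E True) + infdist (snd p) (E False) + dist (a True (fst p)) (a False (snd p)))"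
    by (intro continuous_on_add cda continuous_intros)
  have pmu: "0 < infdist (fst p) (E True) + infdist (snd p) (E False) + dist (a True (fst p)) (a False (snd p))" for p
  proof (rule ccontr)
    assume "\<not> ?thesis"
    then have "infdist (fst p) (E True) = 0" "infdist (snd p) (E False) = 0" "dist (a True (fst p)) (a False (snd p)) = 0"
      using infdist_nonneg[of "fst p" "E True"] infdist_nonneg[of "snd p" "E False"]
        zero_le_dist[of "a True (fst p)" "a False (snd p)"] by linarith+
    then show False
      using sep in_closed_iff_infdist_zero[OF clE E(2)] by auto
  qed
  obtain \<mu> where \<mu>: "0 < \<mu>" "\<And>p. p \<in> unit_square \<times> unit_square \<Longrightarrow>
      \<mu> \<le> infdist (fst p) (E True) + infdist (snd p) (E False) + dist (a True (fst p)) (a False (snd p))"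
    by (rule compact_pos_lower_bound[OF cQQ cmu pmu]) (rule that; assumption)
  define \<xi> where "\<xi> = \<mu> / 4"
  have \<xi>: "0 < \<xi>" using \<mu>(1) unfolding \<xi>_def by simp
  define \<epsilon> where "\<epsilon> = min (\<mu> / 4) (min (\<omega> / 32) (e / 2))"
  have \<epsilon>: "0 < \<epsilon>" "\<epsilon> \<le> \<mu> / 4" "\<epsilon> \<le> \<omega> / 32" "\<epsilon> \<le> e / 2" using \<mu>(1) \<omega> e unfolding \<epsilon>_def by auto
  \<comment> \<open>A bound \<open>\<zeta>\<close> is needed such that points at distance at least \<open>\<xi>\<close> from the walls have heights
    farther than \<open>\<zeta>\<close> from the integers, and points with heights within \<open>\<zeta>\<close> of the integers and
    with nearby images have distance less than \<open>\<rho>\<close>. Compactness reduces both to integer heights.\<close>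
  have "\<exists>n>0. (\<forall>z\<in>unit_square. \<xi> \<le> infdist z (E i) \<longrightarrow> n \<le> infdist (H i z) \<int>) \<and>
     (\<forall>z\<in>unit_square. \<forall>z'\<in>unit_square. \<rho> \<le> dist z z' \<longrightarrow> dist (a i z) (a i z') \<le> \<omega> / 2 \<longrightarrow>
        n \<le> infdist (H i z) \<int> + infdist (H i z') \<int>)" for i
  proof -
    have zero: "infdist (H i z) \<int> = 0 \<longleftrightarrow> H i z \<in> \<int>" for z
      using in_closed_iff_infdist_zero[OF closed_Ints ZI] by blast
    have cK: "compact (unit_square \<inter> (\<lambda>z. infdist z (E i)) -` {\<xi>..})" (is "compact ?K")
      by (rule closedin_compact[OF compact_unit_square continuous_closedin_preimage])
         (auto intro!: continuous_intros)
    have cf: "continuous_on ?K (\<lambda>z. infdist (H i z) \<int>)" by (rule continuous_on_subset[OF cI]) blast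
    have pf: "0 < infdist (H i z) \<int>" if "z \<in> ?K" for z
    proof -
      have "z \<notin> E i" using that \<xi> by auto
      then have "H i z \<notin> \<int>" using E(4)[of i] that by blast
      then show ?thesis using zero[of z] infdist_nonneg[of "H i z" \<int>] by linarith
    qed
    obtain n1 where n1: "0 < n1" "\<And>z. z \<in> ?K \<Longrightarrow> n1 \<le> infdist (H i z) \<int>"
      by (rule compact_pos_lower_bound[OF cK cf pf]) (assumption, rule that)
    let ?L = "unit_square \<times> unit_square \<inter> (\<lambda>p. (dist (fst p) (snd p), dist (a i (fst p)) (a i (snd p)))) -` ({\<rho>..} \<times> {..\<omega> / 2})"
    have cL: "compact ?L"
      by (rule closedin_compact[OF cQQ continuous_closedin_preimage])
         (intro continuous_on_Pair cda continuous_intros, intro closed_Times closed_atLeast closed_atMost)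
    have cg: "continuous_on ?L (\<lambda>p. infdist (H i (fst p)) \<int> + infdist (H i (snd p)) \<int>)"
    proof (rule continuous_on_subset[of "unit_square \<times> unit_square"])
      show "continuous_on (unit_square \<times> unit_square) (\<lambda>p. infdist (H i (fst p)) \<int> + infdist (H i (snd p)) \<int>)"
        by (intro continuous_intros continuous_on_compose2[OF HQ]) auto
    qed blast
    have pg: "0 < infdist (H i (fst p)) \<int> + infdist (H i (snd p)) \<int>" if p: "p \<in> ?L" for p
    proof (rule ccontr)
      assume "\<not> ?thesis"
      then have "infdist (H i (fst p)) \<int> = 0" "infdist (H i (snd p)) \<int> = 0"
        using infdist_nonneg[of "H i (fst p)" \<int>] infdist_nonneg[of "H i (snd p)" \<int>] by linarith+
      then have "H i (fst p) \<in> \<int>" "H i (snd p) \<in> \<int>" using zero by blast+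
      moreover have "fst p \<in> unit_square" "snd p \<in> unit_square" "\<rho> \<le> dist (fst p) (snd p)"
        "dist (a i (fst p)) (a i (snd p)) \<le> \<omega> / 2" using p by (auto simp only: mem_Times_iff Int_iff vimage_eq atLeast_iff atMost_iff fst_conv snd_conv)
      ultimately have "3 * \<omega> / 4 \<le> \<omega> / 2" using E(7)[of "fst p" "snd p" i] by linarith
      then show False using \<omega> by simp
    qed
    obtain n2 where n2: "0 < n2" "\<And>p. p \<in> ?L \<Longrightarrow> n2 \<le> infdist (H i (fst p)) \<int> + infdist (H i (snd p)) \<int>"
      by (rule compact_pos_lower_bound[OF cL cg pg]) (assumption, rule that)
    show ?thesis
    proof (rule exI[of _ "min n1 n2"], intro conjI ballI impI)
      show "0 < min n1 n2" using n1(1) n2(1) by simp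
      show "min n1 n2 \<le> infdist (H i z) \<int>" if "z \<in> unit_square" "\<xi> \<le> infdist z (E i)" for z
        using n1(2)[of z] that by (intro min.coboundedI1) blast
      show "min n1 n2 \<le> infdist (H i z) \<int> + infdist (H i z') \<int>"
        if "z \<in> unit_square" "z' \<in> unit_square" "\<rho> \<le> dist z z'" "dist (a i z) (a i z') \<le> \<omega> / 2" for z z'
      proof -
        have "(z, z') \<in> ?L"
          using that by (simp only: Int_iff mem_Times_iff vimage_eq fst_conv snd_conv atLeast_iff atMost_iff simp_thms)
        from n2(2)[OF this] show ?thesis by simp
      qed
    qed
  qed
  then have "\<exists>n. \<forall>i. 0 < n i \<and> (\<forall>z\<in>unit_square. \<xi> \<le> infdist z (E i) \<longrightarrow> n i \<le> infdist (H i z) \<int>) \<and>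
     (\<forall>z\<in>unit_square. \<forall>z'\<in>unit_square. \<rho> \<le> dist z z' \<longrightarrow> dist (a i z) (a i z') \<le> \<omega> / 2 \<longrightarrow>
        n i \<le> infdist (H i z) \<int> + infdist (H i z') \<int>)" by (intro choice allI)
  then obtain n where n: "\<forall>i. 0 < n i \<and> (\<forall>z\<in>unit_square. \<xi> \<le> infdist z (E i) \<longrightarrow> n i \<le> infdist (H i z) \<int>) \<and>
     (\<forall>z\<in>unit_square. \<forall>z'\<in>unit_square. \<rho> \<le> dist z z' \<longrightarrow> dist (a i z) (a i z') \<le> \<omega> / 2 \<longrightarrow>
        n i \<le> infdist (H i z) \<int> + infdist (H i z') \<int>)" ..
  have npos: "0 < n i" for i by (rule conjunct1[OF spec[OF n]])
  define \<zeta> where "\<zeta> = min (min (1/4) \<zeta>0) (min (n True / 3) (n False / 3))"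
  have \<zeta>: "0 < \<zeta>" "\<zeta> \<le> 1/4" "\<zeta> \<le> \<zeta>0" "\<zeta> \<le> n i / 3" for i
    using \<zeta>0(1) npos unfolding \<zeta>_def by (simp_all, cases i) simp_all
  have thin: "\<zeta> < infdist (H i z) \<int>" if "z \<in> unit_square" "\<xi> \<le> infdist z (E i)" for i z
  proof -
    have "n i \<le> infdist (H i z) \<int>" using spec[OF n, of i] that by blast
    then show ?thesis using \<zeta>(4)[of i] npos[of i] by linarith
  qed
  have close: "dist z z' < \<rho>"
    if z: "z \<in> unit_square" "z' \<in> unit_square" "infdist (H i z) \<int> \<le> \<zeta>" "infdist (H i z') \<int> \<le> \<zeta>"
      "dist (a i z) (a i z') \<le> \<omega> / 2" for i z z'
  proof (rule ccontr)
    assume "\<not> ?thesis"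
    then have "n i \<le> infdist (H i z) \<int> + infdist (H i z') \<int>" using spec[OF n, of i] z(1,2,5) by force
    then show False using z(3,4) \<zeta>(4)[of i] npos[of i] by linarith
  qed
  have "\<exists>B. \<forall>z\<in>unit_square. \<bar>H i z\<bar> \<le> B" for i
  proof -
    have "bounded (H i ` unit_square)"
      by (intro compact_imp_bounded compact_continuous_image HQ compact_unit_square)
    then show ?thesis unfolding bounded_iff by (auto simp only: ball_simps real_norm_def)
  qed
  then obtain B where B: "\<forall>i. \<forall>z\<in>unit_square. \<bar>H i z\<bar> \<le> B i" by metis
  define M where "M = nat \<lceil>max (B True) (B False)\<rceil> + 2"
  have M: "\<bar>H i z\<bar> + 2 \<le> M" if "z \<in> unit_square" for i z
  proof -
    have "\<bar>H i z\<bar> \<le> B i" using B that by blast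
    also have "B i \<le> max (B True) (B False)" by (cases i) auto
    also have "\<dots> \<le> real (nat \<lceil>max (B True) (B False)\<rceil>)" by (rule real_nat_ceiling_ge)
    finally show ?thesis unfolding M_def by simp
  qed
  obtain s where s: "continuous_on UNIV s"
    "\<And>(k::int) (y::real). \<bar>k\<bar> \<le> M \<Longrightarrow> \<bar>y - k\<bar> \<le> \<zeta> \<Longrightarrow> s y = k + (y - k) / (2 * \<zeta>)"
    "\<And>(k::int) (y::real). - int M \<le> k \<Longrightarrow> k < M \<Longrightarrow> k + \<zeta> \<le> y \<Longrightarrow> y \<le> k + 1 - \<zeta> \<Longrightarrow> s y = k + 1/2"
    by (rule staircase[OF \<zeta>(1,2), of M]) (rule that; assumption)
  have s_near: "\<exists>m::int. \<bar>H i z - m\<bar> \<le> \<zeta> \<and> s (H i z) = m + (H i z - m) / (2 * \<zeta>)"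
    if z: "z \<in> unit_square" "infdist (H i z) \<int> \<le> \<zeta>" for i z
  proof -
    obtain m :: int where m: "\<bar>H i z - m\<bar> \<le> \<zeta>" by (rule near_integer[OF z(2)])
    then have "\<bar>m\<bar> \<le> M" using M[OF z(1), of i] \<zeta>(2) by linarith
    then show ?thesis using s(2) m by blast
  qed
  have s_far: "s (H i z) = \<lfloor>H i z\<rfloor> + 1/2"
    if "z \<in> unit_square" "\<zeta> < infdist (H i z) \<int>" for i z
  proof -
    have "- int M \<le> \<lfloor>H i z\<rfloor>" "\<lfloor>H i z\<rfloor> < M" using M[OF that(1), of i] by linarith+
    then show ?thesis using far_from_integers[OF that(2)] by (intro s(3)) auto
  qed
  have s_close: "\<bar>s (H i z) - H i z\<bar> \<le> 1" if z: "z \<in> unit_square" for i z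
  proof (cases "infdist (H i z) \<int> \<le> \<zeta>")
    case True
    then obtain m :: int where m: "\<bar>H i z - m\<bar> \<le> \<zeta>" "s (H i z) = m + (H i z - m) / (2 * \<zeta>)"
      using s_near[OF z] by blast
    have "\<bar>(H i z - m) / (2 * \<zeta>)\<bar> \<le> 1/2" using m(1) \<zeta>(1) by (simp add: field_simps abs_divide)
    then show ?thesis using m \<zeta>(2) by linarith
  next
    case False
    then show ?thesis using s_far[OF z, of i] by linarith
  qed
  have "(0, 0) \<in> \<Union>\<S>" unfolding S(2) by simp
  then have "\<S> \<noteq> {}" by blast
  then obtain os and \<eta> :: real where os: "0 < \<eta>" "\<eta> \<le> 1/100" "\<And>S. S \<in> \<S> \<Longrightarrow> 0 < os S" "\<And>S. S \<in> \<S> \<Longrightarrow> os S \<le> 1/8"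
    "\<And>S S'. S \<in> \<S> \<Longrightarrow> S' \<in> \<S> \<Longrightarrow> S \<noteq> S' \<Longrightarrow> 10 * \<eta> < \<bar>os S - os S'\<bar>"
    by (rule separated_offsets[OF S(1)]) (rule that; assumption)
  \<comment> \<open>The bump vanishes near integer levels (\<open>None\<close>) and equals the offset on each cell away from
    the walls (\<open>Some S\<close>). These closed sets are pairwise disjoint, as different cells meet in
    walls only.\<close>
  have "\<exists>b. continuous_on unit_square b \<and> (\<forall>z\<in>unit_square. \<bar>b z\<bar> \<le> 1/8) \<and>
     (\<forall>z\<in>unit_square. infdist (H i z) \<int> \<le> \<zeta> \<longrightarrow> b z = 0) \<and>
     (\<forall>S\<in>\<S>. \<forall>z\<in>S. \<xi> \<le> infdist z (E i) \<longrightarrow> b z = os S)" for i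
  proof -
    define D where "D p = (case p of None \<Rightarrow> {z \<in> unit_square. infdist (H i z) \<int> \<le> \<zeta>}
        | Some S \<Rightarrow> {z \<in> S. \<xi> \<le> infdist z (E i)})" for p
    define t where "t p = (case p of None \<Rightarrow> 0 | Some S \<Rightarrow> os S)" for p
    define I where "I = insert None (Some ` \<S>)"
    have I: "finite I" unfolding I_def using S(1) by simp
    have cD: "compact (D p)" "D p \<subseteq> unit_square" if "p \<in> I" for p
    proof -
      have "compact (D p) \<and> D p \<subseteq> unit_square"
      proof (cases p)
        case None
        have eq: "D p = unit_square \<inter> (\<lambda>z. infdist (H i z) \<int>) -` {..\<zeta>}" unfolding D_def None by auto
        show ?thesis unfolding eq
          by (rule conjI, rule closedin_compact[OF compact_unit_square continuous_closedin_preimage[OF cI closed_atMost]]) blast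
      next
        case (Some S')
        then have S': "S' \<in> \<S>" using that unfolding I_def by auto
        have eq: "D p = S' \<inter> (\<lambda>z. infdist z (E i)) -` {\<xi>..}" unfolding D_def Some by auto
        have "continuous_on S' (\<lambda>z. infdist z (E i))" by (intro continuous_intros)
        from closedin_compact[OF bspec[OF S(3) S'] continuous_closedin_preimage[OF this closed_atLeast]]
        show ?thesis unfolding eq using S(2) S' by blast
      qed
      then show "compact (D p)" "D p \<subseteq> unit_square" by blast+
    qed
    have agree: "p = p'" if p: "p \<in> I" "p' \<in> I" "z \<in> D p" "z \<in> D p'" for p p' z
    proof -
      have zQ: "z \<in> unit_square" using cD(2)[OF p(1)] p(3) by blast
      have no: False if "z \<in> D None" "z \<in> D (Some S')" for S'
        using that thin[OF zQ, of i] unfolding D_def by simp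
      have eq: "S1 = S2" if "z \<in> D (Some S1)" "z \<in> D (Some S2)" "S1 \<in> \<S>" "S2 \<in> \<S>" for S1 S2
      proof (rule ccontr)
        assume "S1 \<noteq> S2"
        then have "z \<in> E i" using E(5)[OF that(3,4)] that(1,2) unfolding D_def by auto
        then have "infdist z (E i) = 0" by simp
        then show False using that(1) \<xi> unfolding D_def by simp
      qed
      show ?thesis
        using p no eq unfolding I_def by (cases p; cases p') auto
    qed
    obtain g :: "real \<times> real \<Rightarrow> real" where g: "continuous_on (\<Union>p\<in>I. D p) g" "\<And>p z. p \<in> I \<Longrightarrow> z \<in> D p \<Longrightarrow> g z = t p"
    proof (rule finite_closed_pasting[where I = I and B = D and f = "\<lambda>p z. t p", OF I])
      show "closed (D p)" if "p \<in> I" for p by (rule compact_imp_closed[OF cD(1)[OF that]])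
      show "t p = t p'" if "p \<in> I" "p' \<in> I" "z \<in> D p" "z \<in> D p'" for p p' z using agree[OF that] by simp
    qed (rule continuous_on_const | (rule that; assumption))+
    have cU: "compact (\<Union>p\<in>I. D p)" by (rule compact_UN[OF I cD(1)])
    have cl: "closedin (top_of_set unit_square) (\<Union>p\<in>I. D p)"
      by (rule closed_subset[OF UN_least[OF cD(2)] compact_imp_closed[OF cU]])
    have tb: "\<bar>t p\<bar> \<le> 1/8" if "p \<in> I" for p
      using that os(3,4) unfolding t_def I_def by (auto simp: less_imp_le)
    have nb: "norm (g z) \<le> 1/8" if z: "z \<in> (\<Union>p\<in>I. D p)" for z
      using z
    proof (elim UN_E)
      fix p assume "p \<in> I" "z \<in> D p"
      then show ?thesis using g(2) tb by simp
    qed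
    have e8: "0 \<le> (1/8 :: real)" by simp
    obtain b where b: "continuous_on unit_square b" "\<And>z. z \<in> (\<Union>p\<in>I. D p) \<Longrightarrow> b z = g z"
      "\<And>z. z \<in> unit_square \<Longrightarrow> norm (b z) \<le> 1/8"
      by (rule Tietze[OF g(1) cl e8 nb]) (assumption, rule that)
    have bt: "b z = t p" if "p \<in> I" "z \<in> D p" for p z
      using b(2)[OF UN_I[where B = D, OF that]] g(2)[OF that] by simp
    show ?thesis
    proof (rule exI[of _ b], intro conjI ballI impI b(1))
      show "\<bar>b z\<bar> \<le> 1/8" if "z \<in> unit_square" for z using b(3)[OF that] by simp
      show "b z = 0" if "z \<in> unit_square" "infdist (H i z) \<int> \<le> \<zeta>" for z
        using bt[of None z] that unfolding I_def D_def t_def by simp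
      show "b z = os S'" if "S' \<in> \<S>" "z \<in> S'" "\<xi> \<le> infdist z (E i)" for S' z
        using bt[of "Some S'" z] that unfolding I_def D_def t_def by simp
    qed
  qed
  then have "\<exists>b. \<forall>i. continuous_on unit_square (b i) \<and> (\<forall>z\<in>unit_square. \<bar>b i z\<bar> \<le> 1/8) \<and>
     (\<forall>z\<in>unit_square. infdist (H i z) \<int> \<le> \<zeta> \<longrightarrow> b i z = 0) \<and>
     (\<forall>S\<in>\<S>. \<forall>z\<in>S. \<xi> \<le> infdist z (E i) \<longrightarrow> b i z = os S)" by (intro choice allI)
  then obtain bump where bump': "\<forall>i. continuous_on unit_square (bump i) \<and> (\<forall>z\<in>unit_square. \<bar>bump i z\<bar> \<le> 1/8) \<and>
     (\<forall>z\<in>unit_square. infdist (H i z) \<int> \<le> \<zeta> \<longrightarrow> bump i z = 0) \<and>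
     (\<forall>S\<in>\<S>. \<forall>z\<in>S. \<xi> \<le> infdist z (E i) \<longrightarrow> bump i z = os S)" ..
  have bump: "continuous_on unit_square (bump i)" "\<And>z. z \<in> unit_square \<Longrightarrow> \<bar>bump i z\<bar> \<le> 1/8"
     "\<And>z. z \<in> unit_square \<Longrightarrow> infdist (H i z) \<int> \<le> \<zeta> \<Longrightarrow> bump i z = 0"
     "\<And>S z. S \<in> \<S> \<Longrightarrow> z \<in> S \<Longrightarrow> \<xi> \<le> infdist z (E i) \<Longrightarrow> bump i z = os S" for i
  proof -
    note 1 = spec[OF bump', of i] note 2 = conjunct2[OF 1] note 3 = conjunct2[OF 2]
    show "continuous_on unit_square (bump i)" by (rule conjunct1[OF 1])
    show "\<bar>bump i z\<bar> \<le> 1/8" if "z \<in> unit_square" for z by (rule bspec[OF conjunct1[OF 2] that])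
    show "bump i z = 0" if "z \<in> unit_square" "infdist (H i z) \<int> \<le> \<zeta>" for z
      by (rule mp[OF bspec[OF conjunct1[OF 3] that(1)] that(2)])
    show "bump i z = os S" if "S \<in> \<S>" "z \<in> S" "\<xi> \<le> infdist z (E i)" for S z
      by (rule mp[OF bspec[OF bspec[OF conjunct2[OF 3] that(1)] that(2)] that(3)])
  qed
  define u where "u i z = s (H i z) + \<sigma> i + bump i z" for i z
  have cu: "continuous_on unit_square (u i)" for i
    unfolding u_def by (intro continuous_intros bump(1) continuous_on_compose2[OF s(1) HQ]) auto
  define J where "J i = \<S> \<times> {- int M..int M}" for i :: bool
  define c where "c i j = (case j of (S, k) \<Rightarrow> of_int k + 1/2 + \<sigma> i + os S)" for i and j :: "(real \<times> real) set \<times> int"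
  define K where "K i j = (case j of (S, k) \<Rightarrow> {z \<in> S. \<xi> \<le> infdist z (E i) \<and> of_int k \<le> H i z \<and> H i z \<le> of_int k + 1})"
    for i and j :: "(real \<times> real) set \<times> int"
  \<comment> \<open>the integer level of the other disk whose ramp has its middle just below the plateau of disk
    \<open>i\<close> above \<open>k\<close>\<close>
  define \<kappa> where "\<kappa> i k = (if i then k + 1 else k)" for i and k :: int
  have c\<kappa>: "c i (S', k) = \<kappa> i k + \<sigma> (\<not> i) + os S'" for i S' k
    unfolding c_def \<kappa>_def \<sigma>_def by simp
  have slab: "infdist (H (\<not> i) z) \<int> \<le> \<zeta> \<and> H (\<not> i) z = \<kappa> i k + 2 * \<zeta> * (u (\<not> i) z - \<sigma> (\<not> i) - \<kappa> i k)"
    if S': "S' \<in> \<S>" and z: "z \<in> unit_square" and u: "\<bar>u (\<not> i) z - c i (S', k)\<bar> \<le> \<eta>" for i S' k z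
  proof -
    have o: "0 < os S'" "os S' \<le> 1/8" using os(3,4)[OF S'] .
    have near: "infdist (H (\<not> i) z) \<int> \<le> \<zeta>"
    proof (rule ccontr)
      assume "\<not> ?thesis"
      then have "s (H (\<not> i) z) = \<lfloor>H (\<not> i) z\<rfloor> + 1/2" using s_far[OF z] by simp
      then have "u (\<not> i) z - c i (S', k) = of_int (\<lfloor>H (\<not> i) z\<rfloor> - \<kappa> i k) + 1/2 + bump (\<not> i) z - os S'"
        unfolding u_def c\<kappa> by simp
      moreover have "1/2 \<le> \<bar>real_of_int (\<lfloor>H (\<not> i) z\<rfloor> - \<kappa> i k) + 1/2\<bar>" by (rule half_integer_abs)
      ultimately show False using u bump(2)[OF z, of "\<not> i"] o os(2) by linarith
    qed
    obtain m :: int where m: "\<bar>H (\<not> i) z - m\<bar> \<le> \<zeta>" "s (H (\<not> i) z) = m + (H (\<not> i) z - m) / (2 * \<zeta>)"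
      using s_near[OF z near] by blast
    have b: "\<bar>(H (\<not> i) z - m) / (2 * \<zeta>)\<bar> \<le> 1/2" using m(1) \<zeta>(1) by (simp add: field_simps abs_divide)
    have uz: "u (\<not> i) z = m + (H (\<not> i) z - m) / (2 * \<zeta>) + \<sigma> (\<not> i)"
      unfolding u_def m(2) using bump(3)[OF z near] by simp
    then have "u (\<not> i) z - c i (S', k) = real_of_int (m - \<kappa> i k) + (H (\<not> i) z - m) / (2 * \<zeta>) - os S'"
      unfolding c\<kappa> by simp
    then have "\<bar>real_of_int (m - \<kappa> i k)\<bar> < 1" using u b o os(2) by linarith
    then have "m = \<kappa> i k" by linarith
    then have "H (\<not> i) z = \<kappa> i k + 2 * \<zeta> * (u (\<not> i) z - \<sigma> (\<not> i) - \<kappa> i k)"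
      using uz \<zeta>(1) by (simp add: field_simps)
    then show ?thesis using near by blast
  qed
  \<comment> \<open>the points of the other disk whose images are near the image of \<open>S\<close>, close to an integer
    level: they lie in one chart\<close>
  define hit where "hit i S z' \<longleftrightarrow> z' \<in> unit_square \<and> infdist (H (\<not> i) z') \<int> \<le> \<zeta> \<and>
      (\<exists>z\<in>S. dist (a i z) (a (\<not> i) z') < 2 * \<epsilon>)" for i and S :: "(real \<times> real) set" and z' :: "real \<times> real"
  have "\<exists>P :: (real \<times> real) set \<times> (real \<times> real \<Rightarrow> real). compact (fst P) \<and> fst P \<subseteq> unit_square \<and> continuous_on (fst P) (snd P) \<and> snd P ` fst P \<subseteq> {0..1} \<and>
      inj_on (\<lambda>z. (snd P z, H (\<not> i) z)) (fst P) \<and> (\<forall>z'. hit i S' z' \<longrightarrow> z' \<in> fst P)"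
    if S': "S' \<in> \<S>" for i S'
  proof (cases "\<exists>z1. hit i S' z1")
    case False
    then show ?thesis by (intro exI[of _ "({}, fst)"]) auto
  next
    case True
    then obtain z1 where z1: "hit i S' z1" ..
    have Q1: "z1 \<in> unit_square" "infdist (H (\<not> i) z1) \<int> \<le> \<zeta>" using z1 unfolding hit_def by blast+
    let ?V = "unit_square \<inter> cball z1 \<rho>"
    have inV: "z' \<in> ?V" if z': "hit i S' z'" for z'
    proof -
      have Q': "z' \<in> unit_square" "infdist (H (\<not> i) z') \<int> \<le> \<zeta>" using z' unfolding hit_def by blast+
      obtain y where y: "y \<in> S'" "dist (a i y) (a (\<not> i) z1) < 2 * \<epsilon>" using z1 unfolding hit_def by blast
      obtain y' where y': "y' \<in> S'" "dist (a i y') (a (\<not> i) z') < 2 * \<epsilon>" using z' unfolding hit_def by blast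
      have "dist (a i y) (a i y') < 3 * \<omega> / 8" by (rule E(6)[OF S' y(1) y'(1)])
      then have "dist (a (\<not> i) z1) (a (\<not> i) z') \<le> \<omega> / 2"
        using y(2) y'(2) \<epsilon>(3) dist_triangle[of "a (\<not> i) z1" "a (\<not> i) z'" "a i y"]
          dist_triangle[of "a i y" "a (\<not> i) z'" "a i y'"] dist_commute[of "a (\<not> i) z1" "a i y"] by linarith
      then have "dist z1 z' < \<rho>" by (rule close[OF Q1(1) Q'(1) Q1(2) Q'(2)])
      then show ?thesis using Q'(1) by simp
    qed
    have cV: "compact ?V" by (intro compact_Int_closed compact_unit_square closed_cball)
    have "infdist (H (\<not> i) z1) \<int> \<le> \<zeta>0" using Q1(2) \<zeta>(3) by linarith
    from chart[OF Q1(1) this]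
    show ?thesis
    proof
      assume "inj_on (\<lambda>z. (fst z, H (\<not> i) z)) (cball z1 \<rho>)"
      then have i: "inj_on (\<lambda>z. (fst z, H (\<not> i) z)) ?V" by (rule inj_on_subset) blast
      have im: "fst ` ?V \<subseteq> {0..1}" by auto
      show ?thesis
        by (rule exI[of _ "(?V, fst)"], unfold fst_conv snd_conv, intro conjI allI impI)
           (rule cV Int_lower1 im i | intro continuous_intros | erule inV)+
    next
      assume "inj_on (\<lambda>z. (snd z, H (\<not> i) z)) (cball z1 \<rho>)"
      then have i: "inj_on (\<lambda>z. (snd z, H (\<not> i) z)) ?V" by (rule inj_on_subset) blast
      have im: "snd ` ?V \<subseteq> {0..1}" by auto
      show ?thesis
        by (rule exI[of _ "(?V, snd)"], unfold fst_conv snd_conv, intro conjI allI impI)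
           (rule cV Int_lower1 im i | intro continuous_intros | erule inV)+
    qed
  qed
  then have "\<forall>i S'. \<exists>P :: (real \<times> real) set \<times> (real \<times> real \<Rightarrow> real). S' \<in> \<S> \<longrightarrow> compact (fst P) \<and> fst P \<subseteq> unit_square \<and> continuous_on (fst P) (snd P) \<and>
      snd P ` fst P \<subseteq> {0..1} \<and> inj_on (\<lambda>z. (snd P z, H (\<not> i) z)) (fst P) \<and> (\<forall>z'. hit i S' z' \<longrightarrow> z' \<in> fst P)"
    by blast
  then have "\<exists>W :: bool \<Rightarrow> (real \<times> real) set \<Rightarrow> (real \<times> real) set \<times> (real \<times> real \<Rightarrow> real). \<forall>i S'. S' \<in> \<S> \<longrightarrow> compact (fst (W i S')) \<and> fst (W i S') \<subseteq> unit_square \<and>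
      continuous_on (fst (W i S')) (snd (W i S')) \<and> snd (W i S') ` fst (W i S') \<subseteq> {0..1} \<and>
      inj_on (\<lambda>z. (snd (W i S') z, H (\<not> i) z)) (fst (W i S')) \<and> (\<forall>z'. hit i S' z' \<longrightarrow> z' \<in> fst (W i S'))"
    unfolding choice_iff .
  then obtain W :: "bool \<Rightarrow> (real \<times> real) set \<Rightarrow> (real \<times> real) set \<times> (real \<times> real \<Rightarrow> real)" where W': "\<forall>i S'. S' \<in> \<S> \<longrightarrow> compact (fst (W i S')) \<and> fst (W i S') \<subseteq> unit_square \<and>
      continuous_on (fst (W i S')) (snd (W i S')) \<and> snd (W i S') ` fst (W i S') \<subseteq> {0..1} \<and>
      inj_on (\<lambda>z. (snd (W i S') z, H (\<not> i) z)) (fst (W i S')) \<and> (\<forall>z'. hit i S' z' \<longrightarrow> z' \<in> fst (W i S'))" ..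
  define V where "V i j = fst (W i (fst j))" for i and j :: "(real \<times> real) set \<times> int"
  define q where "q i j = snd (W i (fst j))" for i and j :: "(real \<times> real) set \<times> int"
  have Vq: "compact (V i j)" "V i j \<subseteq> unit_square" "continuous_on (V i j) (q i j)" "q i j ` V i j \<subseteq> {0..1}"
      "inj_on (\<lambda>z. (q i j z, H (\<not> i) z)) (V i j)" "\<And>z'. hit i (fst j) z' \<Longrightarrow> z' \<in> V i j"
    if "j \<in> J i" for i j
  proof -
    have "fst j \<in> \<S>" using that unfolding J_def by auto
    note W = mp[OF spec[OF spec[OF W', of i], of "fst j"] this, folded V_def q_def]
    show "compact (V i j)" "V i j \<subseteq> unit_square" "continuous_on (V i j) (q i j)" "q i j ` V i j \<subseteq> {0..1}"
      "inj_on (\<lambda>z. (q i j z, H (\<not> i) z)) (V i j)" "\<And>z'. hit i (fst j) z' \<Longrightarrow> z' \<in> V i j"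
      using W by blast+
  qed
  have inQ: "z \<in> unit_square" if "S' \<in> \<S>" "z \<in> S'" for S' z using S(2) that by blast
  have "\<exists>b v. disk_pair X b \<and> close_pairs \<epsilon> a b \<and>
    (\<forall>i. continuous_on unit_square (v i) \<and> (\<forall>z\<in>unit_square. \<bar>v i z - u i z\<bar> \<le> 2 * \<eta>)) \<and>
    (\<forall>z\<in>unit_square. \<forall>z'\<in>unit_square. b True z = b False z' \<longrightarrow> v True z \<noteq> v False z')"
  proof (rule concordance_assembly[where J = J and c = c and K = K and V = V and q = q, OF X dcp a(1) cu \<epsilon>(1) os(1)])
    fix i show "finite (J i)" unfolding J_def using S(1) by simp
  next
    fix i i' j j' assume j: "j \<in> J i" "j' \<in> J i'" "(i, j) \<noteq> (i', j')"
    obtain S1 k1 where 1: "j = (S1, k1)" "S1 \<in> \<S>" using j(1) unfolding J_def by auto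
    obtain S2 k2 where 2: "j' = (S2, k2)" "S2 \<in> \<S>" using j(2) unfolding J_def by auto
    have o: "0 < os S1" "os S1 \<le> 1/8" "0 < os S2" "os S2 \<le> 1/8" using os(3,4) 1(2) 2(2) by blast+
    have d: "c i j - c i' j' = of_int (k1 - k2) + (\<sigma> i - \<sigma> i') + (os S1 - os S2)" unfolding c_def 1 2 by simp
    show "10 * \<eta> < \<bar>c i j - c i' j'\<bar>"
    proof (cases "i = i'")
      case False
      then have "\<bar>of_int (k1 - k2) + (\<sigma> i - \<sigma> i')\<bar> \<ge> 1/2"
        using half_integer_abs[of "k1 - k2"] half_integer_abs[of "k1 - k2 - 1"]
        unfolding \<sigma>_def by (cases i; cases i'; simp)
      then show ?thesis using d o os(2) by linarith
    next
      case True
      show ?thesis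
      proof (cases "k1 = k2")
        case False
        then have "\<bar>of_int (k1 - k2) :: real\<bar> \<ge> 1" by linarith
        then show ?thesis using d o os(2) True by simp
      next
        case k: True
        then have "S1 \<noteq> S2" using j(3) True 1 2 by auto
        from os(5)[OF 1(2) 2(2) this] show ?thesis using d k True by simp
      qed
    qed
  next
    fix i j assume j: "j \<in> J i"
    obtain S1 k1 where 1: "j = (S1, k1)" "S1 \<in> \<S>" using j unfolding J_def by auto
    have S1Q: "S1 \<subseteq> unit_square" using 1(2) S(2) by blast
    have eq: "K i j = S1 \<inter> (\<lambda>z. (infdist z (E i), H i z)) -` ({\<xi>..} \<times> {of_int k1..of_int k1 + 1})"
      unfolding K_def 1 by auto
    have cc: "continuous_on S1 (\<lambda>z. (infdist z (E i), H i z))"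
      by (intro continuous_intros continuous_on_subset[OF HQ S1Q])
    have "closed ({\<xi>..} \<times> {real_of_int k1..real_of_int k1 + 1})" by (intro closed_Times closed_atLeast closed_atLeastAtMost)
    from closedin_compact[OF bspec[OF S(3) 1(2)] continuous_closedin_preimage[OF cc this]]
    show "compact (K i j)" unfolding eq .
    show "K i j \<subseteq> unit_square" unfolding eq using S1Q by blast
    show "compact (V i j)" "V i j \<subseteq> unit_square" "continuous_on (V i j) (q i j)" "q i j ` V i j \<subseteq> {0..1}"
      by (fact Vq[OF j])+
    show "u i z = c i j" if z: "z \<in> K i j" for z
    proof -
      have zK: "z \<in> S1" "\<xi> \<le> infdist z (E i)" "of_int k1 \<le> H i z" "H i z \<le> of_int k1 + 1"
        using z unfolding K_def 1 by auto
      have zQ: "z \<in> unit_square" using S1Q zK(1) by blast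
      have f: "\<zeta> < infdist (H i z) \<int>" by (rule thin[OF zQ zK(2)])
      have "\<lfloor>H i z\<rfloor> = k1" using zK(3,4) far_from_integers[OF f] \<zeta>(1) by linarith
      then have "s (H i z) = k1 + 1/2" using s_far[OF zQ f] by simp
      then show ?thesis unfolding u_def c_def 1 using bump(4)[OF 1(2) zK(1,2)] by simp
    qed
    show "inj_on (\<lambda>z. (q i j z, u (\<not> i) z)) {z \<in> V i j. \<bar>u (\<not> i) z - c i j\<bar> \<le> \<eta>}"
    proof (rule inj_onI)
      fix z z' assume z: "z \<in> {z \<in> V i j. \<bar>u (\<not> i) z - c i j\<bar> \<le> \<eta>}" "z' \<in> {z \<in> V i j. \<bar>u (\<not> i) z - c i j\<bar> \<le> \<eta>}"
        and eq: "(q i j z, u (\<not> i) z) = (q i j z', u (\<not> i) z')"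
      have Q: "z \<in> unit_square" "z' \<in> unit_square" using z Vq(2)[OF j] by blast+
      have "\<bar>u (\<not> i) z - c i (S1, k1)\<bar> \<le> \<eta>" "\<bar>u (\<not> i) z' - c i (S1, k1)\<bar> \<le> \<eta>" using z 1(1) by auto
      then have "H (\<not> i) z = H (\<not> i) z'"
        using slab[OF 1(2) Q(1), of i k1] slab[OF 1(2) Q(2), of i k1] eq by simp
      then show "z = z'" using inj_onD[OF Vq(5)[OF j], of z z'] eq z by simp
    qed
    show "z' \<in> V i j"
      if z: "z \<in> K i j" "z' \<in> unit_square" "\<bar>u (\<not> i) z' - c i j\<bar> \<le> \<eta>" "dist (a i z) (a (\<not> i) z') < 2 * \<epsilon>" for z z'
    proof (rule Vq(6)[OF j])
      have "z \<in> S1" using z(1) unfolding K_def 1 by auto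
      moreover have "infdist (H (\<not> i) z') \<int> \<le> \<zeta>" using slab[OF 1(2) z(2), of i k1] z(3) 1(1) by blast
      ultimately show "hit i (fst j) z'" unfolding hit_def 1 fst_conv using z(2,4) by blast
    qed
  next
    fix z z' assume z: "z \<in> unit_square" "z' \<in> unit_square"
      and n: "z \<notin> (\<Union>j\<in>J True. K True j)" "z' \<notin> (\<Union>j\<in>J False. K False j)"
    have wall: "infdist z (E i) < \<xi>" if z: "z \<in> unit_square" "z \<notin> (\<Union>j\<in>J i. K i j)" for i z
    proof (rule ccontr)
      assume x: "\<not> ?thesis"
      obtain S1 where S1: "S1 \<in> \<S>" "z \<in> S1" using z(1) S(2) by blast
      have "\<lfloor>H i z\<rfloor> \<in> {- int M..int M}" using M[OF z(1), of i] by simp linarith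
      then have "(S1, \<lfloor>H i z\<rfloor>) \<in> J i" unfolding J_def using S1(1) by simp
      moreover have "z \<in> K i (S1, \<lfloor>H i z\<rfloor>)" unfolding K_def using S1(2) x by simp
      ultimately show False using z(2) by blast
    qed
    have "\<mu> \<le> infdist z (E True) + infdist z' (E False) + dist (a True z) (a False z')"
      using \<mu>(2)[of "(z, z')"] z by (simp only: mem_Times_iff fst_conv snd_conv simp_thms)
    then show "2 * \<epsilon> \<le> dist (a True z) (a False z')"
      using wall[OF z(1) n(1)] wall[OF z(2) n(2)] \<epsilon>(2) unfolding \<xi>_def by linarith
  qed
  then obtain b v where b: "disk_pair X b" "close_pairs \<epsilon> a b"
    "\<forall>i. continuous_on unit_square (v i) \<and> (\<forall>z\<in>unit_square. \<bar>v i z - u i z\<bar> \<le> 2 * \<eta>)"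
    "\<forall>z\<in>unit_square. \<forall>z'\<in>unit_square. b True z = b False z' \<longrightarrow> v True z \<noteq> v False z'"
    by (elim exE conjE) (rule that)
  have "close_pairs (e / 2 + e / 2) f b" by (rule close_pairs_trans[OF a(2) close_pairs_mono[OF b(2) \<epsilon>(4)]])
  then have fb: "close_pairs e f b" by simp
  have vh: "\<bar>v i z - h i z\<bar> \<le> 3" if z: "z \<in> unit_square" for i z
  proof -
    have "\<bar>v i z - u i z\<bar> \<le> 2 * \<eta>" using b(3) z by blast
    then show ?thesis
      using H(2)[OF z, of i] s_close[OF z, of i] bump(2)[OF z, of i] os(2) unfolding u_def by linarith
  qed
  show ?thesis
    by (rule exI[of _ b], rule exI[of _ v], intro conjI allI ballI b(1) fb)
       (rule conjunct1[OF spec[OF b(3)]], erule vh, erule (1) bspec[OF bspec[OF b(4)]])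
qed

text \<open>The coarse version applies to the heights multiplied by \<open>8 / e\<close>: an error of 3 in the
  stretched heights is an error of \<open>3 * e / 8\<close> in the original ones, less than \<open>e / 2\<close>.\<close>

lemma DCP_imp_DDP:
  fixes X :: "'a::metric_space set"
  assumes X: "homeomorphic_to_ENR X" and dcp: "disjoint_path_concordances_property X"
  shows "disjoint_disks_property (X \<times> (UNIV :: real set))"
  unfolding disjoint_disks_property_def
proof (intro allI impI, elim conjE)
  fix f1 f2 :: "real \<times> real \<Rightarrow> 'a \<times> real" and e :: real
  assume f1: "continuous_on unit_square f1" "f1 ` unit_square \<subseteq> X \<times> UNIV"
    and f2: "continuous_on unit_square f2" "f2 ` unit_square \<subseteq> X \<times> UNIV" and e: "0 < e"
  define f where "f i = (if i then f1 else f2)" for i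
  have f: "continuous_on unit_square (f i)" "f i ` unit_square \<subseteq> X \<times> UNIV" for i
    using f1 f2 unfolding f_def by (cases i; simp only: if_True if_False)+
  define h where "h i z = 8 / e * snd (f i z)" for i z
  have dp: "disk_pair X (\<lambda>i z. fst (f i z))"
    unfolding disk_pair_def
  proof (intro allI conjI)
    show "continuous_on unit_square (\<lambda>z. fst (f i z))" for i by (intro continuous_intros f(1))
    show "(\<lambda>z. fst (f i z)) ` unit_square \<subseteq> X" for i using f(2)[of i] by fastforce
  qed
  have ch: "continuous_on unit_square (h i)" for i unfolding h_def by (intro continuous_intros f(1))
  have e2: "0 < e / 2" using e by simp
  obtain b :: "bool \<Rightarrow> real \<times> real \<Rightarrow> 'a" and v :: "bool \<Rightarrow> real \<times> real \<Rightarrow> real"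
    where b: "disk_pair X b" "close_pairs (e / 2) (\<lambda>i z. fst (f i z)) b"
    "\<forall>i. continuous_on unit_square (v i) \<and> (\<forall>z\<in>unit_square. \<bar>v i z - h i z\<bar> \<le> 3)"
    "\<forall>z\<in>unit_square. \<forall>z'\<in>unit_square. b True z = b False z' \<longrightarrow> v True z \<noteq> v False z'"
    using DCP_disjoint_disks_coarse[where h = h, OF X dcp dp ch e2] by (elim exE conjE) (rule that)
  define g where "g i z = (b i z, e / 8 * v i z)" for i z
  have cb: "continuous_on unit_square (b i)" "b i ` unit_square \<subseteq> X" for i
    using b(1) unfolding disk_pair_def by blast+
  have g: "continuous_on unit_square (g i)" "g i ` unit_square \<subseteq> X \<times> UNIV" for i
  proof -
    have "continuous_on unit_square (v i)" using b(3) by blast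
    then show "continuous_on unit_square (g i)" unfolding g_def by (intro continuous_intros cb(1))
    show "g i ` unit_square \<subseteq> X \<times> UNIV" unfolding g_def using cb(2)[of i] by blast
  qed
  have fg: "dist (f i z) (g i z) < e" if z: "z \<in> unit_square" for i z
  proof -
    have 1: "dist (fst (f i z)) (b i z) < e / 2" using b(2) z unfolding close_pairs_def by blast
    have "\<bar>v i z - h i z\<bar> \<le> 3" using b(3) z by blast
    then have "e / 8 * \<bar>v i z - h i z\<bar> \<le> e / 8 * 3" using e by (intro mult_left_mono) auto
    moreover have "e / 8 * \<bar>v i z - h i z\<bar> = \<bar>e / 8 * v i z - snd (f i z)\<bar>"
    proof -
      have "e / 8 * \<bar>v i z - h i z\<bar> = \<bar>e / 8 * (v i z - h i z)\<bar>" using e by (simp add: abs_mult)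
      also have "e / 8 * (v i z - h i z) = e / 8 * v i z - snd (f i z)"
        unfolding h_def using e by (simp add: right_diff_distrib)
      finally show ?thesis .
    qed
    ultimately have 2: "dist (snd (f i z)) (e / 8 * v i z) \<le> e / 8 * 3"
      by (simp add: dist_real_def abs_minus_commute)
    have "dist (f i z) (g i z) \<le> dist (fst (f i z)) (fst (g i z)) + dist (snd (f i z)) (snd (g i z))"
      unfolding dist_prod_def by (rule sqrt_sum_squares_le_sum) auto
    then show ?thesis using 1 2 e unfolding g_def by simp
  qed
  have "g True ` unit_square \<inter> g False ` unit_square = {}"
  proof (rule equals0I, elim IntE imageE)
    fix w z z' assume z: "w = g True z" "z \<in> unit_square" "w = g False z'" "z' \<in> unit_square"
    have "b True z = b False z'" "v True z = v False z'" using z(1,3) e unfolding g_def by auto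
    with b(4) z(2,4) show False by blast
  qed
  then show "\<exists>g1 g2. continuous_on unit_square g1 \<and> g1 ` unit_square \<subseteq> X \<times> UNIV \<and>
      continuous_on unit_square g2 \<and> g2 ` unit_square \<subseteq> X \<times> UNIV \<and>
      (\<forall>z\<in>unit_square. dist (f1 z) (g1 z) < e) \<and> (\<forall>z\<in>unit_square. dist (f2 z) (g2 z) < e) \<and>
      g1 ` unit_square \<inter> g2 ` unit_square = {}"
    using fg[of _ True] fg[of _ False] unfolding f_def if_True if_False
    by (intro exI[of _ "g True"] exI[of _ "g False"] conjI g ballI) (simp_all only: )
qed

theorem corollary3p5:
  fixes n :: nat and X :: "'a::metric_space set"
  assumes "n \<ge> 4" and "ENR_homology_manifold n X"
  shows "disjoint_path_concordances_property X \<longleftrightarrow>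
         disjoint_disks_property (X \<times> (UNIV :: real set))"
proof -
  have X: "homeomorphic_to_ENR X" using assms(2) unfolding ENR_homology_manifold_def by blast
  show ?thesis using DCP_imp_DDP[OF X] DDP_imp_DCP[OF X] by blast
qed

end
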